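(* Let $H$ be a directed planar graph with real arc lengths, $n$ vertices and no negative-length cycles, embedded in the plane. Let $r,g,b$ be three sites that lie on a single face $h$ of $H$, and assume every face of $H$ other than $h$ has exactly 3 vertices. Let $\omega$ assign a nonnegative additive weight to each of $r,g,b$. Suppose we are given a multiple-source shortest paths (MSSP) data structure for the sites $r,g,b$ in $H$ that answers each query in $D$ time. Then the trichromatic face $\tilde f$ of the additively weighted Voronoi diagram of $H$ with sites $\{r,g,b\}$ and weights $\omega$ can be found in $O(\log^2(|H|)\cdot D)$ time.
   Context: Shortest paths in $H$ are assumed unique. For a site $s$ and vertex $v$, the additive distance is $\omega(s)+\mathrm{dist}_H(s,v)$. The additively weighted Voronoi diagram with sites $S=\{r,g,b\}$ partitions $V(H)$ into cells $\mathrm{Vor}(s)$, $s\in S$, where $v\in\mathrm{Vor}(s)$ iff $s$ minimizes the additive distance to $v$; ties are broken consistently in favor of sites with larger weight, formally by reverse lexicographic order on $(\omega(s),s)$. A face of $H$ other than $h$ is trichromatic if its three vertices belong to three distinct Voronoi cells; with three sites there is at most one such face. The MSSP data structure represents the shortest path trees $T_r,T_g,T_b$ of $H$ rooted at the sites and their cotrees $T_r^*,T_g^*,T_b^*$ (the spanning trees of the dual $H^*$ formed by the duals of edges not in the respective primal tree, rooted at the dual vertex $h^*$), and supports, in $D$ time per query, distance queries from the root in the primal trees and standard tree queries (e.g. level-ancestor, ancestor, LCA queries) in these trees and cotrees. *)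

theory Defs
  imports
    "Graph_Theory.Graph_Theory"
    "HOL-Combinatorics.Orbits"
    "HOL-Library.Sublist"
    Complex_Main
begin

section \<open>Embedded directed graphs\<close>

text \<open>
  Every edge of the embedding consists of two darts, exchanged by \<open>twin\<close>.  The arcs of the
  directed graph \<open>graph\<close> are some of these darts, at least one of each edge; if both are
  arcs, their lengths are unrelated.  The functions \<open>tail\<close> and \<open>head\<close> of \<open>graph\<close> are also
  used on the darts that are not arcs.  The map \<open>rot\<close> sends a dart to the next one around
  its tail.  Faces are named by numbers: \<open>face a\<close> is the name of the face beside the dart \<open>a\<close>.
\<close>

record plane_digraph =
  graph :: "(nat, nat) pre_digraph"
  len :: "nat \<Rightarrow> real"
  darts :: "nat set"
  twin :: "nat \<Rightarrow> nat"
  rot :: "nat \<Rightarrow> nat"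
  face :: "nat \<Rightarrow> nat"

definition dart_graph :: "plane_digraph \<Rightarrow> (nat, nat) pre_digraph" where
  "dart_graph H = (graph H)\<lparr>arcs := darts H\<rparr>"

definition face_succ :: "plane_digraph \<Rightarrow> nat \<Rightarrow> nat" where
  "face_succ H = rot H \<circ> twin H"

definition faces :: "plane_digraph \<Rightarrow> nat set" where
  "faces H = face H ` darts H"

definition face_darts :: "plane_digraph \<Rightarrow> nat \<Rightarrow> nat set" where
  "face_darts H f = {a \<in> darts H. face H a = f}"

definition face_verts :: "plane_digraph \<Rightarrow> nat \<Rightarrow> nat set" where
  "face_verts H f = tail (graph H) ` face_darts H f"

text \<open>
  A rotation system embeds a connected graph in the sphere (equivalently, in the plane) iff
  Euler's formula \<open>V - E + F = 2\<close> holds; here \<open>E\<close> is half the number of darts.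
\<close>

definition embedded_in_plane :: "plane_digraph \<Rightarrow> bool" where
  "embedded_in_plane H \<longleftrightarrow>
     fin_digraph (dart_graph H) \<and>
     connected (dart_graph H) \<and>
     bidirected_digraph (dart_graph H) (twin H) \<and>
     arcs (graph H) \<subseteq> darts H \<and>
     (\<forall>a\<in>darts H. a \<in> arcs (graph H) \<or> twin H a \<in> arcs (graph H)) \<and>
     rot H permutes darts H \<and>
     (\<forall>v\<in>verts (graph H). out_arcs (dart_graph H) v \<noteq> {} \<longrightarrow>
        cyclic_on (rot H) (out_arcs (dart_graph H) v)) \<and>
     (\<forall>a\<in>darts H. face_darts H (face H a) = orbit (face_succ H) a) \<and>
     2 * card (verts (graph H)) + 2 * card (faces H) = card (darts H) + 4"

text \<open>The face has exactly three corners, and these are at three different vertices.\<close>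

definition triangular_face :: "plane_digraph \<Rightarrow> nat \<Rightarrow> bool" where
  "triangular_face H f \<longleftrightarrow> card (face_darts H f) = 3 \<and> card (face_verts H f) = 3"


section \<open>Distances and shortest paths\<close>

abbreviation cost :: "plane_digraph \<Rightarrow> nat list \<Rightarrow> real" where
  "cost H p \<equiv> wf_digraph.awalk_cost (len H) p"

definition dist_in :: "plane_digraph \<Rightarrow> nat \<Rightarrow> nat \<Rightarrow> ereal" where
  "dist_in H = wf_digraph.\<mu> (graph H) (len H)"

definition no_negative_cycle :: "plane_digraph \<Rightarrow> bool" where
  "no_negative_cycle H \<longleftrightarrow> (\<forall>p. pre_digraph.cycle (graph H) p \<longrightarrow> 0 \<le> cost H p)"

definition shortest_path :: "plane_digraph \<Rightarrow> nat \<Rightarrow> nat list \<Rightarrow> nat \<Rightarrow> bool" where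
  "shortest_path H u p v \<longleftrightarrow>
     pre_digraph.apath (graph H) u p v \<and> ereal (cost H p) = dist_in H u v"

definition unique_shortest_paths :: "plane_digraph \<Rightarrow> bool" where
  "unique_shortest_paths H \<longleftrightarrow>
     (\<forall>u v p q. shortest_path H u p v \<longrightarrow> shortest_path H u q v \<longrightarrow> p = q)"


section \<open>The additively weighted Voronoi diagram of three sites\<close>

datatype site = Red | Green | Blue

definition add_dist :: "plane_digraph \<Rightarrow> (site \<Rightarrow> nat) \<Rightarrow> (site \<Rightarrow> real) \<Rightarrow> site \<Rightarrow> nat \<Rightarrow> ereal" where
  "add_dist H S \<omega> s v = ereal (\<omega> s) + dist_in H (S s) v"

text \<open>Ties go to the site \<open>s\<close> whose pair \<open>(\<omega> s, S s)\<close> is lexicographically larger.\<close>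

definition Vor :: "plane_digraph \<Rightarrow> (site \<Rightarrow> nat) \<Rightarrow> (site \<Rightarrow> real) \<Rightarrow> site \<Rightarrow> nat set" where
  "Vor H S \<omega> s = {v \<in> verts (graph H). \<forall>t. t \<noteq> s \<longrightarrow>
      add_dist H S \<omega> s v < add_dist H S \<omega> t v \<or>
      add_dist H S \<omega> s v = add_dist H S \<omega> t v \<and>
        (\<omega> t < \<omega> s \<or> \<omega> t = \<omega> s \<and> S t < S s)}"

definition trichromatic ::
  "plane_digraph \<Rightarrow> nat \<Rightarrow> (site \<Rightarrow> nat) \<Rightarrow> (site \<Rightarrow> real) \<Rightarrow> nat \<Rightarrow> bool" where
  "trichromatic H h S \<omega> f \<longleftrightarrow> f \<in> faces H \<and> f \<noteq> h \<and>
     (\<exists>x y z. face_verts H f = {x, y, z} \<and>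
        x \<in> Vor H S \<omega> Red \<and> y \<in> Vor H S \<omega> Green \<and> z \<in> Vor H S \<omega> Blue)"


section \<open>Shortest path trees and their cotrees\<close>

text \<open>
  Both kinds of tree are digraphs that contain each of their edges in both directions.  In the
  cotree, the dart \<open>a\<close> leads from the face beside \<open>a\<close> to the face on the other side of the edge.
\<close>

definition tree_darts :: "plane_digraph \<Rightarrow> nat \<Rightarrow> nat set" where
  "tree_darts H u =
     {a. \<exists>v p. shortest_path H u p v \<and> (a \<in> set p \<or> twin H a \<in> set p)}"

datatype side = Primal | Cotree

fun tree_of :: "plane_digraph \<Rightarrow> side \<Rightarrow> nat \<Rightarrow> (nat, nat) pre_digraph" where
  "tree_of H Primal u =
     \<lparr>verts = verts (graph H), arcs = tree_darts H u,
      tail = tail (graph H), head = head (graph H)\<rparr>"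
| "tree_of H Cotree u =
     \<lparr>verts = faces H, arcs = darts H - tree_darts H u,
      tail = face H, head = face H \<circ> twin H\<rparr>"

text \<open>
  A reference dart \<open>d\<close>, with \<open>face H d = h\<close> and with the site as its tail, determines the
  tree, its root and, below, the order of the tree.
\<close>

fun dart_node :: "plane_digraph \<Rightarrow> side \<Rightarrow> nat \<Rightarrow> nat" where
  "dart_node H Primal a = tail (graph H) a"
| "dart_node H Cotree a = face H a"

fun next_dart :: "plane_digraph \<Rightarrow> side \<Rightarrow> nat \<Rightarrow> nat" where
  "next_dart H Primal a = rot H a"
| "next_dart H Cotree a = face_succ H a"

definition the_tree :: "plane_digraph \<Rightarrow> side \<Rightarrow> nat \<Rightarrow> (nat, nat) pre_digraph" where
  "the_tree H T d = tree_of H T (tail (graph H) d)"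

definition root_path :: "plane_digraph \<Rightarrow> side \<Rightarrow> nat \<Rightarrow> nat \<Rightarrow> nat list" where
  "root_path H T d x = (THE p. pre_digraph.apath (the_tree H T d) (dart_node H T d) p x)"

definition branch :: "plane_digraph \<Rightarrow> side \<Rightarrow> nat \<Rightarrow> nat \<Rightarrow> nat list" where
  "branch H T d x =
     pre_digraph.awalk_verts (the_tree H T d) (dart_node H T d) (root_path H T d x)"

definition ancestor :: "plane_digraph \<Rightarrow> side \<Rightarrow> nat \<Rightarrow> nat \<Rightarrow> nat \<Rightarrow> bool" where
  "ancestor H T d x y \<longleftrightarrow> x \<in> set (branch H T d y)"

text \<open>
  The trees are ordered by the embedding.  The Euler tour starts with the first dart of the
  tree among \<open>d\<close> and its successors around the root; after the dart \<open>a\<close> it continues with the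
  first dart of the tree that follows \<open>twin a\<close> around the head of \<open>a\<close>.  The preorder lists the
  nodes by their first visit (\<^const>\<open>remdups\<close> alone would keep the last one).
\<close>

definition first_tree_dart :: "plane_digraph \<Rightarrow> side \<Rightarrow> nat \<Rightarrow> nat \<Rightarrow> nat" where
  "first_tree_dart H T d a =
     (next_dart H T ^^ (LEAST k. (next_dart H T ^^ k) a \<in> arcs (the_tree H T d))) a"

definition tour_next :: "plane_digraph \<Rightarrow> side \<Rightarrow> nat \<Rightarrow> nat \<Rightarrow> nat" where
  "tour_next H T d a = first_tree_dart H T d (next_dart H T (twin H a))"

definition tour :: "plane_digraph \<Rightarrow> side \<Rightarrow> nat \<Rightarrow> nat list" where
  "tour H T d = map (\<lambda>k. (tour_next H T d ^^ k) (first_tree_dart H T d d))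
                    [0..<card (arcs (the_tree H T d))]"

definition preorder :: "plane_digraph \<Rightarrow> side \<Rightarrow> nat \<Rightarrow> nat list" where
  "preorder H T d =
     rev (remdups (rev (dart_node H T d # map (head (the_tree H T d)) (tour H T d))))"


section \<open>Programs with access to the graph and to the MSSP data structure\<close>

text \<open>
  A comparison-based real RAM with a fixed number of registers per program.  Natural numbers
  serve as vertices, darts, faces and counters; the only operations on them are addition,
  truncated subtraction and halving, and the only arithmetic on lengths is addition and
  subtraction.  The graph is accessible only by local steps from a known dart.  The data
  structure answers the queries \<open>Parent\<close> to \<open>Select\<close> and \<open>Dist\<close>, which name one of the three
  sites; the query \<open>Parent\<close> returns the dart that leads from the given node to its parent, and
  \<open>Rank\<close> and \<open>Select\<close> refer to positions in the preorder.
\<close>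

datatype nexp =
    NConst nat | NReg nat
  | NAdd nexp nexp | NSub nexp nexp | NHalf nexp
  | Tail nexp | Head nexp | Twin nexp | Rot nexp | Face nexp
  | Parent side site nexp
  | Depth side site nexp
  | LevelAncestor side site nexp nexp
  | IsAncestor side site nexp nexp
  | LCA side site nexp nexp
  | SubtreeSize side site nexp
  | Rank side site nexp
  | Select side site nexp

datatype rexp =
    RReg nat | RAdd rexp rexp | RSub rexp rexp
  | Dist site nexp

datatype bexp =
    NLess nexp nexp | RLess rexp rexp | BNot bexp | BAnd bexp bexp

datatype com =
    Skip | NAssign nat nexp | RAssign nat rexp
  | Seq com com | If bexp com com | While bexp com

type_synonym state = "(nat \<Rightarrow> nat) \<times> (nat \<Rightarrow> real)"

text \<open>The parameter \<open>c\<close> gives the reference dart of each site.\<close>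

fun nval :: "plane_digraph \<Rightarrow> (site \<Rightarrow> nat) \<Rightarrow> nexp \<Rightarrow> state \<Rightarrow> nat" where
  "nval H c (NConst k) \<sigma> = k"
| "nval H c (NReg i) \<sigma> = fst \<sigma> i"
| "nval H c (NAdd e e') \<sigma> = nval H c e \<sigma> + nval H c e' \<sigma>"
| "nval H c (NSub e e') \<sigma> = nval H c e \<sigma> - nval H c e' \<sigma>"
| "nval H c (NHalf e) \<sigma> = nval H c e \<sigma> div 2"
| "nval H c (Tail e) \<sigma> = tail (graph H) (nval H c e \<sigma>)"
| "nval H c (Head e) \<sigma> = head (graph H) (nval H c e \<sigma>)"
| "nval H c (Twin e) \<sigma> = twin H (nval H c e \<sigma>)"
| "nval H c (Rot e) \<sigma> = rot H (nval H c e \<sigma>)"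
| "nval H c (Face e) \<sigma> = face H (nval H c e \<sigma>)"
| "nval H c (Parent T s e) \<sigma> = twin H (last (root_path H T (c s) (nval H c e \<sigma>)))"
| "nval H c (Depth T s e) \<sigma> = length (root_path H T (c s) (nval H c e \<sigma>))"
| "nval H c (LevelAncestor T s e e') \<sigma> = branch H T (c s) (nval H c e \<sigma>) ! nval H c e' \<sigma>"
| "nval H c (IsAncestor T s e e') \<sigma> =
     of_bool (ancestor H T (c s) (nval H c e \<sigma>) (nval H c e' \<sigma>))"
| "nval H c (LCA T s e e') \<sigma> =
     last (longest_common_prefix (branch H T (c s) (nval H c e \<sigma>))
                                 (branch H T (c s) (nval H c e' \<sigma>)))"
| "nval H c (SubtreeSize T s e) \<sigma> =
     card {y \<in> verts (the_tree H T (c s)). ancestor H T (c s) (nval H c e \<sigma>) y}"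
| "nval H c (Rank T s e) \<sigma> = (LEAST k. preorder H T (c s) ! k = nval H c e \<sigma>)"
| "nval H c (Select T s e) \<sigma> = preorder H T (c s) ! nval H c e \<sigma>"

fun rval :: "plane_digraph \<Rightarrow> (site \<Rightarrow> nat) \<Rightarrow> rexp \<Rightarrow> state \<Rightarrow> real" where
  "rval H c (RReg i) \<sigma> = snd \<sigma> i"
| "rval H c (RAdd e e') \<sigma> = rval H c e \<sigma> + rval H c e' \<sigma>"
| "rval H c (RSub e e') \<sigma> = rval H c e \<sigma> - rval H c e' \<sigma>"
| "rval H c (Dist s e) \<sigma> =
     real_of_ereal (dist_in H (tail (graph H) (c s)) (nval H c e \<sigma>))"

fun bval :: "plane_digraph \<Rightarrow> (site \<Rightarrow> nat) \<Rightarrow> bexp \<Rightarrow> state \<Rightarrow> bool" where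
  "bval H c (NLess e e') \<sigma> \<longleftrightarrow> nval H c e \<sigma> < nval H c e' \<sigma>"
| "bval H c (RLess e e') \<sigma> \<longleftrightarrow> rval H c e \<sigma> < rval H c e' \<sigma>"
| "bval H c (BNot b) \<sigma> \<longleftrightarrow> \<not> bval H c b \<sigma>"
| "bval H c (BAnd b b') \<sigma> \<longleftrightarrow> bval H c b \<sigma> \<and> bval H c b' \<sigma>"

text \<open>
  \<open>D\<close> is the worst-case query time of the data structure and is charged for every query; every
  other step takes one time unit.
\<close>

fun ntime :: "nat \<Rightarrow> nexp \<Rightarrow> nat" where
  "ntime D (NConst k) = 1"
| "ntime D (NReg i) = 1"
| "ntime D (NAdd e e') = 1 + ntime D e + ntime D e'"
| "ntime D (NSub e e') = 1 + ntime D e + ntime D e'"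
| "ntime D (NHalf e) = 1 + ntime D e"
| "ntime D (Tail e) = 1 + ntime D e"
| "ntime D (Head e) = 1 + ntime D e"
| "ntime D (Twin e) = 1 + ntime D e"
| "ntime D (Rot e) = 1 + ntime D e"
| "ntime D (Face e) = 1 + ntime D e"
| "ntime D (Parent T s e) = D + ntime D e"
| "ntime D (Depth T s e) = D + ntime D e"
| "ntime D (LevelAncestor T s e e') = D + ntime D e + ntime D e'"
| "ntime D (IsAncestor T s e e') = D + ntime D e + ntime D e'"
| "ntime D (LCA T s e e') = D + ntime D e + ntime D e'"
| "ntime D (SubtreeSize T s e) = D + ntime D e"
| "ntime D (Rank T s e) = D + ntime D e"
| "ntime D (Select T s e) = D + ntime D e"

fun rtime :: "nat \<Rightarrow> rexp \<Rightarrow> nat" where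
  "rtime D (RReg i) = 1"
| "rtime D (RAdd e e') = 1 + rtime D e + rtime D e'"
| "rtime D (RSub e e') = 1 + rtime D e + rtime D e'"
| "rtime D (Dist s e) = D + ntime D e"

fun btime :: "nat \<Rightarrow> bexp \<Rightarrow> nat" where
  "btime D (NLess e e') = 1 + ntime D e + ntime D e'"
| "btime D (RLess e e') = 1 + rtime D e + rtime D e'"
| "btime D (BNot b) = 1 + btime D b"
| "btime D (BAnd b b') = 1 + btime D b + btime D b'"

text \<open>\<open>exec H c D p \<sigma> t \<sigma>'\<close>: the program \<open>p\<close>, started in \<open>\<sigma>\<close>, stops in \<open>\<sigma>'\<close> after time \<open>t\<close>.\<close>

inductive exec ::
  "plane_digraph \<Rightarrow> (site \<Rightarrow> nat) \<Rightarrow> nat \<Rightarrow> com \<Rightarrow> state \<Rightarrow> nat \<Rightarrow> state \<Rightarrow> bool"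
  for H :: plane_digraph and c :: "site \<Rightarrow> nat" and D :: nat where
  Skip: "exec H c D Skip \<sigma> 1 \<sigma>"
| NAssign: "exec H c D (NAssign i e) \<sigma> (1 + ntime D e) ((fst \<sigma>)(i := nval H c e \<sigma>), snd \<sigma>)"
| RAssign: "exec H c D (RAssign i e) \<sigma> (1 + rtime D e) (fst \<sigma>, (snd \<sigma>)(i := rval H c e \<sigma>))"
| Seq: "exec H c D p \<sigma> t \<sigma>' \<Longrightarrow> exec H c D q \<sigma>' t' \<sigma>'' \<Longrightarrow>
    exec H c D (Seq p q) \<sigma> (t + t') \<sigma>''"
| IfTrue: "bval H c b \<sigma> \<Longrightarrow> exec H c D p \<sigma> t \<sigma>' \<Longrightarrow>
    exec H c D (If b p q) \<sigma> (1 + btime D b + t) \<sigma>'"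
| IfFalse: "\<not> bval H c b \<sigma> \<Longrightarrow> exec H c D q \<sigma> t \<sigma>' \<Longrightarrow>
    exec H c D (If b p q) \<sigma> (1 + btime D b + t) \<sigma>'"
| WhileFalse: "\<not> bval H c b \<sigma> \<Longrightarrow> exec H c D (While b p) \<sigma> (1 + btime D b) \<sigma>"
| WhileTrue: "bval H c b \<sigma> \<Longrightarrow> exec H c D p \<sigma> t \<sigma>' \<Longrightarrow> exec H c D (While b p) \<sigma>' t' \<sigma>'' \<Longrightarrow>
    exec H c D (While b p) \<sigma> (1 + btime D b + t + t') \<sigma>''"

text \<open>
  The input consists of the reference darts of the three sites (which give access to the sites,
  to \<open>h\<close> and to the graph) and of the three weights.  All other registers are initially \<open>0\<close>.
\<close>

definition initial_state :: "(site \<Rightarrow> nat) \<Rightarrow> (site \<Rightarrow> real) \<Rightarrow> state" where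
  "initial_state c \<omega> =
     ((\<lambda>_. 0)(0 := c Red, 1 := c Green, 2 := c Blue), (\<lambda>_. 0)(0 := \<omega> Red, 1 := \<omega> Green, 2 := \<omega> Blue))"

definition answer :: "state \<Rightarrow> nat option" where
  "answer \<sigma> = (if fst \<sigma> 0 = 0 then None else Some (fst \<sigma> 1))"

end

theory Submission
  imports Defs
begin

text \<open>
  Orient every edge from red to green as +1 and from green to red as -1.  As in Sperner's lemma,
  the sum over the darts of a triangle is nonzero iff the triangle is trichromatic, and the sum
  over a set of faces is the sum over its boundary.  Let \<open>T\<close> be the shortest path tree of the red
  site.  The boundary of the set of faces below a node \<open>y\<close> of its cotree is the fundamental cycle
  of the edge from \<open>y\<close> to its parent, that is, two paths of \<open>T\<close> and one edge.  On a path of \<open>T\<close>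
  the red vertices form a prefix, so the path contributes at most one crossing, which binary
  search finds with \<open>O(log n)\<close> queries.  Hence \<open>O(log n)\<close> queries decide whether the
  trichromatic face, which is unique, lies below \<open>y\<close>.

  The face is located with \<open>O(log n)\<close> such decisions.  Since \<open>h\<close> may have many children in the
  cotree, the child above the face is first found by binary search in the preorder, where the
  side of a boundary vertex on which the face lies is read off the path of \<open>T\<close> to it.
  Below this child the cotree is binary, and regions with at most one subtree removed are halved
  at centroids; a centroid is the lowest heavy ancestor of the median of the region in preorder.

  The topology enters through Euler's formula only: it makes the complement of a spanning
  tree a spanning tree of the dual, and an edge count for the Voronoi forest shows that there is
  at most one trichromatic face and, if there is one, exactly three bichromatic edges on \<open>h\<close>.
\<close>


section \<open>Rooted trees of darts\<close>

text \<open>No Jordan curve is used. A set of faces is encoded by the antisymmetric function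
  \<open>I a - I (twin H a)\<close> on darts, whose net flow out of every vertex is zero.
  Subtracting the flow of the expected boundary walk leaves a conserved function supported on a
  spanning tree, and such a function vanishes because leaves can be peeled off. Boundaries thus
  become identities between integer sums. The cyclic order of the cells around \<open>h\<close>
  enters only the test at a boundary vertex outside the red cell, so a single unknown bit is
  guessed. A wrong guess, or the absence of a trichromatic face, may lead the search astray, but it
  can neither exceed the time bound nor give a false answer: loops end because a quantity read off
  the registers halves, and a face is reported only after its corners were tested. Hence the
  specifications bound the time always and promise a location only under \<open>tricol f\<close>.
  The square of the logarithm comes from a search in the cotree with level searches inside each
  round.\<close>

locale dart_tree =
  fixes V A :: "nat set" and src dst tw :: "nat \<Rightarrow> nat" and rt :: nat and pd dp :: "nat \<Rightarrow> nat"
  assumes finite_V: "finite V" and rt_V: "rt \<in> V"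
    and A_eq: "A = pd ` (V - {rt}) \<union> tw ` pd ` (V - {rt})"
    and tw_tw: "a \<in> A \<Longrightarrow> tw (tw a) = a"
    and src_tw: "a \<in> A \<Longrightarrow> src (tw a) = dst a"
    and dst_tw: "a \<in> A \<Longrightarrow> dst (tw a) = src a"
    and dst_pd: "v \<in> V \<Longrightarrow> v \<noteq> rt \<Longrightarrow> dst (pd v) = v"
    and src_pd: "v \<in> V \<Longrightarrow> v \<noteq> rt \<Longrightarrow> src (pd v) \<in> V"
    and dp_pd: "v \<in> V \<Longrightarrow> v \<noteq> rt \<Longrightarrow> dp v = Suc (dp (src (pd v)))"
    and dp_rt: "dp rt = 0"
begin

lemma pd_A: "v \<in> V \<Longrightarrow> v \<noteq> rt \<Longrightarrow> pd v \<in> A"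
  and tw_pd_A: "v \<in> V \<Longrightarrow> v \<noteq> rt \<Longrightarrow> tw (pd v) \<in> A"
  unfolding A_eq by auto

lemma A_cases:
  assumes "a \<in> A"
  obtains (down) v where "v \<in> V" "v \<noteq> rt" "a = pd v"
    | (up) v where "v \<in> V" "v \<noteq> rt" "a = tw (pd v)"
  using assms unfolding A_eq by auto

lemma tw_A: "a \<in> A \<Longrightarrow> tw a \<in> A"
  by (erule A_cases) (auto simp: tw_tw pd_A tw_pd_A)

lemma src_V: "a \<in> A \<Longrightarrow> src a \<in> V" and dst_V: "a \<in> A \<Longrightarrow> dst a \<in> V"
  by (erule A_cases; simp add: src_pd dst_pd src_tw dst_tw pd_A)+

lemma finite_A: "finite A"
  unfolding A_eq using finite_V by simp

lemma tree_induct [consumes 1, case_names root step]: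
  assumes "v \<in> V" "P rt"
    and step: "\<And>v. v \<in> V \<Longrightarrow> v \<noteq> rt \<Longrightarrow> P (src (pd v)) \<Longrightarrow> P v"
  shows "P v"
  using assms(1)
proof (induction "dp v" arbitrary: v rule: less_induct)
  case less
  show ?case
  proof (cases "v = rt")
    case False
    then show ?thesis using less step[OF \<open>v \<in> V\<close> False] src_pd dp_pd by simp
  qed (use assms in simp)
qed

text \<open>The dart \<open>pd v\<close> leads from the parent into \<open>v\<close>. Recursion on
  the number of steps, later set to the depth, makes the path primitive recursive.\<close>

primrec rp :: "nat \<Rightarrow> nat \<Rightarrow> nat list" where
  "rp 0 v = []"
| "rp (Suc n) v = rp n (src (pd v)) @ [pd v]"

definition rpath :: "nat \<Rightarrow> nat list" where "rpath v = rp (dp v) v"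

definition br :: "nat \<Rightarrow> nat list" where "br v = rt # map dst (rpath v)"

definition anc :: "nat \<Rightarrow> nat \<Rightarrow> bool" where "anc x y \<longleftrightarrow> x \<in> set (br y)"

definition sub :: "nat \<Rightarrow> nat set" where "sub v = {y \<in> V. anc v y}"

lemma rpath_rt [simp]: "rpath rt = []"
  by (simp add: rpath_def dp_rt)

lemma rpath_step: "v \<in> V \<Longrightarrow> v \<noteq> rt \<Longrightarrow> rpath v = rpath (src (pd v)) @ [pd v]"
  by (simp add: rpath_def dp_pd)

lemma br_rt [simp]: "br rt = [rt]"
  by (simp add: br_def)

lemma br_step: "v \<in> V \<Longrightarrow> v \<noteq> rt \<Longrightarrow> br v = br (src (pd v)) @ [v]"
  by (simp add: br_def rpath_step dst_pd)

lemma length_rpath: "v \<in> V \<Longrightarrow> length (rpath v) = dp v"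
  by (induction rule: tree_induct) (simp_all add: dp_rt rpath_step dp_pd)

lemma length_br: "v \<in> V \<Longrightarrow> length (br v) = Suc (dp v)"
  by (simp add: br_def length_rpath)

lemma last_br: "v \<in> V \<Longrightarrow> last (br v) = v"
  by (cases "v = rt") (simp_all add: br_step)

lemma last_rpath: "v \<in> V \<Longrightarrow> v \<noteq> rt \<Longrightarrow> last (rpath v) = pd v"
  by (simp add: rpath_step)

lemma set_rpath: "v \<in> V \<Longrightarrow> set (rpath v) \<subseteq> A"
  by (induction rule: tree_induct) (simp_all add: rpath_step pd_A)

lemma set_br: "v \<in> V \<Longrightarrow> set (br v) \<subseteq> V"
  by (induction rule: tree_induct) (simp_all add: br_step rt_V)

lemma br_nth:
  assumes "v \<in> V" "k \<le> dp v"
  shows "br v ! k \<in> V" "dp (br v ! k) = k" "br (br v ! k) = take (Suc k) (br v)"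
  using assms
proof (induction rule: tree_induct)
  case root
  { case 1 then show ?case using rt_V by (simp add: dp_rt) }
  { case 2 then show ?case by (simp add: dp_rt) }
  { case 3 then show ?case by (simp add: dp_rt) }
next
  case (step v)
  have P: "src (pd v) \<in> V" using step src_pd by simp
  have L: "length (br (src (pd v))) = dp v" using length_br[OF P] dp_pd step by simp
  have *: "br v ! k \<in> V \<and> dp (br v ! k) = k \<and> br (br v ! k) = take (Suc k) (br v)" if "k \<le> dp v"
  proof (cases "k = dp v")
    case True
    then show ?thesis using step L by (simp add: br_step nth_append)
  next
    case False
    then have "k \<le> dp (src (pd v))" using that dp_pd step by simp
    then show ?thesis using step L that False by (simp add: br_step nth_append)
  qed
  { case 1 then show ?case using * by simp }
  { case 2 then show ?case using * by simp }
  { case 3 then show ?case using * by simp }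
qed

lemma br_nth_dp: "v \<in> V \<Longrightarrow> br v ! dp v = v"
  by (metis last_br last_conv_nth length_br diff_Suc_1 list.discI br_def)

text \<open>A branch lists its nodes by increasing depth, so \<open>x\<close> can occur in it only
  at position \<open>dp x\<close>.\<close>

lemma anc_iff: "y \<in> V \<Longrightarrow> anc x y \<longleftrightarrow> dp x \<le> dp y \<and> br y ! dp x = x"
  unfolding anc_def in_set_conv_nth using br_nth length_br[of y]
  by (metis less_Suc_eq_le)

lemma anc_V: "anc x y \<Longrightarrow> y \<in> V \<Longrightarrow> x \<in> V"
  using set_br unfolding anc_def by blast

lemma anc_refl: "x \<in> V \<Longrightarrow> anc x x"
  by (simp add: anc_iff br_nth_dp)

lemma anc_rt: "x \<in> V \<Longrightarrow> anc rt x"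
  by (simp add: anc_def br_def)

lemma anc_dp: "anc x y \<Longrightarrow> y \<in> V \<Longrightarrow> dp x \<le> dp y"
  by (simp add: anc_iff)

lemma anc_br: "anc x y \<Longrightarrow> y \<in> V \<Longrightarrow> br x = take (Suc (dp x)) (br y)"
  using anc_iff br_nth(3) by metis

lemma anc_trans: "anc x y \<Longrightarrow> anc y z \<Longrightarrow> z \<in> V \<Longrightarrow> anc x z"
  unfolding anc_def using anc_br[of y z] by (auto simp: anc_def dest: in_set_takeD)

lemma anc_eq_dp: "anc x y \<Longrightarrow> y \<in> V \<Longrightarrow> dp x = dp y \<Longrightarrow> x = y"
  using anc_iff br_nth_dp by metis

lemma anc_chain:
  assumes "anc x z" "anc y z" "z \<in> V" "dp x \<le> dp y" shows "anc x y"
  using assms anc_br[of y z] anc_iff[of z x] anc_iff[of y x] anc_V[of y z] by auto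

lemma anc_linear: "anc x z \<Longrightarrow> anc y z \<Longrightarrow> z \<in> V \<Longrightarrow> anc x y \<or> anc y x"
  using anc_chain by (meson nle_le)

lemma anc_antisym: "anc x y \<Longrightarrow> anc y x \<Longrightarrow> y \<in> V \<Longrightarrow> x = y"
  using anc_eq_dp anc_dp anc_V by (metis le_antisym)

lemma anc_par: "v \<in> V \<Longrightarrow> v \<noteq> rt \<Longrightarrow> anc x v \<longleftrightarrow> x = v \<or> anc x (src (pd v))"
  by (auto simp: anc_def br_step)

lemma anc_br_nth: "v \<in> V \<Longrightarrow> k \<le> dp v \<Longrightarrow> anc (br v ! k) v"
  by (simp add: anc_def length_br)

lemma not_anc_par: "v \<in> V \<Longrightarrow> v \<noteq> rt \<Longrightarrow> \<not> anc v (src (pd v))"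
  using anc_dp[of v "src (pd v)"] dp_pd[of v] src_pd[of v] by auto

lemma dp_0: "v \<in> V \<Longrightarrow> dp v = 0 \<longleftrightarrow> v = rt"
  using dp_pd dp_rt by fastforce

lemma sub_V: "sub v \<subseteq> V" by (auto simp: sub_def)

lemma finite_sub: "finite (sub v)" using sub_V finite_V finite_subset by blast

lemma sub_self: "v \<in> V \<Longrightarrow> v \<in> sub v" by (simp add: sub_def anc_refl)

lemma sub_rt: "sub rt = V" by (auto simp: sub_def anc_rt)

lemma rt_sub: "v \<in> V \<Longrightarrow> v \<noteq> rt \<Longrightarrow> rt \<notin> sub v"
  by (simp add: sub_def anc_def)

lemma sub_mono: "anc x y \<Longrightarrow> sub y \<subseteq> sub x"
  unfolding sub_def using anc_trans by blast

lemma sub_disjoint: "\<not> anc x y \<Longrightarrow> \<not> anc y x \<Longrightarrow> sub x \<inter> sub y = {}"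
  unfolding sub_def using anc_linear by blast

lemma child_towards:
  assumes "anc v y" "y \<in> V" "y \<noteq> v"
  obtains c where "c \<in> V" "c \<noteq> rt" "src (pd c) = v" "anc c y" 
proof -
  have v: "v \<in> V" using anc_V assms by blast
  have lt: "dp v < dp y" using anc_dp[OF assms(1,2)] anc_eq_dp[OF assms(1,2)] assms(3) by fastforce
  let ?c = "br y ! Suc (dp v)"
  have c: "?c \<in> V" "dp ?c = Suc (dp v)" "anc ?c y" using br_nth[OF assms(2), of "Suc (dp v)"] anc_br_nth[OF assms(2)] lt by auto
  then have nr: "?c \<noteq> rt" using dp_rt by auto
  have "anc v ?c" using anc_chain[OF assms(1) c(3) assms(2)] c by simp
  then have "anc v (src (pd ?c))" using anc_par[OF c(1) nr, of v] c by auto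
  moreover have "dp (src (pd ?c)) = dp v" using dp_pd[OF c(1) nr] c by simp
  ultimately have "src (pd ?c) = v" using anc_eq_dp src_pd[OF c(1) nr] by metis
  then show ?thesis using that c nr by blast
qed

definition lca :: "nat \<Rightarrow> nat \<Rightarrow> nat" where
  "lca x y = last (longest_common_prefix (br x) (br y))"

text \<open>The branch of any common ancestor is a prefix of both branches, hence of their longest
  common prefix, whose last entry is therefore the deepest common ancestor.\<close>

lemma lca_anc:
  assumes "x \<in> V" "y \<in> V"
  shows "anc (lca x y) x" "anc (lca x y) y" "\<And>z. anc z x \<Longrightarrow> anc z y \<Longrightarrow> anc z (lca x y)"
proof -
  let ?p = "longest_common_prefix (br x) (br y)"
  have p: "prefix ?p (br x)" "prefix ?p (br y)"
    by (simp_all add: longest_common_prefix_prefix1 longest_common_prefix_prefix2)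
  have ne: "?p \<noteq> []" by (simp add: br_def)
  have "set ?p \<subseteq> set (br x)" "set ?p \<subseteq> set (br y)" using p by (auto dest: set_mono_prefix)
  then show 1: "anc (lca x y) x" "anc (lca x y) y"
    unfolding anc_def lca_def using last_in_set[OF ne] by blast+
  show "anc z (lca x y)" if "anc z x" "anc z y" for z
  proof -
    have "prefix (br z) (br x)" "prefix (br z) (br y)"
      using anc_br[OF that(1) assms(1)] anc_br[OF that(2) assms(2)] take_is_prefix by metis+
    then have pz: "prefix (br z) ?p" using longest_common_prefix_max_prefix by blast
    have zV: "z \<in> V" using that anc_V assms by blast
    have "dp z < length ?p" using prefix_length_le[OF pz] length_br[OF zV] by simp
    moreover have "dp (lca x y) = length ?p - 1"
    proof -
      have "last ?p = br x ! (length ?p - 1)" using p ne 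
        by (metis last_conv_nth diff_less length_greater_0_conv less_numeral_extra(1) prefixE nth_append)
      moreover have "length ?p - 1 \<le> dp x" using prefix_length_le[OF p(1)] length_br[OF assms(1)] by simp
      ultimately show ?thesis unfolding lca_def using br_nth(2)[OF assms(1)] by simp
    qed
    ultimately show ?thesis using anc_chain[OF that(1) 1(1) assms(1)] by simp
  qed
qed

section \<open>Simple paths in the digraph of the tree\<close>

abbreviation dg :: "(nat, nat) pre_digraph" where
  "dg \<equiv> \<lparr>verts = V, arcs = A, tail = src, head = dst\<rparr>"

lemma wf_dg: "wf_digraph dg"
  by unfold_locales (simp_all add: src_V dst_V)

lemma apath_rpath:
  assumes "v \<in> V"
  shows "pre_digraph.apath dg rt (rpath v) v \<and> pre_digraph.awalk_verts dg rt (rpath v) = br v"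
proof -
  interpret G: wf_digraph dg by (rule wf_dg)
  from assms show ?thesis
  proof (induction rule: tree_induct)
    case root
    then show ?case using rt_V by (simp add: G.apath_Nil_iff)
  next
    case (step v)
    let ?u = "src (pd v)"
    have u: "G.apath rt (rpath ?u) ?u" "G.awalk_verts rt (rpath ?u) = br ?u" using step by auto
    have e: "G.apath ?u [pd v] v" using step pd_A dst_pd not_anc_par[of v] src_pd
      by (auto simp: G.apath_simps anc_def last_br dest: arg_cong[of _ _ dp] simp: dp_pd)
    have last: "last (G.awalk_verts rt (rpath ?u)) = ?u" using u last_br src_pd step by simp
    have "v \<notin> set (br ?u)" using not_anc_par step by (simp add: anc_def)
    then have "G.apath rt (rpath ?u @ [pd v]) v"
      using u e last by (simp add: G.apath_append_iff dst_pd step)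
    moreover from this have "G.awalk_verts rt (rpath ?u @ [pd v]) = br v"
      using u last step by (subst G.awalk_verts_append) (auto simp: G.apath_def br_step dst_pd)
    ultimately show ?case using step by (simp add: rpath_step)
  qed
qed

text \<open>A simple path from the root cannot climb: up to its last dart it is \<open>rpath\<close>
  by induction, and an upward last dart would end at the parent, which lies on that path already.
  This gives the definite description in \<open>root_path\<close> its meaning.\<close>

lemma apath_eq_rpath:
  assumes "pre_digraph.apath dg rt p v" shows "p = rpath v"
proof -
  interpret G: wf_digraph dg by (rule wf_dg)
  from assms show ?thesis
  proof (induction p arbitrary: v rule: rev_induct)
    case Nil
    then show ?case by (metis G.apath_Nil_iff rpath_rt)
  next
    case (snoc a p)
    let ?u = "last (G.awalk_verts rt p)"
    have p: "G.apath rt p ?u" and a: "G.apath ?u [a] v"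
      and disj: "v \<notin> set (G.awalk_verts rt p)"
      using snoc.prems by (auto simp: G.apath_append_iff G.apath_simps)
    have aA: "a \<in> A" "src a = ?u" "dst a = v" using a by (auto simp: G.apath_simps)
    have u: "?u \<in> V" using aA src_V by metis
    have pu: "p = rpath ?u" using snoc.IH p by blast
    then have v: "v \<notin> set (br ?u)" using disj apath_rpath[OF u] by metis
    from aA(1) show ?case
    proof (cases rule: A_cases)
      case (down w)
      then have "w = v" using aA dst_pd by simp
      then show ?thesis using down aA pu rpath_step by metis
    next
      case (up w)
      then have "w = ?u" "src (pd w) = v" using aA src_tw dst_tw pd_A dst_pd by metis+
      then have "v \<in> set (br ?u)" using anc_par[of w v] anc_refl[of v] src_pd[of w] up unfolding anc_def by auto
      then show ?thesis using v by blast
    qed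
  qed
qed

lemma THE_apath: "v \<in> V \<Longrightarrow> (THE p. pre_digraph.apath dg rt p v) = rpath v"
  using apath_rpath apath_eq_rpath by blast

lemma pd_inj: "inj_on pd (V - {rt})"
  by (rule inj_on_inverseI[where g = dst]) (simp add: dst_pd)

lemma pd_ne_tw_pd:
  assumes "v \<in> V" "v \<noteq> rt" "w \<in> V" "w \<noteq> rt" shows "pd v \<noteq> tw (pd w)"
proof
  assume eq: "pd v = tw (pd w)"
  then have "src (pd v) = w" "v = src (pd w)" using src_tw dst_tw pd_A dst_pd assms by metis+
  then have "dp v = Suc (dp w)" "dp w = Suc (dp v)" using dp_pd assms by metis+
  then show False by simp
qed

lemma card_A: "card A = 2 * (card V - 1)"
proof -
  have inj: "inj_on tw (pd ` (V - {rt}))"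
    by (rule inj_on_inverseI[where g = tw]) (auto intro!: tw_tw pd_A)
  have "card A = card (pd ` (V - {rt})) + card (tw ` pd ` (V - {rt}))"
    unfolding A_eq using finite_V pd_ne_tw_pd by (intro card_Un_disjoint) auto
  also have "\<dots> = 2 * card (V - {rt})" using card_image[OF inj] card_image[OF pd_inj] by simp
  finally show ?thesis using rt_V finite_V by simp
qed

end


section \<open>Euler tours and preorders\<close>

lemma funpow_inj_on:
  assumes "inj_on f S" "f ` S \<subseteq> S" "x \<in> S" "y \<in> S" "(f ^^ k) x = (f ^^ k) y"
  shows "x = y"
  using assms(5)
proof (induction k)
  case (Suc k)
  have "(f ^^ k) z \<in> S" if "z \<in> S" for z
    using that assms(2) by (induction k) auto
  then show ?case using Suc assms by (auto dest: inj_onD)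
qed simp

text \<open>A return to \<open>x\<close> after fewer than \<open>card S\<close> steps would confine
  the orbit to too few elements. Injectivity cancels common steps, so every repetition of values
  amounts to a return to \<open>x\<close>.\<close>

lemma cyclic_enumeration:
  assumes "finite S" "inj_on f S" "f ` S \<subseteq> S" "x \<in> S" "\<And>y. y \<in> S \<Longrightarrow> \<exists>k. (f ^^ k) x = y"
  shows "inj_on (\<lambda>k. (f ^^ k) x) {..<card S}" "(\<lambda>k. (f ^^ k) x) ` {..<card S} = S"
    "(f ^^ card S) x = x"
proof -
  let ?t = "\<lambda>k. (f ^^ k) x"
  have tS: "?t k \<in> S" for k using assms(3,4) by (induction k) auto
  have nper: "?t p \<noteq> x" if "0 < p" "p < card S" for p
  proof
    assume "?t p = x"
    then have "?t k = ?t (k mod p)" for k by (simp add: funpow_mod_eq)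
    then have "S \<subseteq> ?t ` {..<p}" using assms(5) that
      by (metis (no_types, lifting) image_eqI lessThan_iff mod_less_divisor subsetI)
    then have "card S \<le> p" by (metis card_lessThan finite_lessThan surj_card_le)
    then show False using that by simp
  qed
  have *: "i = j" if "?t i = ?t j" "i \<le> j" "j < card S" for i j
  proof (rule ccontr)
    assume "i \<noteq> j"
    then have ij: "i < j" using that by simp
    have "?t i = (f ^^ i) (?t (j - i))" using that by (simp flip: funpow_add[THEN fun_cong, unfolded o_def])
    then have "?t (j - i) = x" using funpow_inj_on[OF assms(2,3,4) tS] by metis
    then show False using nper[of "j - i"] ij that by simp
  qed
  show inj: "inj_on ?t {..<card S}"
    by (rule inj_onI) (metis * lessThan_iff linorder_le_cases)
  show im: "?t ` {..<card S} = S"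
    by (rule card_subset_eq) (use assms(1) tS card_image[OF inj] in auto)
  have "?t (card S) \<in> ?t ` {..<card S}" using im tS by simp
  then obtain j where j: "j < card S" "?t (card S) = ?t j" by auto
  have "?t (card S) = (f ^^ j) (?t (card S - j))" using j by (simp flip: funpow_add[THEN fun_cong, unfolded o_def])
  then have "?t (card S - j) = x" using funpow_inj_on[OF assms(2,3,4) tS] j by metis
  then show "?t (card S) = x" using nper[of "card S - j"] j by (cases "j = 0") auto
qed

lemma upt_append: "i \<le> j \<Longrightarrow> j \<le> k \<Longrightarrow> [i..<j] @ [j..<k] = [i..<k]"
  by (metis le_add_diff_inverse upt_add_eq_append)

definition first_occs :: "'a list \<Rightarrow> 'a list" where
  "first_occs xs = rev (remdups (rev xs))"

lemma set_first_occs [simp]: "set (first_occs xs) = set xs"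
  and distinct_first_occs [simp]: "distinct (first_occs xs)"
  by (simp_all add: first_occs_def)

lemma remdups_append_filter:
  "remdups (xs @ ys) = filter (\<lambda>x. x \<notin> set ys) (remdups xs) @ remdups ys"
  by (induction xs) auto

lemma first_occs_append:
  "first_occs (xs @ ys) = first_occs xs @ filter (\<lambda>x. x \<notin> set xs) (first_occs ys)"
  by (simp add: first_occs_def remdups_append_filter rev_filter)

lemma hd_first_occs: "xs \<noteq> [] \<Longrightarrow> hd (first_occs xs) = hd xs"
  using first_occs_append[of "[hd xs]" "tl xs"] by (simp add: first_occs_def)

definition rank :: "'a list \<Rightarrow> 'a \<Rightarrow> nat" where
  "rank xs x = (LEAST k. xs ! k = x)"

lemma rank_nth: "distinct xs \<Longrightarrow> k < length xs \<Longrightarrow> rank xs (xs ! k) = k"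
  unfolding rank_def by (rule Least_equality) (simp, metis leI nth_eq_iff_index_eq order.strict_trans order.irrefl)

lemma rank_less: "distinct xs \<Longrightarrow> x \<in> set xs \<Longrightarrow> rank xs x < length xs"
  and nth_rank: "distinct xs \<Longrightarrow> x \<in> set xs \<Longrightarrow> xs ! rank xs x = x"
  by (metis in_set_conv_nth rank_nth)+

lemma rank_append:
  assumes "distinct (xs @ ys @ zs)" "y \<in> set (xs @ ys @ zs)"
  shows "y \<in> set xs \<longleftrightarrow> rank (xs @ ys @ zs) y < length xs"
    "y \<in> set ys \<longleftrightarrow> length xs \<le> rank (xs @ ys @ zs) y \<and> rank (xs @ ys @ zs) y < length xs + length ys"
proof -
  let ?r = "rank (xs @ ys @ zs) y"
  have r: "?r < length (xs @ ys @ zs)" "(xs @ ys @ zs) ! ?r = y"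
    using rank_less[OF assms] nth_rank[OF assms] by simp_all
  consider "?r < length xs" | "length xs \<le> ?r" "?r < length xs + length ys" | "length xs + length ys \<le> ?r"
    by linarith
  then have "(y \<in> set xs \<longleftrightarrow> ?r < length xs) \<and> (y \<in> set ys \<longleftrightarrow> length xs \<le> ?r \<and> ?r < length xs + length ys)"
  proof cases
    case 1
    then have "y \<in> set xs" using r by (metis nth_append nth_mem)
    then show ?thesis using 1 assms(1) by auto
  next
    case 2
    then have l: "?r - length xs < length ys" by linarith
    then have "y = ys ! (?r - length xs)" using r 2 by (simp add: nth_append)
    then have "y \<in> set ys" using l by (metis nth_mem)
    then show ?thesis using 2 assms(1) by auto
  next
    case 3
    then have l: "?r - length xs - length ys < length zs" "\<not> ?r - length xs < length ys" using r(1) by simp_all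
    then have "y = zs ! (?r - length xs - length ys)" using r 3 by (simp add: nth_append)
    then have "y \<in> set zs" using l by (metis nth_mem)
    then show ?thesis using 3 assms(1) by auto
  qed
  then show "y \<in> set xs \<longleftrightarrow> ?r < length xs"
    "y \<in> set ys \<longleftrightarrow> length xs \<le> ?r \<and> ?r < length xs + length ys" by auto
qed

text \<open>\<open>Dt\<close> contains all darts around the nodes, \<open>nx\<close> is their cyclic
  order, and \<open>A\<close> is the tree among them. For the cotree, \<open>nx\<close> is the face
  successor.\<close>

locale plane_tree = dart_tree +
  fixes Dt :: "nat set" and nx :: "nat \<Rightarrow> nat" and d :: nat
  assumes finite_Dt: "finite Dt" and A_Dt: "A \<subseteq> Dt"
    and nx_Dt: "a \<in> Dt \<Longrightarrow> nx a \<in> Dt" and src_nx: "a \<in> Dt \<Longrightarrow> src (nx a) = src a"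
    and nx_inj: "inj_on nx Dt"
    and nx_cyc: "a \<in> Dt \<Longrightarrow> b \<in> Dt \<Longrightarrow> src a = src b \<Longrightarrow> \<exists>k. (nx ^^ k) a = b"
    and d_Dt: "d \<in> Dt" and src_d: "src d = rt"
begin

lemma nx_pow: "a \<in> Dt \<Longrightarrow> (nx ^^ k) a \<in> Dt \<and> src ((nx ^^ k) a) = src a"
  by (induction k) (auto simp: nx_Dt src_nx)

definition ftd :: "nat \<Rightarrow> nat" where "ftd a = (nx ^^ (LEAST k. (nx ^^ k) a \<in> A)) a"

definition nxt :: "nat \<Rightarrow> nat" where "nxt a = ftd (nx (tw a))"

definition tour_list :: "nat list" where
  "tour_list = map (\<lambda>k. (nxt ^^ k) (ftd d)) [0..<card A]"

definition pre :: "nat list" where "pre = first_occs (rt # map dst tour_list)"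

lemma ftd:
  assumes "a \<in> Dt" "b \<in> A" "src b = src a"
  obtains k where "ftd a = (nx ^^ k) a" "ftd a \<in> A" "\<And>j. j < k \<Longrightarrow> (nx ^^ j) a \<notin> A"
proof -
  obtain k where "(nx ^^ k) a = b" using nx_cyc[of a b] assms A_Dt by auto
  then have "(nx ^^ (LEAST k. (nx ^^ k) a \<in> A)) a \<in> A" using LeastI[of "\<lambda>k. (nx ^^ k) a \<in> A" k] assms by simp
  then show ?thesis using that[of "LEAST k. (nx ^^ k) a \<in> A"] not_less_Least by (auto simp: ftd_def)
qed

lemma nxt:
  assumes "a \<in> A"
  obtains k where "nxt a = (nx ^^ Suc k) (tw a)" "nxt a \<in> A" "src (nxt a) = dst a"
    "\<And>j. j < k \<Longrightarrow> (nx ^^ Suc j) (tw a) \<notin> A"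
proof -
  have t: "tw a \<in> A" "tw a \<in> Dt" using tw_A assms A_Dt by auto
  obtain k where "nxt a = (nx ^^ k) (nx (tw a))" "nxt a \<in> A" "\<And>j. j < k \<Longrightarrow> (nx ^^ j) (nx (tw a)) \<notin> A"
    using ftd[of "nx (tw a)" "tw a"] t nx_Dt src_nx unfolding nxt_def by metis
  then show ?thesis using that[of k] nx_pow[of "tw a" "Suc k"] t src_tw[OF assms]
    by (metis funpow_Suc_right o_apply)
qed

lemma nxt_A: "a \<in> A \<Longrightarrow> nxt a \<in> A" and src_nxt: "a \<in> A \<Longrightarrow> src (nxt a) = dst a"
  using nxt by metis+

text \<open>If the searches from \<open>tw a\<close> and \<open>tw b\<close> end at the same dart,
  the longer one passes through the start of the shorter. That start is a tree dart, where the
  search would have stopped, so both have the same length.\<close>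

lemma nxt_inj: "inj_on nxt A"
proof -
  have *: "a = b" if ab: "a \<in> A" "b \<in> A" and k: "nxt a = (nx ^^ Suc k) (tw a)"
    and l: "nxt b = (nx ^^ Suc l) (tw b)" "\<And>j. j < l \<Longrightarrow> (nx ^^ Suc j) (tw b) \<notin> A"
    and eq: "nxt a = nxt b" and le: "k \<le> l" for a b k l
  proof -
    have t: "tw a \<in> A" "tw b \<in> A" "tw a \<in> Dt" "tw b \<in> Dt" using ab tw_A A_Dt by auto
    have "(nx ^^ Suc l) (tw b) = (nx ^^ Suc k) ((nx ^^ (l - k)) (tw b))"
      using le by (metis Suc_diff_Suc add_diff_inverse_nat funpow_add not_less o_apply plus_nat.simps(2))
    then have "tw a = (nx ^^ (l - k)) (tw b)"
      using funpow_inj_on[OF nx_inj, of "tw a" "(nx ^^ (l - k)) (tw b)" "Suc k"] eq k l t nx_pow nx_Dt by auto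
    then have "l - k = 0" using l(2)[of "l - k - 1"] t le
      by (metis Suc_pred diff_less_Suc less_Suc_eq_le not_less_eq zero_less_iff_neq_zero diff_le_self Suc_le_eq Suc_diff_1 order.strict_trans2 lessI)
    then have "tw a = tw b" using \<open>tw a = _\<close> by simp
    then show ?thesis using tw_tw ab by metis
  qed
  show ?thesis
  proof (rule inj_onI)
    fix a b assume ab: "a \<in> A" "b \<in> A" "nxt a = nxt b"
    obtain k where k: "nxt a = (nx ^^ Suc k) (tw a)" "\<And>j. j < k \<Longrightarrow> (nx ^^ Suc j) (tw a) \<notin> A" using nxt[OF ab(1)] by metis
    obtain l where l: "nxt b = (nx ^^ Suc l) (tw b)" "\<And>j. j < l \<Longrightarrow> (nx ^^ Suc j) (tw b) \<notin> A" using nxt[OF ab(2)] by metis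
    show "a = b" using *[OF ab(1,2) k(1) l ab(3)] *[OF ab(2,1) l(1) k ab(3)[symmetric]] by (metis nle_le)
  qed
qed

lemma entry_dart:
  assumes "a \<in> A" "v \<in> V" "v \<noteq> rt" "dst a \<in> sub v" "src a \<notin> sub v" shows "a = pd v"
  using assms(1)
proof (cases rule: A_cases)
  case (down w)
  then have "v = w" using assms anc_par[of w v] dst_pd src_pd by (auto simp: sub_def)
  then show ?thesis using down by simp
next
  case (up w)
  then have "src a = w" "dst a = src (pd w)" using src_tw dst_tw pd_A dst_pd by auto
  then show ?thesis using assms up anc_par[of w v] by (auto simp: sub_def)
qed

lemma exit_dart:
  assumes "a \<in> A" "v \<in> V" "v \<noteq> rt" "src a \<in> sub v" "dst a \<notin> sub v" shows "a = tw (pd v)"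
  using entry_dart[of "tw a" v] assms tw_A src_tw dst_tw tw_tw by metis

text \<open>A set closed under \<open>nxt\<close> that enters \<open>S\<close> must leave it again, because \<open>nxt\<close> is injective.\<close>

lemma tw_closed_cut:
  assumes B: "B \<subseteq> A" "nxt ` B \<subseteq> B" and x: "x \<in> B" "dst x \<in> S" "src x \<notin> S"
    and exit: "\<And>a. a \<in> A \<Longrightarrow> src a \<in> S \<Longrightarrow> dst a \<notin> S \<Longrightarrow> a = tw x"
  shows "tw x \<in> B"
proof (rule ccontr)
  assume n: "tw x \<notin> B"
  let ?Z = "{a \<in> B. dst a \<in> S}"
  have fin: "finite ?Z" using B finite_A finite_subset by fastforce
  have "nxt ` ?Z \<subseteq> ?Z - {x}"
  proof
    fix b assume "b \<in> nxt ` ?Z"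
    then obtain a where a: "a \<in> B" "dst a \<in> S" "b = nxt a" by auto
    then have b: "b \<in> B" "src b \<in> S" using B src_nxt by auto
    then have "dst b \<in> S" using exit[of b] n B by auto
    then show "b \<in> ?Z - {x}" using b x by auto
  qed
  then have "card (nxt ` ?Z) \<le> card (?Z - {x})" using fin by (intro card_mono) auto
  moreover have "card (nxt ` ?Z) = card ?Z" using nxt_inj B by (intro card_image) (auto intro: inj_on_subset)
  moreover have "card (?Z - {x}) < card ?Z" using fin x by (intro psubset_card_mono) auto
  ultimately show False by simp
qed

text \<open>The tour is one cycle. A nonempty set closed under \<open>nxt\<close> is closed under
  \<open>tw\<close> by the cut argument applied to subtrees; as \<open>nxt (tw x)\<close> is the
  next tree dart after \<open>x\<close> around the same node, it is closed under rotation as well,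
  and the tree is connected.\<close>

lemma nxt_transitive:
  assumes B: "B \<subseteq> A" "nxt ` B \<subseteq> B" "B \<noteq> {}"
  shows "B = A"
proof -
  have tw: "tw x \<in> B" if x: "x \<in> B" for x
  proof -
    have "x \<in> A" using x B by blast
    then show ?thesis
    proof (cases rule: A_cases)
      case (down v)
      show ?thesis
        by (rule tw_closed_cut[OF B(1,2) x, of "sub v"])
          (use down exit_dart[of _ v] not_anc_par[of v] sub_self[of v] in \<open>auto simp: dst_pd sub_def\<close>)
    next
      case (up v)
      have e: "tw x = pd v" using up tw_tw pd_A by simp
      show ?thesis
      proof (rule tw_closed_cut[OF B(1,2) x, of "- sub v"])
        have "dst x = src (pd v)" "src x = v" using up src_tw dst_tw pd_A dst_pd by simp_all
        then show "dst x \<in> - sub v" "src x \<notin> - sub v" using not_anc_par[of v] sub_self[of v] up by (auto simp: sub_def)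
        show "a = tw x" if "a \<in> A" "src a \<in> - sub v" "dst a \<notin> - sub v" for a
          using entry_dart[of a v] that up e by simp
      qed
    qed
  qed
  have star: "y \<in> B" if x: "x \<in> B" and y: "y \<in> A" "src y = src x" for x y
  proof -
    obtain k where "(nx ^^ k) x = y" using nx_cyc[of x y] x y B A_Dt by auto
    then show ?thesis using x
    proof (induction k arbitrary: x rule: less_induct)
      case (less k)
      show ?case
      proof (cases k)
        case (Suc i)
        have xA: "x \<in> A" and txA: "tw x \<in> A" using less.prems B tw_A by auto
        obtain j where j: "nxt (tw x) = (nx ^^ Suc j) x" "\<And>i. i < j \<Longrightarrow> (nx ^^ Suc i) x \<notin> A"
          using nxt[OF txA] tw_tw[OF xA] by metis
        have jB: "nxt (tw x) \<in> B" using tw less.prems B by auto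
        have "j \<le> i" using j(2)[of i] less.prems Suc y by (meson not_less)
        then have "(nx ^^ (i - j)) (nxt (tw x)) = y"
          using j(1) less.prems Suc by (metis Suc_diff_Suc diff_Suc_Suc funpow_add le_add_diff_inverse2 add.commute add_Suc_right o_apply)
        then show ?thesis using less.IH[of "i - j" "nxt (tw x)"] jB Suc by simp
      qed (use less in simp)
    qed
  qed
  have up: "v \<in> V \<Longrightarrow> x \<in> B \<Longrightarrow> src x = v \<Longrightarrow> \<exists>y\<in>B. src y = rt" for v x
  proof (induction arbitrary: x rule: tree_induct)
    case (step v)
    have "tw (pd v) \<in> B" using star[OF step(4), of "tw (pd v)"] step tw_pd_A src_tw pd_A dst_pd by auto
    then have "pd v \<in> B" using tw tw_tw pd_A step by metis
    then show ?case using step.IH by blast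
  qed auto
  have "\<exists>y\<in>B. src y = v" if "v \<in> V" for v
    using that
  proof (induction rule: tree_induct)
    case root
    obtain x where "x \<in> B" using B by blast
    then show ?case using up[of "src x" x] B src_V by blast
  next
    case (step v)
    then have "pd v \<in> B" using star pd_A by metis
    then show ?case using tw[of "pd v"] step src_tw pd_A dst_pd by metis
  qed
  then have "A \<subseteq> B" using star src_V by (metis subsetI)
  then show ?thesis using B by blast
qed

abbreviation t :: "nat \<Rightarrow> nat" where "t k \<equiv> (nxt ^^ k) (ftd d)"

lemma ftd_d:
  assumes "A \<noteq> {}"
  shows "ftd d \<in> A" "src (ftd d) = rt"
proof -
  obtain a where a: "a \<in> A" using assms by blast
  then obtain v where "v \<in> V" "v \<noteq> rt" by (auto elim: A_cases)
  then obtain c where c: "c \<in> V" "c \<noteq> rt" "src (pd c) = rt"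
    using child_towards[of rt v] anc_rt by metis
  obtain k where "ftd d = (nx ^^ k) d" "ftd d \<in> A"
    using ftd[of d "pd c"] c pd_A d_Dt src_d by metis
  then show "ftd d \<in> A" "src (ftd d) = rt" using nx_pow d_Dt src_d by auto
qed

lemma tour_bij:
  assumes "A \<noteq> {}"
  shows "inj_on t {..<card A}" "t ` {..<card A} = A"
proof -
  have sub: "range t \<subseteq> A"
  proof
    fix x assume "x \<in> range t"
    then obtain k where "x = t k" by blast
    moreover have "t k \<in> A" using ftd_d[OF assms] nxt_A by (induction k) auto
    ultimately show "x \<in> A" by simp
  qed
  have "nxt ` range t \<subseteq> range t"
  proof
    fix x assume "x \<in> nxt ` range t"
    then obtain k where "x = t (Suc k)" by auto
    then show "x \<in> range t" by blast
  qed
  then have "range t = A" using nxt_transitive[of "range t"] sub by blast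
  then have "\<And>y. y \<in> A \<Longrightarrow> \<exists>k. t k = y" by (metis (no_types, lifting) imageE)
  then show "inj_on t {..<card A}" "t ` {..<card A} = A"
    using cyclic_enumeration[of A nxt "ftd d"] finite_A nxt_inj nxt_A ftd_d[OF assms] by (auto simp: image_subset_iff)
qed

text \<open>Only \<open>e\<close> can be entered from outside \<open>Z\<close>, and the start of the
  tour is outside \<open>Z\<close> unless it is \<open>e\<close>. So going backwards from any
  position in \<open>Z\<close> one stays in \<open>Z\<close> down to the position of
  \<open>e\<close>.\<close>

lemma tour_interval:
  assumes Z: "Z \<subseteq> A" "e \<in> Z" "ftd d \<in> Z \<Longrightarrow> ftd d = e"
    and entry: "\<And>y. y \<in> A \<Longrightarrow> nxt y \<in> Z \<Longrightarrow> nxt y \<noteq> e \<Longrightarrow> y \<in> Z"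
  obtains p q where "p < q" "q \<le> card A" "t p = e" "{k. k < card A \<and> t k \<in> Z} = {p..<q}"
proof -
  have ne: "A \<noteq> {}" using Z by blast
  note tb = tour_bij[OF ne]
  obtain p where p: "p < card A" "t p = e" using tb Z by (metis (no_types, lifting) imageE lessThan_iff subsetD)
  define J where "J = {k. k < card A \<and> t k \<in> Z}"
  have J: "k \<in> J \<longleftrightarrow> k < card A \<and> t k \<in> Z" for k by (simp add: J_def)
  have down: "0 < k \<and> k - 1 \<in> J" if "k \<in> J" "k \<noteq> p" for k
  proof -
    have ke: "t k \<noteq> e" using that p tb(1) J by (metis inj_onD lessThan_iff)
    then have k0: "0 < k" using that Z(3) J[of k] ke by (cases k) auto
    then have nk: "nxt (t (k - 1)) = t k" by (cases k) auto
    have tA: "t (k - 1) \<in> A" using tb(2) that J[of k] by auto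
    have "t (k - 1) \<in> Z" using entry[OF tA] nk ke J that(1) by metis
    then show ?thesis using J k0 that(1) by (metis diff_le_self order.strict_trans1)
  qed
  have ge: "p \<le> k" if "k \<in> J" for k
    using that
  proof (induction k rule: less_induct)
    case (less k)
    show ?case
    proof (cases "k = p")
      case False
      then have "p \<le> k - 1" using down[OF less.prems] less.IH[of "k - 1"] by simp
      then show ?thesis by simp
    qed simp
  qed
  have conv: "k \<in> J" if "m \<in> J" "p \<le> k" "k \<le> m" for k m
    using that(3,1,2)
  proof (induction rule: inc_induct)
    case (step n)
    then have "Suc n \<in> J" "Suc n \<noteq> p" by auto
    then show ?case using down[of "Suc n"] by simp
  qed
  have pJ: "p \<in> J" using p Z J by simp
  have M: "Max J \<in> J" using pJ by (intro Max_in) (auto simp: J_def)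
  have "J = {p..<Suc (Max J)}"
  proof
    show "J \<subseteq> {p..<Suc (Max J)}" using ge by (auto simp: less_Suc_eq_le J_def)
    show "{p..<Suc (Max J)} \<subseteq> J" using conv[OF M] by (simp add: less_Suc_eq_le subset_iff)
  qed
  moreover have "p < Suc (Max J)" using ge[OF M] by simp
  moreover have "Suc (Max J) \<le> card A" using M J by simp
  ultimately show ?thesis using that[of p "Suc (Max J)"] p unfolding J_def[symmetric] by simp
qed

section \<open>Subtrees as intervals of the preorder\<close>

lemma set_pre: "set pre = V"
proof -
  have "dst ` A \<union> {rt} = V" using dst_V rt_V dst_pd pd_A by (auto simp: image_iff) metis
  moreover have "set tour_list = A"
  proof -
    have "set tour_list = t ` {..<card A}" by (simp add: tour_list_def atLeast0LessThan)
    then show ?thesis using tour_bij(2) by (metis card.empty image_empty lessThan_0)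
  qed
  ultimately show ?thesis by (auto simp: pre_def)
qed

lemma distinct_pre: "distinct pre"
  by (simp add: pre_def)

lemma length_pre: "length pre = card V"
  using distinct_card[OF distinct_pre] set_pre by simp

lemma hd_pre: "hd pre = rt"
  by (simp add: pre_def hd_first_occs)

text \<open>The tour enters the subtree of \<open>v\<close> only through \<open>pd v\<close>, so the
  darts with head in the subtree form one interval of the tour. All visits to its nodes fall into
  this interval, which makes their first visits contiguous and \<open>v\<close> the first of
  them.\<close>

lemma pre_sub:
  assumes "v \<in> V"
  obtains xs ys zs where "pre = xs @ ys @ zs" "set ys = sub v" "hd ys = v"
proof (cases "v = rt")
  case True
  then show ?thesis using that[of "[]" pre "[]"] set_pre sub_rt hd_pre by simp
next
  case False
  let ?Z = "{a \<in> A. dst a \<in> sub v}"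
  have e: "pd v \<in> ?Z" using assms False pd_A dst_pd sub_self by simp
  have r: "rt \<notin> sub v" using rt_sub assms False by simp
  obtain p q where pq: "p < q" "q \<le> card A" "t p = pd v" "{k. k < card A \<and> t k \<in> ?Z} = {p..<q}"
  proof (rule tour_interval[of ?Z "pd v"])
    show "?Z \<subseteq> A" by blast
    show "pd v \<in> ?Z" by (rule e)
    show "ftd d = pd v" if "ftd d \<in> ?Z"
      using that ftd_d entry_dart[OF _ assms False] r by auto
    show "y \<in> ?Z" if "y \<in> A" "nxt y \<in> ?Z" "nxt y \<noteq> pd v" for y
      using that entry_dart[OF _ assms False, of "nxt y"] src_nxt by auto
  qed (use that in blast)
  have im: "dst ` ?Z = sub v"
  proof
    show "sub v \<subseteq> dst ` ?Z"
    proof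
      fix w assume w: "w \<in> sub v"
      then have "w \<in> V" "w \<noteq> rt" using r sub_V by auto
      then show "w \<in> dst ` ?Z" using w dst_pd pd_A by (metis (mono_tags, lifting) image_eqI mem_Collect_eq)
    qed
  qed auto
  have ne: "A \<noteq> {}" using e by blast
  let ?f = "\<lambda>k. dst (t k)"
  have inA: "t k \<in> A" if "k < card A" for k using tour_bij(2)[OF ne] that by blast
  have inZ: "t k \<in> ?Z \<longleftrightarrow> p \<le> k \<and> k < q" if "k < card A" for k
    using pq(4) that by (metis (mono_tags, lifting) atLeastLessThan_iff mem_Collect_eq)
  define L1 L2 L3 where "L1 = rt # map ?f [0..<p]" "L2 = map ?f [p..<q]" "L3 = map ?f [q..<card A]"
  have L: "rt # map dst tour_list = L1 @ L2 @ L3"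
    using pq(1,2) by (simp add: L1_L2_L3_def tour_list_def upt_append flip: map_append)
  have "?Z = t ` {p..<q}"
  proof
    show "?Z \<subseteq> t ` {p..<q}"
    proof
      fix a assume a: "a \<in> ?Z"
      then obtain k where "k < card A" "a = t k" using tour_bij(2)[OF ne] by blast
      then show "a \<in> t ` {p..<q}" using inZ a by auto
    qed
    show "t ` {p..<q} \<subseteq> ?Z"
    proof
      fix a assume "a \<in> t ` {p..<q}"
      then obtain k where k: "p \<le> k" "k < q" "a = t k" by auto
      then have "k < card A" using pq(2) by simp
      then show "a \<in> ?Z" using inZ[of k] k by blast
    qed
  qed
  then have s2: "set L2 = sub v" using im by (auto simp: L1_L2_L3_def image_image)
  have s13: "set L1 \<inter> sub v = {}" "set L3 \<inter> sub v = {}"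
    using inZ inA r pq(1,2) by (auto simp: L1_L2_L3_def)
  have "filter (\<lambda>x. x \<notin> set L1) (first_occs L2) = first_occs L2"
    using s13 s2 by (auto simp: filter_id_conv)
  then have "pre = first_occs L1 @ first_occs L2 @ filter (\<lambda>x. x \<notin> set L1) (filter (\<lambda>x. x \<notin> set L2) (first_occs L3))"
    by (simp add: pre_def L first_occs_append del: filter_filter)
  moreover have "hd (first_occs L2) = v"
    using pq(1,3) dst_pd[OF assms False] by (simp add: hd_first_occs L1_L2_L3_def upt_conv_Cons)
  ultimately show ?thesis using that s2 by simp
qed

abbreviation pos :: "nat \<Rightarrow> nat" where "pos \<equiv> rank pre"

lemma pos_less: "v \<in> V \<Longrightarrow> pos v < card V"
  using rank_less[OF distinct_pre] set_pre length_pre by simp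

lemma nth_pos: "v \<in> V \<Longrightarrow> pre ! pos v = v"
  using nth_rank[OF distinct_pre] set_pre by simp

lemma pos_nth: "k < card V \<Longrightarrow> pos (pre ! k) = k" 
  using rank_nth[OF distinct_pre] length_pre by simp

lemma nth_V: "k < card V \<Longrightarrow> pre ! k \<in> V"
  using set_pre length_pre nth_mem by metis

lemma pos_rt: "pos rt = 0"
  using pos_nth[of 0] hd_pre rt_V finite_V length_pre by (metis card_gt_0_iff empty_iff hd_conv_nth length_greater_0_conv)

lemma sub_pos:
  assumes "v \<in> V"
  shows "pos v + card (sub v) \<le> card V"
    "y \<in> V \<Longrightarrow> y \<in> sub v \<longleftrightarrow> pos v \<le> pos y \<and> pos y < pos v + card (sub v)"
proof -
  obtain xs ys zs where p: "pre = xs @ ys @ zs" "set ys = sub v" "hd ys = v" using pre_sub[OF assms] by blast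
  have d: "distinct (xs @ ys @ zs)" using distinct_pre p by simp
  have c: "card (sub v) = length ys" using d p distinct_card by fastforce
  have ne: "ys \<noteq> []" using p(2) sub_self[OF assms] by (metis empty_iff list.set(1))
  have "pre ! length xs = v" using p ne by (simp add: nth_append hd_conv_nth)
  then have v: "pos v = length xs" using pos_nth[of "length xs"] length_pre p ne by (metis add_gr_0 length_append length_greater_0_conv less_add_same_cancel1)
  show "pos v + card (sub v) \<le> card V" using v c length_pre p by (metis length_append le_add1 add.assoc)
  show "y \<in> sub v \<longleftrightarrow> pos v \<le> pos y \<and> pos y < pos v + card (sub v)" if "y \<in> V"
  proof -
    have "y \<in> set (xs @ ys @ zs)" using that set_pre p(1) by metis
    then show ?thesis using rank_append(2)[OF d] p v c by metis
  qed
qed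

lemma sub_interval:
  assumes "v \<in> V" "x \<in> V" "anc v x"
  shows "pos v \<le> pos x" "pos x + card (sub x) \<le> pos v + card (sub v)"
proof -
  have x: "x \<in> sub v" "sub x \<subseteq> sub v" using assms sub_mono by (auto simp: sub_def)
  then show "pos v \<le> pos x" using sub_pos(2)[OF assms(1,2)] by simp
  \<comment> \<open>The node of the subtree of \<open>x\<close> that comes last in the
    preorder.\<close>
  let ?e = "pre ! (pos x + card (sub x) - 1)"
  have c: "0 < card (sub x)" using sub_self[OF assms(2)] finite_sub card_gt_0_iff by blast
  have e: "?e \<in> V" "pos ?e = pos x + card (sub x) - 1"
    using c sub_pos(1)[OF assms(2)] nth_V pos_nth by auto
  then have "?e \<in> sub v" using sub_pos(2)[OF assms(2) e(1)] c x by auto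
  then have "pos x + card (sub x) - 1 < pos v + card (sub v)" using sub_pos(2)[OF assms(1) e(1)] e by simp
  then show "pos x + card (sub x) \<le> pos v + card (sub v)" using c by linarith
qed

section \<open>The order of the subtrees at the root\<close>

definition root_dart :: "nat \<Rightarrow> nat" where "root_dart i = (nx ^^ i) d"

definition root_deg :: nat where "root_deg = card {a \<in> Dt. src a = rt}"

lemma root_dart_enum:
  shows "inj_on root_dart {..<root_deg}" "root_dart ` {..<root_deg} = {a \<in> Dt. src a = rt}"
    "(nx ^^ root_deg) d = d"
proof -
  let ?R = "{a \<in> Dt. src a = rt}"
  have "finite ?R" "inj_on nx ?R" "nx ` ?R \<subseteq> ?R" "d \<in> ?R"
    using finite_Dt nx_inj nx_Dt src_nx d_Dt src_d by (auto intro: inj_on_subset)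
  moreover have "\<exists>k. (nx ^^ k) d = y" if "y \<in> ?R" for y using nx_cyc d_Dt src_d that by auto
  ultimately show "inj_on root_dart {..<root_deg}" "root_dart ` {..<root_deg} = ?R" "(nx ^^ root_deg) d = d"
    using cyclic_enumeration[of ?R nx d] unfolding root_dart_def root_deg_def by auto
qed

lemma root_dart_Dt: "root_dart i \<in> Dt" "src (root_dart i) = rt"
  using nx_pow[OF d_Dt] src_d by (simp_all add: root_dart_def)

lemma root_dart_pd:
  assumes "a \<in> A" "src a = rt" shows "a = pd (dst a)" "dst a \<noteq> rt" "dst a \<in> V"
proof -
  have "a = pd (dst a) \<and> dst a \<noteq> rt \<and> dst a \<in> V" using assms(1)
  proof (cases rule: A_cases)
    case (up w)
    then show ?thesis using assms src_tw[of "pd w"] pd_A dst_pd by simp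
  qed (simp add: dst_pd)
  then show "a = pd (dst a)" "dst a \<noteq> rt" "dst a \<in> V" by auto
qed

text \<open>Darts around the root that are not in the tree are skipped, so that \<open>i\<close> can
  count all darts of the root; for the cotree these are the darts of \<open>h\<close>.\<close>

definition before :: "nat \<Rightarrow> nat set" where
  "before i = (\<Union>j\<in>{j. j < i \<and> root_dart j \<in> A}. sub (dst (root_dart j)))"

lemma child_disjoint:
  assumes "a \<in> A" "src a = rt" "b \<in> A" "src b = rt" "x \<in> sub (dst a)" "x \<in> sub (dst b)"
  shows "a = b"
proof -
  note a = root_dart_pd[OF assms(1,2)] and b = root_dart_pd[OF assms(3,4)]
  have "anc (dst a) x" "anc (dst b) x" "x \<in> V" using assms by (auto simp: sub_def)
  moreover have "dp (dst a) = 1" "dp (dst b) = 1" using dp_pd a b assms dp_rt by (metis One_nat_def)+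
  ultimately have "anc (dst a) (dst b)" using anc_chain[of "dst a" x "dst b"] by simp
  then have "dst a = dst b" using anc_eq_dp b \<open>dp (dst a) = 1\<close> \<open>dp (dst b) = 1\<close> by simp
  then show ?thesis using a b by metis
qed

text \<open>The darts that touch \<open>before i\<close> can be entered by the tour only at its very
  first dart, so they form an initial interval of it. Counting a dart by either endpoint keeps in
  this set the passage through the root from one subtree to the next.\<close>

lemma pos_before:
  assumes i: "i \<le> root_deg" and f: "f \<in> before i" and g: "g \<in> V" "g \<notin> before i" "g \<noteq> rt"
  shows "pos f < pos g"
proof -
  let ?X = "before i"
  let ?Z = "{a \<in> A. src a \<in> ?X \<or> dst a \<in> ?X}"
  have XV: "?X \<subseteq> V" "rt \<notin> ?X" using sub_V rt_sub root_dart_pd root_dart_Dt unfolding before_def by blast+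
  obtain j0 where j0: "j0 < i" "root_dart j0 \<in> A" using f unfolding before_def by blast
  have ne: "A \<noteq> {}" using j0 by blast
  obtain m where m: "ftd d = (nx ^^ m) d" "ftd d \<in> A" "\<And>j. j < m \<Longrightarrow> (nx ^^ j) d \<notin> A"
    using ftd[of d "root_dart j0"] j0 root_dart_Dt d_Dt src_d by metis
  have "m \<le> j0" using m(3)[of j0] j0 by (metis root_dart_def leI)
  then have "dst (ftd d) \<in> ?X" unfolding before_def using m j0 sub_self root_dart_pd ftd_d[OF ne]
    by (auto simp: root_dart_def intro!: exI[of _ m])
  then have eZ: "ftd d \<in> ?Z" using m by simp
  obtain p q where pq: "p < q" "q \<le> card A" "t p = ftd d" "{k. k < card A \<and> t k \<in> ?Z} = {p..<q}"
  proof (rule tour_interval[of ?Z "ftd d"])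
    show "y \<in> ?Z" if y: "y \<in> A" "nxt y \<in> ?Z" "nxt y \<noteq> ftd d" for y
    proof (cases "dst y \<in> ?X")
      case False
      then have sn: "src (nxt y) \<notin> ?X" using src_nxt y by simp
      then have "dst (nxt y) \<in> ?X" using y by simp
      then obtain j where j: "j < i" "root_dart j \<in> A" "dst (nxt y) \<in> sub (dst (root_dart j))"
        unfolding before_def by blast
      have "src (nxt y) \<notin> sub (dst (root_dart j))" using sn j unfolding before_def by blast
      then have "nxt y = pd (dst (root_dart j))"
        using entry_dart[of "nxt y" "dst (root_dart j)"] j root_dart_pd[OF j(2) root_dart_Dt(2)] y nxt_A by simp
      then have nj: "nxt y = root_dart j" using root_dart_pd[OF j(2) root_dart_Dt(2)] by simp
      then have dy: "dst y = rt" using src_nxt y root_dart_Dt by metis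
      have ty: "tw y \<in> A" "src (tw y) = rt" using y tw_A src_tw dy by auto
      then have "tw y \<in> {a \<in> Dt. src a = rt}" using A_Dt by auto
      then obtain l where l: "l < root_deg" "tw y = root_dart l" using root_dart_enum(2) by (metis (no_types, lifting) imageE lessThan_iff)
      \<comment> \<open>The tour came up to the root through the \<open>l\<close>-th dart and goes
        down through the \<open>j\<close>-th, where \<open>j < i\<close>. If
        \<open>i \<le> l\<close>, the rotation has passed \<open>d\<close> in between, so the next
        dart is the first tree dart from \<open>d\<close> on.\<close>
      show ?thesis
      proof (cases "l < i")
        case True
        then have "src y \<in> ?X" unfolding before_def using l ty root_dart_pd[OF ty] sub_self[of "dst (tw y)"] dst_tw[OF y(1)] by auto
        then show ?thesis using y by simp
      next
        case False
        obtain k where k: "nxt y = (nx ^^ Suc k) (tw y)" "\<And>j. j < k \<Longrightarrow> (nx ^^ Suc j) (tw y) \<notin> A"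
          using nxt[OF y(1)] by metis
        have pw: "(nx ^^ j) (tw y) = (nx ^^ (j + l)) d" for j
          using l by (simp add: root_dart_def funpow_add)
        have per: "(nx ^^ (root_deg + j)) d = (nx ^^ j) d" for j
          using root_dart_enum(3) by (metis add.commute funpow_add o_apply)
        have "root_deg \<le> Suc (k + l)"
        proof (rule ccontr)
          assume "\<not> root_deg \<le> Suc (k + l)"
          moreover have "root_dart (Suc (k + l)) = root_dart j" using k pw[of "Suc k"] nj by (simp add: root_dart_def)
          ultimately show False using root_dart_enum(1) j False i by (auto dest!: inj_onD)
        qed
        then obtain m' where m': "Suc (k + l) = root_deg + m'" using le_Suc_ex by blast
        have "(nx ^^ m') d = nxt y" using per[of m'] m' k pw[of "Suc k"] by simp
        then have "m \<le> m'" using m(3)[of m'] nxt_A y by (metis not_less)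
        have "\<exists>j. root_deg + m = Suc j + l" using l by (intro exI[of _ "root_deg + m - Suc l"]) simp
        then obtain j' where j': "root_deg + m = Suc j' + l" by blast
        have "(nx ^^ Suc j') (tw y) \<in> A" using pw[of "Suc j'"] j' per[of m] m by simp
        then have "k \<le> j'" using k(2)[of j'] by (metis not_less)
        then have "m' = m" using \<open>m \<le> m'\<close> j' m' by simp
        then have "nxt y = ftd d" using \<open>(nx ^^ m') d = nxt y\<close> m by simp
        then show ?thesis using y by simp
      qed
    qed (use y in simp)
  qed (use eZ that in auto)
  have "p = 0" using inj_onD[OF tour_bij(1)[OF ne], of p 0] pq(1-3) by simp
  let ?f = "\<lambda>k. dst (t k)"
  have inA: "t k \<in> A" if "k < card A" for k using tour_bij(2)[OF ne] that by blast
  have inZ: "t k \<in> ?Z \<longleftrightarrow> k < q" if "k < card A" for k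
    using pq(4) that \<open>p = 0\<close> by (metis (mono_tags, lifting) atLeastLessThan_iff mem_Collect_eq zero_le)
  define L1 L2 where "L1 = rt # map ?f [0..<q]" "L2 = map ?f [q..<card A]"
  have L: "rt # map dst tour_list = L1 @ L2"
    using pq(1,2) by (simp add: L1_L2_def tour_list_def upt_append flip: map_append)
  have fL: "f \<in> set L1"
  proof -
    have fr: "f \<noteq> rt" "f \<in> V" using f XV by auto
    then have "pd f \<in> ?Z" using pd_A dst_pd f by simp
    then obtain k where "k < card A" "t k = pd f" using tour_bij(2)[OF ne] by (metis (no_types, lifting) imageE lessThan_iff mem_Collect_eq)
    then show ?thesis using inZ[of k] \<open>pd f \<in> ?Z\<close> dst_pd[of f] fr unfolding L1_L2_def by (auto simp: image_iff intro!: bexI[of _ k])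
  qed
  have gL: "g \<notin> set L1"
  proof
    assume "g \<in> set L1"
    then obtain k where k: "k < q" "g = dst (t k)" using g unfolding L1_L2_def by auto
    then have tz: "t k \<in> ?Z" using inZ pq by simp
    then have "src (t k) \<in> ?X" using k g by auto
    then obtain j where j: "j < i" "root_dart j \<in> A" "src (t k) \<in> sub (dst (root_dart j))" unfolding before_def by blast
    have "g \<notin> sub (dst (root_dart j))" using g j unfolding before_def by blast
    then have "t k = tw (pd (dst (root_dart j)))"
      using exit_dart[of "t k" "dst (root_dart j)"] root_dart_pd[OF j(2) root_dart_Dt(2)] j tz k by simp
    then have "t k = tw (root_dart j)" using root_dart_pd[OF j(2) root_dart_Dt(2)] by simp
    then have "g = rt" using k dst_tw[OF j(2)] root_dart_Dt by simp
    then show False using g by simp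
  qed
  have pre: "pre = first_occs L1 @ [] @ filter (\<lambda>x. x \<notin> set L1) (first_occs L2)"
    by (simp add: pre_def L first_occs_append)
  have "pos f < length (first_occs L1)" "\<not> pos g < length (first_occs L1)"
    using rank_append(1)[of "first_occs L1" "[]" "filter (\<lambda>x. x \<notin> set L1) (first_occs L2)"] pre distinct_pre set_pre fL gL g f XV
    by (metis set_first_occs subsetD)+
  then show ?thesis by simp
qed

text \<open>Membership in \<open>before i\<close> becomes a comparison of ranks. If \<open>f\<close>
  lay below a later child, \<open>pos_before\<close> applied to that child would place
  \<open>dst (root_dart i)\<close> before \<open>f\<close>.\<close>

lemma before_pos:
  assumes i: "i < root_deg" "root_dart i \<in> A" and f: "f \<in> V" "f \<noteq> rt"
  shows "f \<in> before i \<longleftrightarrow> pos f < pos (dst (root_dart i))"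
proof
  let ?y = "dst (root_dart i)"
  note y = root_dart_pd[OF i(2) root_dart_Dt(2)]
  have neq: "root_dart j \<noteq> root_dart i" if "j < i" for j
    using that i root_dart_enum(1) by (auto dest: inj_onD)
  have yb: "?y \<notin> before i"
  proof
    assume "?y \<in> before i"
    then obtain j where "j < i" "root_dart j \<in> A" "?y \<in> sub (dst (root_dart j))" unfolding before_def by blast
    then show False using child_disjoint[of "root_dart j" "root_dart i" ?y] neq[of j] i root_dart_Dt sub_self y by simp
  qed
  show "pos f < pos ?y" if "f \<in> before i" using pos_before[OF _ that y(3) yb y(2)] i by simp
  show "f \<in> before i" if lt: "pos f < pos ?y"
  proof -
    obtain c where c: "c \<in> V" "c \<noteq> rt" "src (pd c) = rt" "anc c f"
      using child_towards[OF anc_rt[OF f(1)] f] by metis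
    have "pd c \<in> {a \<in> Dt. src a = rt}" using c pd_A A_Dt by auto
    then obtain l where l: "l < root_deg" "pd c = root_dart l" using root_dart_enum(2) by (metis (no_types, lifting) imageE lessThan_iff)
    have lA: "root_dart l \<in> A" and dl: "dst (root_dart l) = c" using c l pd_A dst_pd by metis+
    have fc: "f \<in> sub c" using c f by (simp add: sub_def)
    show ?thesis
    proof (rule ccontr)
      assume nf: "f \<notin> before i"
      then have "\<not> l < i" using fc lA dl unfolding before_def by blast
      moreover have "l \<noteq> i" using sub_pos(2)[OF y(3) f(1)] fc dl lt by auto
      ultimately have "i < l" by simp
      then have "?y \<in> before l" unfolding before_def using i sub_self[OF y(3)] by blast
      moreover have "f \<notin> before l"
      proof
        assume "f \<in> before l"
        then obtain j where j: "j < l" "root_dart j \<in> A" "f \<in> sub (dst (root_dart j))" unfolding before_def by blast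
        then have "root_dart j = root_dart l" using child_disjoint[of "root_dart j" "root_dart l" f] lA root_dart_Dt fc dl by simp
        then show False using j l root_dart_enum(1) by (auto dest!: inj_onD)
      qed
      ultimately have "pos ?y < pos f" using pos_before[of l ?y f] l f by simp
      then show False using lt by simp
    qed
  qed
qed

end


section \<open>Plane maps and their dual spanning trees\<close>

locale plane_map =
  fixes H :: plane_digraph
  assumes emb: "embedded_in_plane H"
begin

abbreviation "st \<equiv> tail (graph H)"
abbreviation "en \<equiv> head (graph H)"
abbreviation "tw \<equiv> twin H"
abbreviation "DD \<equiv> darts H"
abbreviation "V \<equiv> verts (graph H)"
abbreviation "fs \<equiv> face_succ H"
abbreviation "out v \<equiv> {a \<in> DD. st a = v}"

lemma fin_dart_graph: "fin_digraph (dart_graph H)"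
  and bidirected: "bidirected_digraph (dart_graph H) tw"
  and arcs_darts: "arcs (graph H) \<subseteq> DD"
  and rot_permutes: "rot H permutes DD"
  and face_darts_orbit: "a \<in> DD \<Longrightarrow> face_darts H (face H a) = orbit fs a"
  and euler: "2 * card V + 2 * card (faces H) = card DD + 4"
  using emb by (simp_all add: embedded_in_plane_def)

lemma dart_graph_simps [simp]:
  "verts (dart_graph H) = V" "arcs (dart_graph H) = DD"
  "tail (dart_graph H) = st" "head (dart_graph H) = en"
  by (simp_all add: dart_graph_def)

lemma finite_V: "finite V" and finite_DD: "finite DD"
  using fin_digraph.finite_verts[OF fin_dart_graph] fin_digraph.finite_arcs[OF fin_dart_graph] by simp_all

lemma st_V: "a \<in> DD \<Longrightarrow> st a \<in> V" and en_V: "a \<in> DD \<Longrightarrow> en a \<in> V"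
  using wf_digraph.tail_in_verts[of "dart_graph H"] wf_digraph.head_in_verts[of "dart_graph H"]
    fin_digraph.axioms(1)[OF fin_dart_graph] by auto

lemma tw_DD: "a \<in> DD \<Longrightarrow> tw a \<in> DD" and tw_ne: "a \<in> DD \<Longrightarrow> tw a \<noteq> a"
  and tw_tw [simp]: "tw (tw a) = a"
  and st_tw: "a \<in> DD \<Longrightarrow> st (tw a) = en a" and en_tw: "a \<in> DD \<Longrightarrow> en (tw a) = st a"
  using bidirected_digraph.arev_in_arcs[OF bidirected] bidirected_digraph.arev_neq[OF bidirected]
    bidirected_digraph.arev_arev[OF bidirected] bidirected_digraph.tail_arev[OF bidirected]
    bidirected_digraph.head_arev[OF bidirected] by auto

lemma tw_inj: "inj_on tw S"
  by (metis inj_on_inverseI tw_tw)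

lemma rot_cyclic: "a \<in> DD \<Longrightarrow> cyclic_on (rot H) (out (st a))"
  using emb st_V[of a] by (auto simp: embedded_in_plane_def out_arcs_def)

lemma rot_DD: "a \<in> DD \<Longrightarrow> rot H a \<in> DD" and st_rot: "a \<in> DD \<Longrightarrow> st (rot H a) = st a"
  using cyclic_on_inI[OF rot_cyclic[of a], of a] by auto

lemma rot_inj: "inj_on (rot H) S"
  using permutes_inj[OF rot_permutes] by (meson inj_on_subset subset_UNIV)

lemma orbit_funpow: "y \<in> orbit f x \<Longrightarrow> \<exists>k. (f ^^ k) x = y"
  by (auto simp: orbit_altdef)

lemma rot_cyc: "a \<in> DD \<Longrightarrow> b \<in> DD \<Longrightarrow> st a = st b \<Longrightarrow> \<exists>k. (rot H ^^ k) a = b"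
  using rot_cyclic[of a] by (intro orbit_funpow) (auto simp: cyclic_on_alldef)

lemma fs_eq: "fs a = rot H (tw a)"
  by (simp add: face_succ_def)

lemma fs_DD: "a \<in> DD \<Longrightarrow> fs a \<in> DD" and st_fs: "a \<in> DD \<Longrightarrow> st (fs a) = en a"
  by (simp_all add: fs_eq rot_DD st_rot tw_DD st_tw)

lemma fs_inj: "inj_on fs S"
  unfolding face_succ_def by (intro comp_inj_on tw_inj rot_inj)

lemma face_fs: "a \<in> DD \<Longrightarrow> face H (fs a) = face H a"
  using face_darts_orbit[of a] orbit.base[of fs a] by (auto simp: face_darts_def)

lemma face_rot: "a \<in> DD \<Longrightarrow> face H (rot H a) = face H (tw a)"
  using face_fs[of "tw a"] tw_DD by (simp add: fs_eq)

lemma fs_cyc: "a \<in> DD \<Longrightarrow> b \<in> DD \<Longrightarrow> face H a = face H b \<Longrightarrow> \<exists>k. (fs ^^ k) a = b"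
  using face_darts_orbit[of a] by (intro orbit_funpow) (auto simp: face_darts_def)

lemma finite_faces: "finite (faces H)"
  using finite_DD by (simp add: faces_def)

lemma face_faces: "a \<in> DD \<Longrightarrow> face H a \<in> faces H"
  by (simp add: faces_def)

lemma rot_bij: "bij_betw (rot H) (out v) (out v)"
proof -
  have "rot H ` out v \<subseteq> out v" using rot_DD st_rot by auto
  then show ?thesis using endo_inj_surj[of "out v" "rot H"] finite_DD rot_inj[of "out v"] by (simp add: bij_betw_def)
qed

lemma tw_bij: "bij_betw tw DD DD"
  using tw_DD by (intro bij_betwI[where g = tw]) auto

lemma dart_connected:
  assumes "u \<in> V" "v \<in> V" "P u" and step: "\<And>a. a \<in> DD \<Longrightarrow> P (st a) \<Longrightarrow> P (en a)"
  shows "P v"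
proof -
  have "connected (dart_graph H)" using emb by (simp add: embedded_in_plane_def)
  then have "u \<rightarrow>\<^sup>*\<^bsub>with_proj (mk_symmetric (dart_graph H))\<^esub> v"
    using assms by (simp add: connected_def strongly_connected_def mk_symmetric_def)
  then have "(u, v) \<in> rtrancl_on V (\<Union>e\<in>DD. {(st e, en e), (en e, st e)})"
    by (simp add: reachable_def mk_symmetric_def)
  then show ?thesis using \<open>P u\<close>
  proof (induction rule: rtrancl_on_induct)
    case (step v w)
    then obtain e where "e \<in> DD" "(v, w) = (st e, en e) \<or> (v, w) = (en e, st e)" by auto
    then show ?case using assms(4)[of e] assms(4)[of "tw e"] step st_tw en_tw tw_DD by auto
  qed simp
qed

text \<open>The net flow out of \<open>v\<close> of the antisymmetric function \<open>a \<mapsto> I a - I (twin a)\<close> compares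
  consecutive darts around \<open>v\<close>; it vanishes if \<open>I\<close> depends only on the face beside the dart.\<close>

lemma flow_out: "(\<Sum>a\<in>out v. I a - I (tw a)) = (\<Sum>a\<in>out v. I (rot H a) - I (tw a) :: int)"
  using sum.reindex_bij_betw[OF rot_bij, of I v] by (simp add: sum_subtractf)

text \<open>The integral 1-chain of a walk, as an antisymmetric function on darts.\<close>

definition walk_flow :: "nat list \<Rightarrow> nat \<Rightarrow> int" where
  "walk_flow p a = int (count_list p a) - int (count_list p (tw a))"

lemma walk_flow_Nil [simp]: "walk_flow [] a = 0"
  and walk_flow_append [simp]: "walk_flow (p @ q) a = walk_flow p a + walk_flow q a"
  by (simp_all add: walk_flow_def)

lemma walk_flow_tw: "walk_flow p (tw a) = - walk_flow p a"
  by (simp add: walk_flow_def)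

lemma walk_flow_out1: "a \<in> DD \<Longrightarrow> (\<Sum>b\<in>out v. walk_flow [a] b) = of_bool (v = st a) - of_bool (v = en a)"
proof -
  assume a: "a \<in> DD"
  have e: "walk_flow [a] b = of_bool (b = a) - of_bool (b = tw a)" for b
    by (auto simp: walk_flow_def)
  have "(\<Sum>b\<in>out v. of_bool (b = c) :: int) = of_bool (c \<in> out v)" for c
    using finite_DD by (simp add: of_bool_def sum.delta)
  then show ?thesis using a tw_DD st_tw by (simp add: e sum_subtractf)
qed

text \<open>Each step of the walk is counted twice, at its dart and at the twin, where both factors
  change sign.\<close>

lemma walk_flow_sum:
  fixes \<chi> :: "nat \<Rightarrow> int"
  assumes anti: "\<And>a. a \<in> DD \<Longrightarrow> \<chi> (tw a) = - \<chi> a" and p: "set p \<subseteq> DD"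
  shows "(\<Sum>a\<in>DD. \<chi> a * walk_flow p a) = 2 * sum_list (map \<chi> p)"
  using p
proof (induction p)
  case (Cons a p)
  have e: "\<chi> b * walk_flow [a] b = (if b = a then \<chi> b else 0) - (if b = tw a then \<chi> b else 0)" for b
    by (auto simp: walk_flow_def)
  have "(\<Sum>b\<in>DD. \<chi> b * walk_flow [a] b) = \<chi> a - \<chi> (tw a)"
    unfolding e sum_subtractf using Cons.prems tw_DD finite_DD by (simp add: sum.delta)
  then have "(\<Sum>b\<in>DD. \<chi> b * walk_flow [a] b) = 2 * \<chi> a" using anti Cons.prems by simp
  then show ?case using Cons walk_flow_append[of "[a]" p] by (simp add: algebra_simps sum.distrib)
qed simp

text \<open>The sum over all darts is invariant under \<open>tw\<close>, which negates
  \<open>\<chi>\<close>. Adding the two forms avoids the choice of one dart per edge.\<close>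

lemma antisym_sum:
  fixes \<chi> I :: "nat \<Rightarrow> int"
  assumes anti: "\<And>a. a \<in> DD \<Longrightarrow> \<chi> (tw a) = - \<chi> a"
  shows "2 * (\<Sum>a\<in>DD. \<chi> a * I a) = (\<Sum>a\<in>DD. \<chi> a * (I a - I (tw a)))"
proof -
  have "(\<Sum>a\<in>DD. \<chi> a * I (tw a)) = (\<Sum>a\<in>DD. \<chi> (tw a) * I a)"
    using sum.reindex_bij_betw[OF tw_bij, of "\<lambda>a. \<chi> (tw a) * I a"] by simp
  also have "\<dots> = - (\<Sum>a\<in>DD. \<chi> a * I a)" using anti by (simp flip: sum_negf cong: sum.cong)
  finally show ?thesis by (simp add: algebra_simps sum_subtractf)
qed

end

section \<open>Spanning forests and the dual trees that avoid them\<close>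

locale forest = plane_map +
  fixes R :: "nat set" and pd dp :: "nat \<Rightarrow> nat"
  assumes R_V: "R \<subseteq> V"
    and pd_DD: "v \<in> V - R \<Longrightarrow> pd v \<in> DD" and en_pd: "v \<in> V - R \<Longrightarrow> en (pd v) = v"
    and dp_pd: "v \<in> V - R \<Longrightarrow> dp (st (pd v)) < dp v"
begin

definition Fo :: "nat set" where "Fo = pd ` (V - R) \<union> tw ` pd ` (V - R)"

lemma Fo_DD: "Fo \<subseteq> DD"
  using pd_DD tw_DD by (auto simp: Fo_def)

lemma Fo_tw: "a \<in> Fo \<Longrightarrow> tw a \<in> Fo"
  by (auto simp: Fo_def)

lemma card_Fo: "card Fo = 2 * (card V - card R)"
proof -
  have inj: "inj_on pd (V - R)" by (rule inj_on_inverseI[where g = en]) (simp add: en_pd)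
  have "pd v \<noteq> tw (pd w)" if "v \<in> V - R" "w \<in> V - R" for v w
  proof
    assume eq: "pd v = tw (pd w)"
    then have "st (pd v) = w" "v = st (pd w)" using st_tw en_tw pd_DD en_pd that by metis+
    then show False using dp_pd that by (metis less_asym)
  qed
  then have "card Fo = card (pd ` (V - R)) + card (tw ` pd ` (V - R))"
    unfolding Fo_def using finite_V by (intro card_Un_disjoint) auto
  also have "\<dots> = 2 * card (V - R)" using card_image[OF inj] card_image[OF tw_inj] by simp
  finally show ?thesis using R_V finite_V by (simp add: card_Diff_subset finite_subset)
qed

text \<open>Peeling leaves: let \<open>v\<close> be deepest among the nodes whose parent dart
  carries flow. Every other dart at \<open>v\<close> either lies outside the forest or leads to a
  deeper child, so conservation at \<open>v\<close> kills the flow on its parent dart as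
  well.\<close>

lemma forest_flow_zero:
  fixes \<phi> :: "nat \<Rightarrow> int"
  assumes anti: "\<And>a. a \<in> DD \<Longrightarrow> \<phi> (tw a) = - \<phi> a"
    and supp: "\<And>a. a \<in> DD \<Longrightarrow> a \<notin> Fo \<Longrightarrow> \<phi> a = 0"
    and cons: "\<And>v. v \<in> V - R \<Longrightarrow> (\<Sum>a\<in>out v. \<phi> a) = 0"
    and a: "a \<in> DD"
  shows "\<phi> a = 0"
proof (rule ccontr)
  assume na: "\<phi> a \<noteq> 0"
  let ?B = "{v \<in> V - R. \<phi> (pd v) \<noteq> 0}"
  have "?B \<noteq> {}"
  proof -
    have "a \<in> Fo" using supp a na by blast
    then obtain v where v: "v \<in> V - R" "a = pd v \<or> a = tw (pd v)" by (auto simp: Fo_def)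
    then have "\<phi> (pd v) \<noteq> 0" using na anti pd_DD by auto
    then show ?thesis using v by blast
  qed
  moreover have fB: "finite ?B" using finite_V by simp
  ultimately have "Max (dp ` ?B) \<in> dp ` ?B" by (intro Max_in) auto
  then obtain v where v: "v \<in> ?B" and vM: "dp v = Max (dp ` ?B)" by (metis (no_types, lifting) imageE)
  have max: "dp w \<le> dp v" if "w \<in> ?B" for w
    unfolding vM using that fB by (intro Max_ge) auto
  let ?e = "tw (pd v)"
  have e: "?e \<in> out v" using v tw_DD st_tw pd_DD en_pd by auto
  have z: "\<phi> b = 0" if b: "b \<in> out v" "b \<noteq> ?e" for b
  proof (rule ccontr)
    assume nb: "\<phi> b \<noteq> 0"
    then have "b \<in> Fo" using supp b by blast
    then obtain w where w: "w \<in> V - R" "b = pd w \<or> b = tw (pd w)" by (auto simp: Fo_def)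
    then consider "b = pd w" | "b = tw (pd w)" by blast
    then show False
    proof cases
      case 1
      then have "dp v < dp w" using dp_pd w b by auto
      moreover have "w \<in> ?B" using nb 1 w by simp
      ultimately show False using max by fastforce
    next
      case 2
      then have "w = v" using w b st_tw pd_DD en_pd by auto
      then show False using 2 b by simp
    qed
  qed
  have "(\<Sum>b\<in>out v. \<phi> b) = \<phi> ?e + (\<Sum>b\<in>out v - {?e}. \<phi> b)"
    using e finite_DD by (intro sum.remove) auto
  also have "(\<Sum>b\<in>out v - {?e}. \<phi> b) = 0" using z by (intro sum.neutral) auto
  finally show False using cons v anti pd_DD by auto
qed

text \<open>The indicator of \<open>X\<close> yields a conserved function that lives on the forest,
  hence is zero. So no dart separates \<open>X\<close> from its complement, and membership in
  \<open>X\<close> spreads around every vertex and along every dart.\<close>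

lemma dual_connected:
  assumes X: "f \<in> X" "f \<in> faces H"
    and cl: "\<And>a. a \<in> DD - Fo \<Longrightarrow> face H a \<in> X \<Longrightarrow> face H (tw a) \<in> X"
  shows "faces H \<subseteq> X"
proof -
  define I :: "nat \<Rightarrow> int" where "I a = of_bool (face H a \<in> X)" for a
  have z: "I a - I (tw a) = 0" if "a \<in> DD" for a
  proof (rule forest_flow_zero[where \<phi> = "\<lambda>a. I a - I (tw a)"])
    show "I b - I (tw b) = 0" if "b \<in> DD" "b \<notin> Fo" for b
      using cl[of b] cl[of "tw b"] that tw_DD Fo_tw[of "tw b"] by (auto simp: I_def)
    show "(\<Sum>a\<in>out v. I a - I (tw a)) = 0" for v
      unfolding flow_out by (intro sum.neutral) (auto simp: I_def face_rot)
  qed (use that in simp_all)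
  have r: "I (rot H a) = I a" if "a \<in> DD" for a
    using z[OF that] face_rot[OF that] by (simp add: I_def)
  have star: "I b = I a" if ab: "a \<in> DD" "b \<in> DD" "st a = st b" for a b
  proof -
    obtain k where "(rot H ^^ k) a = b" using rot_cyc[OF ab] by blast
    moreover have "(rot H ^^ k) a \<in> DD \<and> I ((rot H ^^ k) a) = I a" for k
      using ab(1) by (induction k) (auto simp: rot_DD r)
    ultimately show ?thesis by metis
  qed
  obtain a0 where a0: "a0 \<in> DD" "face H a0 = f" using X by (auto simp: faces_def)
  have "face H b \<in> X" if b: "b \<in> DD" for b
  proof -
    let ?P = "\<lambda>v. \<forall>b\<in>out v. I b = 1"
    have "?P (st b)"
    proof (rule dart_connected[of "st a0" "st b" ?P])
      show "?P (st a0)" using star[of a0] a0 X by (auto simp: I_def)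
      show "?P (en a)" if a: "a \<in> DD" "?P (st a)" for a
      proof -
        have i: "I (tw a) = 1" using a z[of a] by auto
        have ta: "tw a \<in> DD" "st (tw a) = en a" using a tw_DD st_tw by auto
        show ?thesis
        proof
          fix b assume "b \<in> out (en a)"
          then have "I b = I (tw a)" using ta by (intro star) auto
          then show "I b = 1" using i by simp
        qed
      qed
    qed (use a0 b st_V in auto)
    then show ?thesis using b by (auto simp: I_def)
  qed
  then show ?thesis by (auto simp: faces_def)
qed

text \<open>A breadth-first tree of the dual graph without the forest edges; \<open>dq\<close> is
  the distance from \<open>h\<close> in that graph.\<close>

lemma dual_tree:
  assumes h: "h \<in> faces H"
  obtains B qd dq where "dart_tree (faces H) B (face H) (face H \<circ> tw) tw h qd dq" "B \<subseteq> DD - Fo"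
proof -
  define E where "E = {(face H a, face H (tw a)) | a. a \<in> DD - Fo}"
  define dq where "dq f = (LEAST n. (h, f) \<in> E ^^ n)" for f
  define qd where "qd f = (SOME a. a \<in> DD - Fo \<and> face H (tw a) = f \<and> dq f = Suc (dq (face H a)))" for f
  have reach: "\<exists>n. (h, f) \<in> E ^^ n" if "f \<in> faces H" for f
  proof -
    have "faces H \<subseteq> {f. (h, f) \<in> E\<^sup>*}"
      by (rule dual_connected[of h]) (use h in \<open>auto simp: E_def intro: rtrancl_into_rtrancl\<close>)
    then show ?thesis using that by (auto simp: rtrancl_power)
  qed
  have le: "dq f \<le> n" if "(h, f) \<in> E ^^ n" for f n using that unfolding dq_def by (rule Least_le)
  have dq: "(h, f) \<in> E ^^ dq f" if "f \<in> faces H" for f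
    using reach[OF that] unfolding dq_def by (rule LeastI_ex)
  have dqh: "dq h = 0" using le[of h 0] by simp
  have qd: "qd f \<in> DD - Fo \<and> face H (tw (qd f)) = f \<and> dq f = Suc (dq (face H (qd f)))"
    if f: "f \<in> faces H" "f \<noteq> h" for f
  proof -
    obtain n where n: "dq f = Suc n" using dq[OF f(1)] f(2) by (cases "dq f") auto
    then obtain g where g: "(h, g) \<in> E ^^ n" "(g, f) \<in> E" using dq[OF f(1)] by auto
    then obtain a where a: "a \<in> DD - Fo" "g = face H a" "f = face H (tw a)" by (auto simp: E_def)
    have "g \<in> faces H" using a face_faces by auto
    then have "(h, f) \<in> E ^^ Suc (dq g)" using dq g by auto
    then have "dq f = Suc (dq g)" using le[of f "Suc (dq g)"] le[OF g(1)] n by simp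
    then have "a \<in> DD - Fo \<and> face H (tw a) = f \<and> dq f = Suc (dq (face H a))" using a by simp
    then show ?thesis unfolding qd_def by (rule someI)
  qed
  let ?B = "qd ` (faces H - {h}) \<union> tw ` qd ` (faces H - {h})"
  have "dart_tree (faces H) ?B (face H) (face H \<circ> tw) tw h qd dq"
    by unfold_locales (use finite_faces h qd dqh face_faces in auto)
  moreover have "?B \<subseteq> DD - Fo" using qd tw_DD Fo_tw by (auto dest: Fo_tw)
  ultimately show ?thesis using that by blast
qed

end


section \<open>Shortest path trees\<close>

locale shortest_path_map = plane_map +
  assumes nonneg: "no_negative_cycle H" and uniq: "unique_shortest_paths H"
begin

sublocale G: fin_digraph "graph H"
  by unfold_locales (use arcs_darts st_V en_V finite_V finite_DD in \<open>auto intro: finite_subset\<close>)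

text \<open>A nonempty closed walk that is not a cycle contains a shorter closed walk; cutting it
  out leaves a shorter closed walk again, and the costs add up.\<close>

lemma closed_walk_nonneg: "G.awalk u p u \<Longrightarrow> 0 \<le> cost H p"
proof (induction "length p" arbitrary: u p rule: less_induct)
  case less
  show ?case
  proof (cases p)
    case (Cons e q)
    have q: "G.awalk (en e) q u" and e: "e \<in> arcs (graph H)" "st e = u"
      using less.prems Cons by (auto simp: G.awalk_Cons_iff)
    show ?thesis
    proof (cases "distinct (G.awalk_verts (en e) q)")
      case True
      then have "G.cycle p" using less.prems Cons by (auto simp: G.cycle_def)
      then show ?thesis using nonneg by (simp add: no_negative_cycle_def)
    next
      case False
      then obtain q1 q2 q3 where d: "q = q1 @ q2 @ q3" "0 < length q2"
          "\<exists>w. G.awalk (en e) q1 w \<and> G.awalk w q2 w \<and> G.awalk w q3 u"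
        using G.awalk_not_distinct_decomp[OF q] by blast
      then obtain w where w: "G.awalk (en e) q1 w" "G.awalk w q2 w" "G.awalk w q3 u" by blast
      have "G.awalk u (e # q1 @ q3) u" using w e by (simp add: G.awalk_Cons_iff)
      then have "0 \<le> cost H (e # q1 @ q3)" using less.hyps[of "e # q1 @ q3" u] d Cons by simp
      moreover have "0 \<le> cost H q2" using less.hyps[of q2 w] w d Cons by simp
      ultimately show ?thesis using d Cons by simp
    qed
  qed simp
qed

lemma dist_le: "G.awalk u p v \<Longrightarrow> dist_in H u v \<le> cost H p"
  unfolding dist_in_def by (rule G.min_cost_le_walk_cost)

lemma shortest_path_exists:
  assumes "u \<rightarrow>\<^sup>*\<^bsub>graph H\<^esub> v" shows "\<exists>p. shortest_path H u p v"
  using G.no_neg_cyc_reach_imp_path[OF assms, of "len H"] closed_walk_nonneg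
  unfolding shortest_path_def dist_in_def by (metis not_less)

text \<open>Exchange: a cheaper path to the intermediate vertex, followed by \<open>q\<close>, would
  be cheaper than the distance to \<open>v\<close>. The exchanged walk may fail to be simple, but
  \<open>dist_in\<close> is a lower bound for the cost of all walks.\<close>

lemma shortest_path_prefix:
  assumes "shortest_path H u (p @ q) v"
  shows "shortest_path H u p (last (G.awalk_verts u p))"
proof -
  let ?w = "last (G.awalk_verts u p)"
  have ap: "G.apath u (p @ q) v" "ereal (cost H (p @ q)) = dist_in H u v"
    using assms by (auto simp: shortest_path_def)
  have p: "G.apath u p ?w" using ap(1) G.apath_append_iff by blast
  have q: "G.awalk ?w q v" using ap(1) unfolding G.apath_def by simp
  obtain p' where p': "shortest_path H u p' ?w"
    using shortest_path_exists p G.reachable_awalkI unfolding G.apath_def by blast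
  then have "G.awalk u (p' @ q) v" using q by (auto simp: shortest_path_def G.apath_def intro: G.awalk_appendI)
  then have "cost H (p @ q) \<le> cost H (p' @ q)" using dist_le ap(2) by (metis ereal_less_eq(3))
  then have "ereal (cost H p) \<le> ereal (cost H p')" by simp
  then have "ereal (cost H p) \<le> dist_in H u ?w" using p' by (metis shortest_path_def)
  moreover have "dist_in H u ?w \<le> cost H p" using p dist_le by (simp add: G.apath_def)
  ultimately show ?thesis using p by (simp add: shortest_path_def)
qed

end

locale shortest_path_tree = shortest_path_map +
  fixes u :: nat
  assumes u_V: "u \<in> V" and reach: "v \<in> V \<Longrightarrow> u \<rightarrow>\<^sup>*\<^bsub>graph H\<^esub> v"
begin

definition sp :: "nat \<Rightarrow> nat list" where "sp v = (THE p. shortest_path H u p v)"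
definition spd :: "nat \<Rightarrow> nat" where "spd v = last (sp v)"
definition depth :: "nat \<Rightarrow> nat" where "depth v = length (sp v)"
definition dst :: "nat \<Rightarrow> real" where "dst v = real_of_ereal (dist_in H u v)"

lemma sp: "v \<in> V \<Longrightarrow> shortest_path H u (sp v) v"
  and sp_unique: "v \<in> V \<Longrightarrow> shortest_path H u p v \<Longrightarrow> p = sp v"
proof -
  have *: "\<exists>!p. shortest_path H u p v" if "v \<in> V"
    using shortest_path_exists reach[OF that] uniq unfolding unique_shortest_paths_def by blast
  show "v \<in> V \<Longrightarrow> shortest_path H u (sp v) v" unfolding sp_def using * by (rule theI')
  then show "v \<in> V \<Longrightarrow> shortest_path H u p v \<Longrightarrow> p = sp v" using * by blast
qed

lemma dist_dst: "v \<in> V \<Longrightarrow> dist_in H u v = ereal (dst v)"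
  and dst_cost: "v \<in> V \<Longrightarrow> dst v = cost H (sp v)"
  using sp[of v] unfolding shortest_path_def dst_def by (metis real_of_ereal.simps(1))+

text \<open>Uniqueness identifies the path to \<open>v\<close> without its last arc with the chosen
  path to the tail of that arc; hence the last arcs form a tree.\<close>

lemma sp_step:
  assumes "v \<in> V" "v \<noteq> u"
  shows "spd v \<in> arcs (graph H)" "en (spd v) = v" "sp v = sp (st (spd v)) @ [spd v]"
proof -
  have a: "G.apath u (sp v) v" using sp assms by (simp add: shortest_path_def)
  then have ne: "sp v \<noteq> []" using assms by (auto simp: G.apath_Nil_iff)
  then have e: "sp v = butlast (sp v) @ [spd v]" by (simp add: spd_def)
  let ?w = "last (G.awalk_verts u (butlast (sp v)))"
  have "G.awalk ?w [spd v] v" using a e by (metis G.apath_def G.awalk_append_iff)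
  then have s: "spd v \<in> arcs (graph H)" "st (spd v) = ?w" "en (spd v) = v" by (auto simp: G.awalk_simps)
  then show "spd v \<in> arcs (graph H)" "en (spd v) = v" by auto
  have "shortest_path H u (butlast (sp v)) ?w"
    using shortest_path_prefix sp[OF assms(1)] e by metis
  then have "butlast (sp v) = sp ?w" using sp_unique s by (metis G.tail_in_verts)
  then show "sp v = sp (st (spd v)) @ [spd v]" using e s by simp
qed

lemma sp_u: "sp u = []"
proof -
  have "shortest_path H u (sp u) u" using sp u_V by blast
  then show ?thesis using G.apath_nonempty_ends unfolding shortest_path_def by blast
qed

lemma spd_DD: "v \<in> V \<Longrightarrow> v \<noteq> u \<Longrightarrow> spd v \<in> DD"
  using sp_step arcs_darts by blast

lemma depth_step: "v \<in> V \<Longrightarrow> v \<noteq> u \<Longrightarrow> depth v = Suc (depth (st (spd v)))"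
  unfolding depth_def using sp_step(3) by (metis length_append_singleton)

lemma set_sp: "v \<in> V \<Longrightarrow> set (sp v) \<subseteq> spd ` (V - {u})"
proof (induction "depth v" arbitrary: v rule: less_induct)
  case less
  show ?case
  proof (cases "v = u")
    case False
    then have "set (sp (st (spd v))) \<subseteq> spd ` (V - {u})"
      using less depth_step spd_DD st_V by simp
    moreover have "set (sp v) = insert (spd v) (set (sp (st (spd v))))"
      using sp_step(3)[OF less.prems False] by (metis list.simps(15) rotate1.simps(2) set_rotate1)
    ultimately show ?thesis using less.prems False by auto
  qed (simp add: sp_u)
qed

lemma tree_darts_eq: "tree_darts H u = spd ` (V - {u}) \<union> tw ` spd ` (V - {u})"
proof (intro equalityI subsetI)
  fix a assume "a \<in> tree_darts H u"
  then obtain v p where p: "shortest_path H u p v" "a \<in> set p \<or> tw a \<in> set p"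
    unfolding tree_darts_def by blast
  have v: "v \<in> V" using p unfolding shortest_path_def G.apath_def by auto
  then have "a \<in> spd ` (V - {u}) \<or> tw a \<in> spd ` (V - {u})" using p sp_unique set_sp by blast
  then show "a \<in> spd ` (V - {u}) \<union> tw ` spd ` (V - {u})" by (metis Un_iff image_eqI tw_tw)
next
  fix a assume "a \<in> spd ` (V - {u}) \<union> tw ` spd ` (V - {u})"
  then obtain v where v: "v \<in> V" "v \<noteq> u" "a = spd v \<or> a = tw (spd v)" by auto
  have "spd v \<in> set (sp v)" using sp_step(3)[OF v(1,2)] by (metis in_set_conv_decomp)
  then have "a \<in> set (sp v) \<or> tw a \<in> set (sp v)" using v(3) by auto
  then show "a \<in> tree_darts H u" using sp[OF v(1)] unfolding tree_darts_def by blast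
qed

lemma dst_step: "v \<in> V \<Longrightarrow> v \<noteq> u \<Longrightarrow> dst v = dst (st (spd v)) + len H (spd v)"
  using sp_step[of v] dst_cost[of v] dst_cost[of "st (spd v)"] st_V spd_DD by simp

lemma dst_arc:
  assumes "a \<in> arcs (graph H)" shows "dst (en a) \<le> dst (st a) + len H a"
proof -
  have a: "st a \<in> V" "en a \<in> V" using assms by auto
  have "G.awalk u (sp (st a)) (st a)" using sp[OF a(1)] by (simp add: shortest_path_def G.apath_def)
  then have "G.awalk u (sp (st a) @ [a]) (en a)" using assms by (auto simp: G.awalk_simps)
  then show ?thesis using dist_le[of u "sp (st a) @ [a]" "en a"] dist_dst[OF a(2)] dst_cost[OF a(1)] by simp
qed

sublocale T: dart_tree V "tree_darts H u" st en tw u spd depth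
proof
  show "tree_darts H u = spd ` (V - {u}) \<union> tw ` spd ` (V - {u})" by (rule tree_darts_eq)
  show "depth u = 0" by (simp add: depth_def sp_u)
  have *: "a \<in> DD" if "a \<in> tree_darts H u" for a
    using that spd_DD tw_DD unfolding tree_darts_eq by auto
  show "st (tw a) = en a" "en (tw a) = st a" if "a \<in> tree_darts H u" for a
    using *[OF that] st_tw en_tw by auto
qed (use finite_V u_V sp_step depth_step in auto)

sublocale F: forest H "{u}" spd depth
  by unfold_locales (use u_V spd_DD sp_step depth_step in auto)

lemma Fo_eq: "F.Fo = tree_darts H u"
  by (simp add: F.Fo_def tree_darts_eq)

lemma tree_darts_DD: "tree_darts H u \<subseteq> DD"
  using F.Fo_DD Fo_eq by simp

text \<open>By Euler's formula the dual tree that avoids the shortest path tree has as many darts as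
  the whole complement, \<open>2 * (card (faces H) - 1)\<close>, so it is the complement.\<close>

lemma cotree:
  assumes "h \<in> faces H"
  obtains qd dq where "dart_tree (faces H) (DD - tree_darts H u) (face H) (face H \<circ> tw) tw h qd dq"
proof -
  obtain B qd dq where B: "dart_tree (faces H) B (face H) (face H \<circ> tw) tw h qd dq" "B \<subseteq> DD - F.Fo"
    using F.dual_tree[OF assms] by blast
  have "1 \<le> card V" "1 \<le> card (faces H)" using u_V finite_V assms finite_faces by (auto simp: Suc_le_eq card_gt_0_iff)
  moreover have "card (DD - F.Fo) = card DD - card F.Fo"
    using F.Fo_DD finite_DD by (simp add: card_Diff_subset finite_subset)
  ultimately have "card B = card (DD - F.Fo)" using dart_tree.card_A[OF B(1)] F.card_Fo euler by simp
  then have "B = DD - F.Fo" using B finite_DD by (intro card_subset_eq) auto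
  then show ?thesis using that B Fo_eq by simp
qed

lemma walk_flow_rpath: "v \<in> V \<Longrightarrow> (\<Sum>b\<in>out w. walk_flow (T.rpath v) b) = of_bool (w = u) - of_bool (w = v)"
proof (induction rule: T.tree_induct)
  case (step v)
  then show ?case using sp_step spd_DD walk_flow_out1[of "spd v" w]
    by (simp add: T.rpath_step sum.distrib)
qed simp

lemma walk_flow_rpath_off:
  assumes "v \<in> V" "a \<notin> tree_darts H u" shows "walk_flow (T.rpath v) a = 0"
proof -
  have "a \<notin> set (T.rpath v)" using assms T.set_rpath by blast
  moreover have "tw a \<notin> set (T.rpath v)" using assms T.set_rpath T.tw_A tw_tw by (metis subsetD)
  ultimately show ?thesis by (simp add: walk_flow_def)
qed

end


section \<open>The Voronoi diagram\<close>

lemma UNIV_site: "UNIV = {Red, Green, Blue}"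
  using site.exhaust by auto

locale voronoi = shortest_path_map +
  fixes h :: nat and S c :: "site \<Rightarrow> nat" and \<omega> :: "site \<Rightarrow> real"
  assumes inj_S: "inj S" and h_faces: "h \<in> faces H"
    and c_h: "c s \<in> face_darts H h" and st_c: "st (c s) = S s"
    and site_reach: "v \<in> V \<Longrightarrow> S s \<rightarrow>\<^sup>*\<^bsub>graph H\<^esub> v"
    and triangular: "f \<in> faces H \<Longrightarrow> f \<noteq> h \<Longrightarrow> triangular_face H f"
begin

lemma c_DD: "c s \<in> DD" and face_c: "face H (c s) = h"
  using c_h by (auto simp: face_darts_def)

lemma S_V: "S s \<in> V"
  using st_c st_V c_DD by metis

lemma site_tree: "shortest_path_tree H (S s)"
  by unfold_locales (use S_V site_reach in auto)

sublocale R: shortest_path_tree H "S Red"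
  by (rule site_tree)

abbreviation "spd s \<equiv> shortest_path_tree.spd H (S s)"
abbreviation "dep s \<equiv> shortest_path_tree.depth H (S s)"
abbreviation "sdist s \<equiv> shortest_path_tree.dst H (S s)"

definition beats :: "site \<Rightarrow> site \<Rightarrow> nat \<Rightarrow> bool" where
  "beats s t v \<longleftrightarrow> \<omega> s + sdist s v < \<omega> t + sdist t v \<or>
     \<omega> s + sdist s v = \<omega> t + sdist t v \<and> (\<omega> t < \<omega> s \<or> \<omega> t = \<omega> s \<and> S t < S s)"

definition col :: "nat \<Rightarrow> site" where "col v = (THE s. v \<in> Vor H S \<omega> s)"

lemma Vor_iff: "v \<in> Vor H S \<omega> s \<longleftrightarrow> v \<in> V \<and> (\<forall>t. t \<noteq> s \<longrightarrow> beats s t v)"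
  using shortest_path_tree.dist_dst[OF site_tree]
  by (auto simp: Vor_def beats_def add_dist_def)

lemma beats_total: "s \<noteq> t \<Longrightarrow> beats s t v \<or> beats t s v"
  using inj_S by (auto simp: beats_def inj_def) (metis linorder_neqE)+

lemma beats_trans: "beats s t v \<Longrightarrow> beats t q v \<Longrightarrow> beats s q v"
  by (auto simp: beats_def)

lemma beats_irrefl: "\<not> beats s s v"
  by (simp add: beats_def)

text \<open>At each vertex \<open>beats\<close> is a strict linear order on the three sites, and the
  first of them owns the vertex.\<close>

lemma Vor_col: assumes "v \<in> V" shows "v \<in> Vor H S \<omega> s \<longleftrightarrow> col v = s"
proof -
  have all: "(\<forall>t. P t) \<longleftrightarrow> P Red \<and> P Green \<and> P Blue" for P
    using site.exhaust by metis
  have "\<exists>s. v \<in> Vor H S \<omega> s"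
    using beats_total[of Red Green v] beats_total[of Red Blue v] beats_total[of Green Blue v] beats_trans
    unfolding Vor_iff all using assms by (metis site.distinct)
  moreover have "s = t" if "v \<in> Vor H S \<omega> s" "v \<in> Vor H S \<omega> t" for s t
    using that beats_trans beats_irrefl unfolding Vor_iff by metis
  ultimately have "\<exists>!s. v \<in> Vor H S \<omega> s" by blast
  then show ?thesis unfolding col_def by (metis (mono_tags, lifting) theI')
qed

text \<open>Stepping back along the last arc of the path from \<open>s\<close> lowers the distance
  from \<open>s\<close> by the length of the arc and every other distance by at most this much; the
  tie-break does not depend on the vertex.\<close>

lemma parent_col:
  assumes "v \<in> V" "v \<noteq> S s" "col v = s"
  shows "col (st (spd s v)) = s"
proof -
  interpret T: shortest_path_tree H "S s" by (rule site_tree)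
  let ?w = "st (spd s v)"
  have e: "spd s v \<in> arcs (graph H)" "en (spd s v) = v" using T.sp_step assms by auto
  have w: "?w \<in> V" using e arcs_darts st_V by blast
  have ds: "sdist s v = sdist s ?w + len H (spd s v)" using T.dst_step assms by simp
  have "v \<in> Vor H S \<omega> s" using Vor_col assms by simp
  then have b: "beats s t v" if "t \<noteq> s" for t using that by (simp add: Vor_iff)
  have "beats s t ?w" if "t \<noteq> s" for t
  proof -
    have "sdist t v \<le> sdist t ?w + len H (spd s v)"
      using shortest_path_tree.dst_arc[OF site_tree e(1)] e(2) by simp
    then show ?thesis using b[OF that] ds by (auto simp: beats_def)
  qed
  then have "?w \<in> Vor H S \<omega> s" using w by (simp add: Vor_iff)
  then show ?thesis using Vor_col[OF w] by simp
qed

lemma site_col: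
  assumes "v \<in> V" "col v = s" shows "col (S s) = s"
proof -
  interpret T: shortest_path_tree H "S s" by (rule site_tree)
  from assms show ?thesis
  proof (induction rule: T.T.tree_induct)
    case (step v)
    then show ?case using parent_col by simp
  qed
qed

section \<open>Signed crossings and Sperner's lemma for triangles\<close>

definition chi :: "nat \<Rightarrow> int" where
  "chi a = of_bool (col (st a) = Red \<and> col (en a) = Green) - of_bool (col (st a) = Green \<and> col (en a) = Red)"

lemma chi_tw: "a \<in> DD \<Longrightarrow> chi (tw a) = - chi a"
  by (simp add: chi_def st_tw en_tw conj_commute)

definition sgn_face :: "nat \<Rightarrow> int" where
  "sgn_face f = (\<Sum>a\<in>face_darts H f. chi a)"

abbreviation tricol :: "nat \<Rightarrow> bool" where "tricol \<equiv> trichromatic H h S \<omega>"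

lemma finite_face_darts: "finite (face_darts H f)" and face_darts_DD: "face_darts H f \<subseteq> DD"
  using finite_DD by (auto simp: face_darts_def)

lemma face_enum:
  assumes "a \<in> DD" and S: "S' = face_darts H (face H a)"
  shows "inj_on (\<lambda>k. (fs ^^ k) a) {..<card S'}" "(\<lambda>k. (fs ^^ k) a) ` {..<card S'} = S'" "(fs ^^ card S') a = a"
  using cyclic_enumeration[of S' fs a] assms finite_face_darts fs_inj fs_DD face_fs fs_cyc
  by (auto simp: face_darts_def image_subset_iff)

lemma triangle:
  assumes "f \<in> faces H" "f \<noteq> h" "a \<in> face_darts H f"
  shows "face_darts H f = {a, fs a, fs (fs a)}" "fs (fs (fs a)) = a"
    "distinct [a, fs a, fs (fs a)]" "face_verts H f = {st a, st (fs a), st (fs (fs a))}"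
    "distinct [st a, st (fs a), st (fs (fs a))]"
    "en a = st (fs a)" "en (fs a) = st (fs (fs a))" "en (fs (fs a)) = st a"
proof -
  have c3: "card (face_darts H f) = 3" "card (face_verts H f) = 3"
    using triangular assms by (auto simp: triangular_face_def)
  have a: "a \<in> DD" "face H a = f" using assms by (auto simp: face_darts_def)
  note e = face_enum[OF a(1) refl, unfolded a(2) c3]
  have 3: "{..<3::nat} = {0, 1, 2}" by auto
  show fd: "face_darts H f = {a, fs a, fs (fs a)}"
    using e(2) unfolding 3 by (simp add: numeral_2_eq_2)
  show cyc: "fs (fs (fs a)) = a" using e(3) by (simp add: numeral_3_eq_3)
  show "distinct [a, fs a, fs (fs a)]"
    using c3(1) unfolding fd by (intro card_distinct) simp
  show fv: "face_verts H f = {st a, st (fs a), st (fs (fs a))}"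
    unfolding face_verts_def fd by simp
  show "distinct [st a, st (fs a), st (fs (fs a))]"
    using c3(2) unfolding fv by (intro card_distinct) simp
  show "en a = st (fs a)" "en (fs a) = st (fs (fs a))" "en (fs (fs a)) = st a"
    using a st_fs fs_DD cyc by metis+
qed

lemma tricol_iff:
  assumes "f \<in> faces H" "f \<noteq> h" "a \<in> face_darts H f"
  shows "tricol f \<longleftrightarrow> {col (st a), col (st (fs a)), col (st (fs (fs a)))} = UNIV"
proof -
  note t = triangle[OF assms]
  have a: "a \<in> DD" using assms face_darts_DD by blast
  have v: "st a \<in> V" "st (fs a) \<in> V" "st (fs (fs a)) \<in> V" using st_V fs_DD a by simp_all
  show ?thesis
  proof
    assume "tricol f"
    then obtain x y z where xyz: "face_verts H f = {x, y, z}"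
      "x \<in> Vor H S \<omega> Red" "y \<in> Vor H S \<omega> Green" "z \<in> Vor H S \<omega> Blue"
      unfolding trichromatic_def by blast
    have "col ` {x, y, z} = UNIV" using xyz Vor_col unfolding UNIV_site by (auto simp: Vor_iff)
    moreover have "{x, y, z} = {st a, st (fs a), st (fs (fs a))}" using xyz(1) t(4) by simp
    ultimately have "col ` {st a, st (fs a), st (fs (fs a))} = UNIV" by simp
    then show "{col (st a), col (st (fs a)), col (st (fs (fs a)))} = UNIV" by simp
  next
    assume U: "{col (st a), col (st (fs a)), col (st (fs (fs a)))} = UNIV"
    have "\<exists>x\<in>{st a, st (fs a), st (fs (fs a))}. col x = s" for s
    proof -
      have "s \<in> {col (st a), col (st (fs a)), col (st (fs (fs a)))}" using U by simp
      then show ?thesis by auto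
    qed
    then obtain x y z where xyz: "x \<in> face_verts H f" "y \<in> face_verts H f" "z \<in> face_verts H f"
      "col x = Red" "col y = Green" "col z = Blue" using t(4) by metis
    have "card (face_verts H f) = 3" using triangular assms by (auto simp: triangular_face_def)
    moreover have "card {x, y, z} = 3"
    proof -
      have "x \<noteq> y" "y \<noteq> z" "x \<noteq> z" using xyz(4-6) by auto
      then show ?thesis by simp
    qed
    moreover have "finite (face_verts H f)" using t(4) by simp
    ultimately have "face_verts H f = {x, y, z}" using xyz
      by (metis card_subset_eq empty_subsetI insert_subset)
    moreover have "x \<in> V" "y \<in> V" "z \<in> V" using xyz t(4) v by auto
    ultimately show "tricol f" unfolding trichromatic_def using assms Vor_col xyz by blast
  qed
qed

text \<open>A triangle without red or without green has no crossing, one without blue crosses as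
  often from red to green as back, and a trichromatic one has exactly one crossing.\<close>

lemma sgn_face_nonzero:
  assumes "f \<in> faces H" "f \<noteq> h"
  shows "sgn_face f \<noteq> 0 \<longleftrightarrow> tricol f"
proof -
  obtain a where a: "a \<in> face_darts H f" using assms by (auto simp: faces_def face_darts_def)
  note t = triangle[OF assms a]
  have "sgn_face f = chi a + chi (fs a) + chi (fs (fs a))"
    unfolding sgn_face_def t(1) using t(3) by simp
  then show ?thesis unfolding tricol_iff[OF assms a] chi_def t(6-8) UNIV_site
    by (cases "col (st a)"; cases "col (st (fs a))"; cases "col (st (fs (fs a)))") auto
qed

lemma sgn_face_sum:
  assumes "X \<subseteq> faces H"
  shows "(\<Sum>f\<in>X. sgn_face f) = (\<Sum>a\<in>DD. chi a * of_bool (face H a \<in> X))"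
proof -
  have X: "finite X" using assms finite_faces finite_subset by blast
  have "(\<Sum>f\<in>X. sgn_face f) = (\<Sum>a\<in>(\<Union>f\<in>X. face_darts H f). chi a)"
    unfolding sgn_face_def using X finite_face_darts
    by (intro sum.UNION_disjoint[symmetric]) (auto simp: face_darts_def)
  also have "\<dots> = (\<Sum>a\<in>DD. if face H a \<in> X then chi a else 0)"
    using finite_DD by (intro sum.mono_neutral_cong_left) (auto simp: face_darts_def)
  finally show ?thesis by (simp add: of_bool_def if_distrib cong: if_cong)
qed

section \<open>At most one trichromatic face\<close>

definition BB :: "nat set" where "BB = {a \<in> DD. col (st a) \<noteq> col (en a)}"

lemma BB_tw: "a \<in> BB \<Longrightarrow> tw a \<in> BB"
  by (auto simp: BB_def tw_DD st_tw en_tw)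

lemma tricol_site_col: "tricol f \<Longrightarrow> col (S s) = s"
  unfolding trichromatic_def using site_col Vor_col Vor_iff by (cases s) metis+

lemma hole_walk:
  assumes "a \<in> face_darts H h" "P (col (st a))" "b \<in> face_darts H h" "\<not> P (col (st b))"
  obtains e where "e \<in> face_darts H h" "P (col (st e))" "\<not> P (col (en e))"
proof -
  obtain k where "(fs ^^ k) a = b" using fs_cyc assms by (force simp: face_darts_def)
  then have "\<exists>e. e \<in> face_darts H h \<and> P (col (st e)) \<and> \<not> P (col (en e))"
    using assms
  proof (induction k arbitrary: a)
    case (Suc k)
    have f: "fs a \<in> face_darts H h" using Suc.prems fs_DD face_fs by (auto simp: face_darts_def)
    show ?case
    proof (cases "P (col (st (fs a)))")
      case True
      then show ?thesis using Suc.IH[of "fs a"] Suc.prems f by (simp add: funpow_swap1)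
    next
      case False
      then show ?thesis using Suc.prems st_fs by (metis face_darts_DD subsetD)
    qed
  qed simp
  then show ?thesis using that by blast
qed

text \<open>Every cell contains its own site but not the others, and all sites lie on
  \<open>h\<close>, so a walk around \<open>h\<close> must leave each cell.\<close>

lemma hole_out: 
  assumes "\<And>s. col (S s) = s"
  obtains e where "e \<in> face_darts H h" "e \<in> BB" "col (st e) = s"
proof -
  obtain t where "t \<noteq> s" by (metis site.distinct(1))
  then obtain e where "e \<in> face_darts H h" "col (st e) = s" "col (en e) \<noteq> s"
    using hole_walk[of "c s" "\<lambda>x. x = s" "c t"] c_h st_c assms by metis
  moreover from this have "e \<in> DD" using face_darts_DD by blast
  ultimately show ?thesis using that by (auto simp: BB_def)
qed

lemma hole_in: 
  assumes "\<And>s. col (S s) = s"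
  obtains e where "e \<in> face_darts H h" "e \<in> BB" "col (en e) = s"
proof -
  obtain t where "t \<noteq> s" by (metis site.distinct(1))
  then obtain e where "e \<in> face_darts H h" "col (st e) \<noteq> s" "col (en e) = s"
    using hole_walk[of "c t" "\<lambda>x. x \<noteq> s" "c s"] c_h st_c assms by metis
  moreover from this have "e \<in> DD" using face_darts_DD by blast
  ultimately show ?thesis using that by (auto simp: BB_def)
qed

text \<open>Double counting of bichromatic darts. The Voronoi forest contains none; the edges of a
  dual tree that avoids it are charged to faces of \<open>VB\<close>, and four darts remain, so
  \<open>card BB\<close> is at most \<open>4 + 2 * card VB\<close>. Conversely each face of
  \<open>VB\<close> has two bichromatic darts, a trichromatic one has three, and those on
  \<open>h\<close> come on top.\<close>

lemma tricol_count:
  assumes sc: "\<And>s. col (S s) = s"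
  shows "card {f. tricol f} + card (BB \<inter> face_darts H h) \<le> 4"
proof -
  let ?pd = "\<lambda>v. spd (col v) v" and ?dp = "\<lambda>v. dep (col v) v"
  have ne: "v \<noteq> S (col v)" if "v \<in> V - range S" for v using that by blast
  have pc: "col (st (?pd v)) = col v" if "v \<in> V - range S" for v
    using parent_col[of v "col v"] ne[OF that] that by simp
  interpret F: forest H "range S" ?pd ?dp
  proof
    show "range S \<subseteq> V" using S_V by blast
    fix v assume v: "v \<in> V - range S"
    interpret T: shortest_path_tree H "S (col v)" by (rule site_tree)
    show "?pd v \<in> DD" "en (?pd v) = v" using T.spd_DD T.sp_step v ne[OF v] by auto
    show "dep (col (st (?pd v))) (st (?pd v)) < ?dp v" using T.depth_step[of v] pc[OF v] v ne[OF v] by simp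
  qed
  obtain B qd dq where B: "dart_tree (faces H) B (face H) (face H \<circ> tw) tw h qd dq" "B \<subseteq> DD - F.Fo"
    using F.dual_tree[OF h_faces] by blast
  interpret C: dart_tree "faces H" B "face H" "face H \<circ> tw" tw h qd dq by (rule B(1))
  have disj: "BB \<inter> F.Fo = {}"
    using pc F.en_pd F.pd_DD by (auto simp: F.Fo_def BB_def st_tw en_tw)
  define VB where "VB = {f \<in> faces H - {h}. BB \<inter> face_darts H f \<noteq> {}}"
  have fVB: "finite VB" using finite_faces by (simp add: VB_def)
  have fBB: "finite BB" using finite_DD by (simp add: BB_def)
  have c3: "card (range S) = 3" using card_image[OF inj_S] unfolding UNIV_site by simp
  have cV: "3 \<le> card V" using card_mono[OF finite_V F.R_V] c3 by simp
  have cF: "1 \<le> card (faces H)" using h_faces finite_faces by (auto simp: Suc_le_eq card_gt_0_iff)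
  have "BB \<subseteq> (DD - F.Fo - B) \<union> (BB \<inter> B)" using disj by (auto simp: BB_def)
  then have "card BB \<le> card (DD - F.Fo - B) + card (BB \<inter> B)"
    using finite_DD fBB by (meson card_Un_le card_mono finite_Diff finite_Int finite_UnI order_trans)
  \<comment> \<open>Compared with a spanning tree and its dual, having three roots instead of one
    leaves two more edges uncovered.\<close>
  also have "card (DD - F.Fo - B) = 4"
  proof -
    have "card (DD - F.Fo - B) = card DD - card F.Fo - card B"
      using B(2) F.Fo_DD finite_DD by (subst card_Diff_subset card_Diff_subset; auto intro: finite_subset)+
    then show ?thesis using C.card_A F.card_Fo c3 cV cF euler by simp
  qed
  \<comment> \<open>An edge of the dual tree is charged to its lower face, which is never
    \<open>h\<close>.\<close>
  also have "card (BB \<inter> B) \<le> 2 * card VB"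
  proof -
    have VBI: "f \<in> VB" if "f \<in> faces H" "f \<noteq> h" "qd f \<in> BB \<or> tw (qd f) \<in> BB" for f
    proof -
      have "tw (qd f) \<in> BB" using that BB_tw by auto
      moreover have "face H (tw (qd f)) = f" using C.dst_pd that by simp
      ultimately show ?thesis using that by (auto simp: VB_def face_darts_def BB_def)
    qed
    have "BB \<inter> B \<subseteq> qd ` VB \<union> tw ` qd ` VB"
    proof
      fix a assume "a \<in> BB \<inter> B"
      then have a: "a \<in> BB" "a \<in> B" by auto
      from a(2) show "a \<in> qd ` VB \<union> tw ` qd ` VB"
        by (cases rule: C.A_cases) (use a VBI in blast)+
    qed
    then have "card (BB \<inter> B) \<le> card (qd ` VB \<union> tw ` qd ` VB)" using fVB by (intro card_mono) auto
    also have "\<dots> \<le> card VB + card VB"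
      using fVB by (meson add_mono card_Un_le card_image_le finite_imageI order_trans)
    finally show ?thesis by simp
  qed
  finally have up: "card BB \<le> 4 + 2 * card VB" by simp
  let ?b = "\<lambda>f. card (BB \<inter> face_darts H f)"
  have b2: "2 * of_bool (f \<in> VB) + of_bool (tricol f) \<le> ?b f" if f: "f \<in> faces H - {h}" for f
  proof -
    obtain a where a: "a \<in> face_darts H f" using f by (auto simp: faces_def face_darts_def)
    have fh: "f \<in> faces H" "f \<noteq> h" using f by auto
    note t = triangle[OF fh a]
    have dd: "a \<in> DD" "fs a \<in> DD" "fs (fs a) \<in> DD" using a face_darts_DD fs_DD by blast+
    let ?x = "col (st a)" and ?y = "col (st (fs a))" and ?z = "col (st (fs (fs a)))"
    have Beq: "BB \<inter> face_darts H f = (if ?x \<noteq> ?y then {a} else {}) \<union> (if ?y \<noteq> ?z then {fs a} else {}) \<union>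
       (if ?z \<noteq> ?x then {fs (fs a)} else {})"
      unfolding t(1) BB_def using dd t(6-8) by auto
    then have "?b f = of_bool (?x \<noteq> ?y) + of_bool (?y \<noteq> ?z) + of_bool (?z \<noteq> ?x)" using t(3) by auto
    moreover have "f \<in> VB \<longleftrightarrow> ?x \<noteq> ?y \<or> ?y \<noteq> ?z \<or> ?z \<noteq> ?x"
      using f by (simp add: VB_def Beq)
    moreover have "tricol f \<longrightarrow> ?x \<noteq> ?y \<and> ?y \<noteq> ?z \<and> ?z \<noteq> ?x"
      unfolding tricol_iff[OF fh a] UNIV_site by (cases ?x; cases ?y; cases ?z) auto
    ultimately show ?thesis by auto
  qed
  have "card BB = (\<Sum>f\<in>faces H. ?b f)"
  proof -
    have "BB = (\<Union>f\<in>faces H. BB \<inter> face_darts H f)" by (auto simp: BB_def face_darts_def faces_def)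
    then have "card BB = card (\<Union>f\<in>faces H. BB \<inter> face_darts H f)" by simp
    also have "\<dots> = (\<Sum>f\<in>faces H. ?b f)"
      using finite_faces finite_face_darts by (intro card_UN_disjoint) (auto simp: face_darts_def)
    finally show ?thesis .
  qed
  also have "\<dots> = ?b h + (\<Sum>f\<in>faces H - {h}. ?b f)" using finite_faces h_faces by (rule sum.remove)
  finally have BBs: "card BB = ?b h + (\<Sum>f\<in>faces H - {h}. ?b f)" .
  have "(\<Sum>f\<in>faces H - {h}. 2 * of_bool (f \<in> VB) + of_bool (tricol f)) \<le> (\<Sum>f\<in>faces H - {h}. ?b f)"
    using b2 by (rule sum_mono)
  moreover have "(\<Sum>f\<in>faces H - {h}. 2 * of_bool (f \<in> VB) + of_bool (tricol f)) = 2 * card VB + card {f. tricol f}"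
  proof -
    have "(faces H - {h}) \<inter> {f. f \<in> VB} = VB" "(faces H - {h}) \<inter> {f. tricol f} = {f. tricol f}"
      by (auto simp: VB_def trichromatic_def)
    then show ?thesis using finite_faces
      by (simp add: sum.distrib flip: sum_distrib_left)
  qed
  ultimately show ?thesis using up BBs by simp
qed

text \<open>Each of the three colours is left and entered on \<open>h\<close>, so both colour maps
  on the bichromatic darts of \<open>h\<close> are surjective; if there are only three such darts,
  the maps are injective.\<close>

lemma hole_card:
  assumes sc: "\<And>s. col (S s) = s"
  shows "3 \<le> card (BB \<inter> face_darts H h)" 
    "\<And>P a b. card (BB \<inter> face_darts H h) \<le> 3 \<Longrightarrow> P = (\<lambda>a. col (st a)) \<or> P = (\<lambda>a. col (en a)) \<Longrightarrow>
      a \<in> BB \<inter> face_darts H h \<Longrightarrow> b \<in> BB \<inter> face_darts H h \<Longrightarrow> P a = P b \<Longrightarrow> a = b"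
proof -
  let ?B = "BB \<inter> face_darts H h"
  have fin: "finite ?B" using finite_face_darts by simp
  have s: "P ` ?B = UNIV" if "P = (\<lambda>a. col (st a)) \<or> P = (\<lambda>a. col (en a))" for P
  proof -
    have "s \<in> P ` ?B" for s
      using hole_out[OF sc, of s] hole_in[OF sc, of s] that by (metis (no_types, lifting) IntI imageI)
    then show ?thesis by blast
  qed
  have 3: "card (UNIV :: site set) = 3" unfolding UNIV_site by simp
  show "3 \<le> card ?B" using card_image_le[OF fin, of "\<lambda>a. col (st a)"] s 3 by simp
  show "a = b" if "card ?B \<le> 3" "P = (\<lambda>a. col (st a)) \<or> P = (\<lambda>a. col (en a))" "a \<in> ?B" "b \<in> ?B" "P a = P b" for P a b
  proof -
    have "card (P ` ?B) = card ?B" using s[OF that(2)] 3 that(1) card_image_le[OF fin, of P] by simp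
    then have "inj_on P ?B" using fin by (simp add: eq_card_imp_inj_on)
    then show ?thesis using that by (auto dest: inj_onD)
  qed
qed

lemma tricol_unique:
  assumes "tricol f" "tricol g" shows "f = g"
proof -
  have "card {f. tricol f} \<le> 1"
    using tricol_count hole_card(1) tricol_site_col[OF assms(1)] by fastforce
  moreover have "finite {f. tricol f}"
    by (rule finite_subset[OF _ finite_faces]) (auto simp: trichromatic_def)
  ultimately show ?thesis using assms by (simp add: card_le_Suc0_iff_eq)
qed

text \<open>The trichromatic face uses up one of the four units in \<open>tricol_count\<close>,
  which leaves at most three bichromatic darts on \<open>h\<close>.\<close>

lemma tricol_hole_unique:
  assumes "tricol f" "a \<in> BB" "a \<in> face_darts H h" "b \<in> BB" "b \<in> face_darts H h"
  shows "col (st a) = col (st b) \<Longrightarrow> a = b" "col (en a) = col (en b) \<Longrightarrow> a = b"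
proof -
  have "finite {f. tricol f}"
    by (rule finite_subset[OF _ finite_faces]) (auto simp: trichromatic_def)
  then have "1 \<le> card {f. tricol f}" using assms by (auto simp: Suc_le_eq card_gt_0_iff)
  then have c: "card (BB \<inter> face_darts H h) \<le> 3" using tricol_count tricol_site_col[OF assms(1)] by fastforce
  show "col (st a) = col (st b) \<Longrightarrow> a = b" "col (en a) = col (en b) \<Longrightarrow> a = b"
    using hole_card(2)[OF tricol_site_col[OF assms(1)] c, of "\<lambda>a. col (st a)" a b]
      hole_card(2)[OF tricol_site_col[OF assms(1)] c, of "\<lambda>a. col (en a)" a b] assms by auto
qed

text \<open>If both sides of \<open>a\<close> were \<open>h\<close>, then \<open>a\<close> and
  \<open>tw a\<close> would already enter both of their colours on \<open>h\<close>. The dart of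
  \<open>h\<close> that leaves the third colour enters one of these, so by uniqueness it would be
  \<open>a\<close> or \<open>tw a\<close>, neither of which starts in the third colour.\<close>

lemma bichromatic_not_bridge:
  assumes "tricol f" "a \<in> BB" shows "face H a \<noteq> h \<or> face H (tw a) \<noteq> h"
proof (rule ccontr)
  assume "\<not> ?thesis"
  then have a: "a \<in> face_darts H h" "tw a \<in> face_darts H h" "tw a \<in> BB" "a \<in> DD"
    using assms BB_tw tw_DD by (auto simp: face_darts_def BB_def)
  have ne: "col (st a) \<noteq> col (en a)" using assms by (simp add: BB_def)
  obtain q where q: "q \<noteq> col (st a)" "q \<noteq> col (en a)"
    by (cases "col (st a)"; cases "col (en a)") (metis site.distinct)+
  obtain e where e: "e \<in> face_darts H h" "e \<in> BB" "col (st e) = q"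
    using hole_out tricol_site_col[OF assms(1)] by metis
  have "col (en e) \<noteq> q" using e by (auto simp: BB_def)
  then have "col (en e) = col (st a) \<or> col (en e) = col (en a)"
    using q ne by (cases "col (st a)"; cases "col (en a)"; cases q; cases "col (en e)") auto
  then have "e = tw a \<or> e = a"
    using tricol_hole_unique(2)[OF assms(1)] e a assms en_tw by metis
  then show False using e q st_tw a by auto
qed

end


section \<open>Locating the trichromatic face in the cotree\<close>

context voronoi
begin

lemma cell_induct [consumes 2, case_names root step]:
  assumes "v \<in> V" "col v = s" and "col (S s) = s \<Longrightarrow> P (S s)"
    and step: "\<And>v. v \<in> V \<Longrightarrow> v \<noteq> S s \<Longrightarrow> col v = s \<Longrightarrow> spd s v \<in> DD \<Longrightarrow> en (spd s v) = v \<Longrightarrow>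
      col (st (spd s v)) = s \<Longrightarrow> P (st (spd s v)) \<Longrightarrow> P v"
  shows "P v"
proof -
  interpret T: shortest_path_tree H "S s" by (rule site_tree)
  from assms(1,2) show ?thesis
  proof (induction rule: T.T.tree_induct)
    case (step v)
    then show ?case using parent_col T.spd_DD T.sp_step assms(4)[of v] by simp
  qed (use assms in simp)
qed

definition crossings :: "nat \<Rightarrow> int" where
  "crossings v = sum_list (map chi (R.T.rpath v))"

lemma red_parent: "v \<in> V \<Longrightarrow> v \<noteq> S Red \<Longrightarrow> col v = Red \<Longrightarrow> col (st (R.spd v)) = Red"
  using parent_col[of v Red] by simp

lemma red_anc: "v \<in> V \<Longrightarrow> col v = Red \<Longrightarrow> R.T.anc x v \<Longrightarrow> col x = Red"
proof (induction rule: R.T.tree_induct)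
  case root
  then show ?case by (simp add: R.T.anc_def)
next
  case (step v)
  then show ?case using red_parent R.T.anc_par[of v x] by auto
qed

lemma crossings_root: "crossings (S Red) = 0"
  by (simp add: crossings_def)

lemma crossings_step:
  assumes "v \<in> V" "v \<noteq> S Red"
  shows "crossings v = crossings (st (R.spd v)) + chi (R.spd v)"
  using assms by (simp add: crossings_def R.T.rpath_step)

lemma crossings_red: "v \<in> V \<Longrightarrow> col v = Red \<Longrightarrow> crossings v = 0"
proof (induction rule: R.T.tree_induct)
  case (step v)
  then show ?case using red_parent crossings_step R.sp_step by (simp add: chi_def)
qed (simp add: crossings_root)

text \<open>Red vertices are closed under ancestors, so a path that has left the red cell at
  \<open>x\<close> never returns; its only possible crossing is the dart into
  \<open>x\<close>.\<close>

lemma crossings_frontier: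
  assumes "x \<in> V" "x \<noteq> S Red" "col x \<noteq> Red" "col (st (R.spd x)) = Red"
  shows "v \<in> V \<Longrightarrow> R.T.anc x v \<Longrightarrow> crossings v = of_bool (col x = Green)"
proof (induction rule: R.T.tree_induct)
  case root
  then show ?case using assms by (simp add: R.T.anc_def)
next
  case (step v)
  have par: "st (R.spd v) \<in> V" using step st_V R.spd_DD by blast
  show ?case
  proof (cases "x = v")
    case True
    then have "crossings (st (R.spd v)) = 0" using crossings_red par assms by simp
    then show ?thesis using crossings_step step True assms R.sp_step by (auto simp: chi_def)
  next
    case False
    then have a: "R.T.anc x (st (R.spd v))" using step R.T.anc_par by metis
    then have "col (st (R.spd v)) \<noteq> Red" using red_anc[OF par] assms by blast
    moreover from this have "col v \<noteq> Red" using red_parent step by blast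
    ultimately show ?thesis using crossings_step step a R.sp_step by (simp add: chi_def)
  qed
qed

end

section \<open>Subtrees of the red cotree\<close>

locale voronoi_cotree = voronoi +
  C: dart_tree "faces H" "DD - tree_darts H (S Red)" "face H" "face H \<circ> tw" "twin H" h qd dq for qd dq
begin

sublocale C: plane_tree "faces H" "DD - tree_darts H (S Red)" "face H" "face H \<circ> tw" "twin H" h qd dq DD fs "c Red"
  by unfold_locales (use finite_DD fs_DD face_fs fs_inj fs_cyc c_DD face_c in auto)

abbreviation "TD \<equiv> tree_darts H (S Red)"

lemma qd: "y \<in> faces H \<Longrightarrow> y \<noteq> h \<Longrightarrow> qd y \<in> DD" "y \<in> faces H \<Longrightarrow> y \<noteq> h \<Longrightarrow> qd y \<notin> TD"
  using C.pd_A by auto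

lemma TD_tw: "a \<in> TD \<Longrightarrow> tw a \<in> TD"
  by (rule R.T.tw_A)

lemma red_flow_zero:
  assumes "\<And>a. a \<in> DD \<Longrightarrow> \<phi> (tw a) = - \<phi> a" "\<And>a. a \<in> DD \<Longrightarrow> a \<notin> TD \<Longrightarrow> \<phi> a = 0"
    "\<And>v. (\<Sum>a\<in>out v. \<phi> a) = (0::int)" "a \<in> DD"
  shows "\<phi> a = 0"
  by (rule R.F.forest_flow_zero) (use assms R.Fo_eq in auto)

text \<open>The boundary of the set of faces below \<open>y\<close> is the fundamental cycle of the dart \<open>z\<close> that
  leads from \<open>y\<close> to its parent.\<close>

lemma sub_sgn:
  assumes y: "y \<in> faces H" "y \<noteq> h" and z: "z = tw (qd y)"
  shows "(\<Sum>f\<in>C.sub y. sgn_face f) = crossings (st z) + chi z - crossings (en z)"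
proof -
  define I :: "nat \<Rightarrow> int" where "I a = of_bool (face H a \<in> C.sub y)" for a
  let ?w = "\<lambda>a. walk_flow (R.T.rpath (st z)) a + walk_flow [z] a - walk_flow (R.T.rpath (en z)) a"
  have q: "qd y \<in> DD" "qd y \<notin> TD" using qd y by auto
  have zD: "z \<in> DD" using q z tw_DD by simp
  have zT: "z \<notin> TD" using q z TD_tw[of z] by auto
  have zV: "st z \<in> V" "en z \<in> V" using zD st_V en_V by auto
  have fz: "face H z = y" "face H (qd y) \<notin> C.sub y" "y \<in> C.sub y"
    using C.dst_pd[OF y] C.not_anc_par[OF y] C.sub_self[OF y(1)] z by (auto simp: C.sub_def)
  \<comment> \<open>Both sides are conserved, so it suffices to compare them off the shortest path
    tree. There the edge from \<open>w\<close> to its parent separates the subtree of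
    \<open>y\<close> from its complement only for \<open>w = y\<close>.\<close>
  have eq: "I a - I (tw a) - ?w a = 0" if "a \<in> DD" for a
  proof (rule red_flow_zero[where \<phi> = "\<lambda>a. I a - I (tw a) - ?w a"])
    show "I (tw a) - I (tw (tw a)) - ?w (tw a) = - (I a - I (tw a) - ?w a)" for a
      by (simp add: walk_flow_tw)
    show "(\<Sum>a\<in>out v. I a - I (tw a) - ?w a) = 0" for v
    proof -
      have "(\<Sum>a\<in>out v. I a - I (tw a)) = 0"
        unfolding flow_out by (intro sum.neutral) (auto simp: I_def face_rot)
      moreover have "(\<Sum>a\<in>out v. ?w a) = 0"
        unfolding sum_subtractf sum.distrib using R.walk_flow_rpath zV walk_flow_out1[OF zD] by simp
      ultimately show ?thesis by (subst sum_subtractf) simp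
    qed
    show "I a - I (tw a) - ?w a = 0" if a: "a \<in> DD" "a \<notin> TD" for a
    proof -
      have w: "?w a = walk_flow [z] a" using R.walk_flow_rpath_off zV a by simp
      have "I a - I (tw a) = walk_flow [z] a"
      proof -
        have aA: "a \<in> DD - TD" using a by simp
        have ne: "tw z \<noteq> z" using tw_ne zD by simp
        have *: "I (qd w) - I (tw (qd w)) = walk_flow [z] (qd w)" if w: "w \<in> faces H" "w \<noteq> h" for w
        proof (cases "w = y")
          case True
          then show ?thesis using fz ne z by (simp add: I_def walk_flow_def)
        next
          case False
          have "qd w \<noteq> qd y" using False C.dst_pd w y by metis
          moreover have "qd w \<noteq> z" using C.pd_ne_tw_pd w y z by simp
          moreover have "tw (qd w) \<noteq> z" using z \<open>qd w \<noteq> qd y\<close> tw_tw by metis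
          ultimately have "walk_flow [z] (qd w) = 0" by (simp add: walk_flow_def)
          moreover have "face H (qd w) \<in> C.sub y \<longleftrightarrow> face H (tw (qd w)) \<in> C.sub y"
            using C.anc_par[OF w, of y] C.dst_pd[OF w] C.src_pd[OF w] w False by (auto simp: C.sub_def)
          ultimately show ?thesis by (simp add: I_def)
        qed
        from aA show ?thesis
        proof (cases rule: C.A_cases)
          case (down w)
          then show ?thesis using * by simp
        next
          case (up w)
          then show ?thesis using *[of w] by (simp add: walk_flow_tw)
        qed
      qed
      then show ?thesis using w by simp
    qed
  qed (use that in simp)
  have "2 * (\<Sum>f\<in>C.sub y. sgn_face f) = (\<Sum>a\<in>DD. chi a * (I a - I (tw a)))"
    unfolding sgn_face_sum[OF C.sub_V] I_def[symmetric] by (rule antisym_sum) (rule chi_tw)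
  also have "\<dots> = (\<Sum>a\<in>DD. chi a * ?w a)" using eq by (intro sum.cong) auto
  also have "\<dots> = (\<Sum>a\<in>DD. chi a * walk_flow (R.T.rpath (st z)) a) + (\<Sum>a\<in>DD. chi a * walk_flow [z] a)
     - (\<Sum>a\<in>DD. chi a * walk_flow (R.T.rpath (en z)) a)"
    by (simp add: algebra_simps sum.distrib sum_subtractf)
  also have "\<dots> = 2 * crossings (st z) + 2 * chi z - 2 * crossings (en z)"
    using walk_flow_sum[of chi, OF chi_tw] R.T.set_rpath R.tree_darts_DD zV zD
    by (simp add: crossings_def subset_trans[OF R.T.set_rpath R.tree_darts_DD])
  finally show ?thesis by simp
qed

text \<open>Uniqueness of the trichromatic face reduces the sum to a single term, so that
  contributions cannot cancel.\<close>

lemma tricol_sum: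
  assumes "tricol f" "X \<subseteq> faces H" "h \<notin> X"
  shows "(\<Sum>g\<in>X. sgn_face g) \<noteq> 0 \<longleftrightarrow> f \<in> X"
proof -
  have X: "finite X" using assms finite_faces finite_subset by blast
  have f: "f \<in> faces H" "f \<noteq> h" using assms by (auto simp: trichromatic_def)
  have "sgn_face g = (if g = f then sgn_face f else 0)" if "g \<in> X" for g
  proof (cases "g = f")
    case False
    then have "\<not> tricol g" using tricol_unique[OF assms(1)] by blast
    moreover have "g \<in> faces H" "g \<noteq> h" using that assms by auto
    ultimately show ?thesis using sgn_face_nonzero[of g] False by simp
  qed simp
  then have "(\<Sum>g\<in>X. sgn_face g) = (\<Sum>g\<in>X. if g = f then sgn_face f else 0)" by (rule sum.cong[OF refl])
  also have "\<dots> = (if f \<in> X then sgn_face f else 0)" using X by simp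
  finally show ?thesis using sgn_face_nonzero f assms(1) by simp
qed

lemma in_sub_iff:
  assumes "tricol f" "y \<in> faces H" "y \<noteq> h"
  shows "f \<in> C.sub y \<longleftrightarrow> crossings (st (tw (qd y))) + chi (tw (qd y)) \<noteq> crossings (en (tw (qd y)))"
  using tricol_sum[OF assms(1) C.sub_V C.rt_sub[OF assms(2,3)]] sub_sgn[OF assms(2,3) refl] by auto

section \<open>Cuts along the tree path to a boundary vertex\<close>

abbreviation "rd \<equiv> C.root_dart"

lemma rd_0: "rd 0 = c Red" and rd_Suc: "rd (Suc i) = fs (rd i)"
  by (simp_all add: C.root_dart_def)

lemma rd_DD: "rd i \<in> DD" and face_rd: "face H (rd i) = h"
  using C.root_dart_Dt by auto

lemma rd_inj: "i < C.root_deg \<Longrightarrow> j < C.root_deg \<Longrightarrow> rd i = rd j \<Longrightarrow> i = j"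
  using C.root_dart_enum(1) by (auto dest: inj_onD)

lemma walk_flow_hole: "(\<Sum>a\<in>out v. walk_flow (map rd [0..<i]) a) = of_bool (v = S Red) - of_bool (v = st (rd i))"
proof (induction i)
  case 0
  then show ?case by (simp add: rd_0 st_c)
next
  case (Suc i)
  then show ?case using walk_flow_out1[OF rd_DD, of i v] by (simp add: sum.distrib rd_Suc st_fs rd_DD)
qed

lemma before_faces: "C.before i \<subseteq> faces H" "h \<notin> C.before i"
proof -
  show "C.before i \<subseteq> faces H" using C.sub_V unfolding C.before_def by blast
  show "h \<notin> C.before i"
  proof
    assume "h \<in> C.before i"
    then obtain j where "rd j \<in> DD - TD" "h \<in> C.sub ((face H \<circ> tw) (rd j))" unfolding C.before_def by blast
    then show False using C.rt_sub C.root_dart_pd[of "rd j"] C.root_dart_Dt by blast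
  qed
qed

text \<open>\<open>before i\<close> is a union of full subtrees hanging at \<open>h\<close>, so
  among the cotree edges only those at \<open>h\<close> can leave it.\<close>

lemma before_child:
  assumes "w \<in> faces H" "w \<noteq> h" "face H (qd w) \<noteq> h"
  shows "face H (qd w) \<in> C.before i \<longleftrightarrow> w \<in> C.before i"
proof -
  have "face H (qd w) \<in> C.sub (face H (tw (rd j))) \<longleftrightarrow> w \<in> C.sub (face H (tw (rd j)))" if "rd j \<in> DD - TD" for j
  proof -
    have e: "rd j = qd (face H (tw (rd j)))" using C.root_dart_pd[of "rd j"] that C.root_dart_Dt by auto
    have "w \<noteq> face H (tw (rd j))"
      using assms(3) e face_rd by metis
    then show ?thesis using C.anc_par[OF assms(1,2)] assms C.src_pd by (auto simp: C.sub_def)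
  qed
  then show ?thesis unfolding C.before_def by (auto simp: o_def)
qed

lemma count_hole_list: "i \<le> C.root_deg \<Longrightarrow> count_list (map rd [0..<i]) a = of_bool (\<exists>j<i. a = rd j)"
proof (induction i)
  case (Suc i)
  have "rd j \<noteq> rd i" "rd i \<noteq> rd j" if "j < i" for j using rd_inj[of j i] that Suc.prems by auto
  then show ?case using Suc by (cases "a = rd i") (auto simp: less_Suc_eq)
qed simp

text \<open>The cut between the first \<open>i\<close> darts of \<open>h\<close>, with all faces below them, and the rest is
  the tree path to the vertex at which the \<open>i\<close>-th dart of \<open>h\<close> starts.\<close>

lemma before_flow:
  assumes i: "i \<le> C.root_deg" and a: "a \<in> DD"
  shows "of_bool (face H a \<in> C.before i) - of_bool (face H (tw a) \<in> C.before i) =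
    walk_flow (R.T.rpath (st (rd i))) a - walk_flow (map rd [0..<i]) a"
proof -
  define I :: "nat \<Rightarrow> int" where "I a = of_bool (face H a \<in> C.before i)" for a
  let ?w = "\<lambda>a. walk_flow (R.T.rpath (st (rd i))) a - walk_flow (map rd [0..<i]) a"
  have pV: "st (rd i) \<in> V" using rd_DD st_V by simp
  have "I a - I (tw a) - ?w a = 0"
  proof (rule red_flow_zero[where \<phi> = "\<lambda>a. I a - I (tw a) - ?w a"])
    show "I (tw a) - I (tw (tw a)) - ?w (tw a) = - (I a - I (tw a) - ?w a)" for a
      by (simp add: walk_flow_tw)
    show "(\<Sum>a\<in>out v. I a - I (tw a) - ?w a) = 0" for v
    proof -
      have "(\<Sum>a\<in>out v. I a - I (tw a)) = 0"
        unfolding flow_out by (intro sum.neutral) (auto simp: I_def face_rot)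
      moreover have "(\<Sum>a\<in>out v. ?w a) = 0"
        unfolding sum_subtractf using R.walk_flow_rpath pV walk_flow_hole by simp
      ultimately show ?thesis by (subst sum_subtractf) simp
    qed
    show "I a - I (tw a) - ?w a = 0" if a: "a \<in> DD" "a \<notin> TD" for a
    proof -
      have w: "?w a = - walk_flow (map rd [0..<i]) a" using R.walk_flow_rpath_off pV a by simp
      have aA: "a \<in> DD - TD" using a by simp
      have *: "I (qd w) - I (tw (qd w)) = - walk_flow (map rd [0..<i]) (qd w)" if w: "w \<in> faces H" "w \<noteq> h" for w
      proof (cases "face H (qd w) = h")
        case False
        have "qd w \<noteq> rd j" "tw (qd w) \<noteq> rd j" for j using False C.dst_pd[OF w] w face_rd by (metis comp_apply)+
        then have "walk_flow (map rd [0..<i]) (qd w) = 0" by (simp add: walk_flow_def count_hole_list[OF i])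
        then show ?thesis using before_child[OF w False] C.dst_pd[OF w] by (simp add: I_def)
      next
        case True
        have "qd w \<in> DD" using qd w by simp
        then have "qd w \<in> {a \<in> DD. face H a = h}" using True by simp
        \<comment> \<open>The edge from \<open>h\<close> to \<open>w\<close> is the
          \<open>l\<close>-th dart of \<open>h\<close>, and it crosses the cut iff
          \<open>l < i\<close>.\<close>
        then obtain l where l: "l < C.root_deg" "qd w = rd l"
          using C.root_dart_enum(2) by (metis (no_types, lifting) imageE lessThan_iff)
        have lA: "rd l \<in> DD - TD" and dl: "face H (tw (rd l)) = w" 
          using l qd[OF w] C.dst_pd[OF w] by simp_all
        have "tw (qd w) \<noteq> rd j" for j using C.dst_pd[OF w] w face_rd by (metis comp_apply)
        moreover have "(\<exists>j<i. qd w = rd j) \<longleftrightarrow> l < i" using l rd_inj i by (metis order.strict_trans2)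
        ultimately have "walk_flow (map rd [0..<i]) (qd w) = of_bool (l < i)"
          by (simp add: walk_flow_def count_hole_list[OF i])
        moreover have "I (qd w) = 0" using True before_faces by (simp add: I_def)
        moreover have "w \<in> C.before i \<longleftrightarrow> l < i"
        proof
          assume "l < i"
          then show "w \<in> C.before i" unfolding C.before_def using lA dl C.sub_self w by auto
        next
          assume "w \<in> C.before i"
          then obtain j where j: "j < i" "rd j \<in> DD - TD" "w \<in> C.sub (face H (tw (rd j)))"
            unfolding C.before_def by auto
          then have "rd j = rd l"
            using C.child_disjoint[of "rd j" "rd l" w] lA C.root_dart_Dt dl C.sub_self w by simp
          then show "l < i" using j l rd_inj i by (metis order.strict_trans2)
        qed
        ultimately show ?thesis using dl l by (simp add: I_def)
      qed
      from aA have "I a - I (tw a) = - walk_flow (map rd [0..<i]) a"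
      proof (cases rule: C.A_cases)
        case (down w)
        then show ?thesis using * by simp
      next
        case (up w)
        then show ?thesis using *[of w] by (simp add: walk_flow_tw)
      qed
      then show ?thesis using w by simp
    qed
  qed (use a in simp)
  then show ?thesis by (simp add: I_def)
qed

lemma before_sgn:
  assumes i: "i \<le> C.root_deg"
  shows "(\<Sum>f\<in>C.before i. sgn_face f) = crossings (st (rd i)) - (\<Sum>j<i. chi (rd j))"
proof -
  let ?I = "\<lambda>a. of_bool (face H a \<in> C.before i) :: int"
  have pV: "st (rd i) \<in> V" using rd_DD st_V by simp
  have "2 * (\<Sum>f\<in>C.before i. sgn_face f) = (\<Sum>a\<in>DD. chi a * (?I a - ?I (tw a)))"
    unfolding sgn_face_sum[OF before_faces(1)] by (rule antisym_sum) (rule chi_tw)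
  also have "\<dots> = (\<Sum>a\<in>DD. chi a * (walk_flow (R.T.rpath (st (rd i))) a - walk_flow (map rd [0..<i]) a))"
    using before_flow[OF i] by (intro sum.cong) auto
  also have "\<dots> = (\<Sum>a\<in>DD. chi a * walk_flow (R.T.rpath (st (rd i))) a) - (\<Sum>a\<in>DD. chi a * walk_flow (map rd [0..<i]) a)"
    by (simp add: algebra_simps sum_subtractf)
  also have "\<dots> = 2 * crossings (st (rd i)) - 2 * sum_list (map chi (map rd [0..<i]))"
    using walk_flow_sum[of chi, OF chi_tw] pV rd_DD
    by (subst (1 2) walk_flow_sum[of chi, OF chi_tw])
       (auto simp: crossings_def dest: subsetD[OF R.T.set_rpath] subsetD[OF R.tree_darts_DD])
  also have "sum_list (map chi (map rd [0..<i])) = (\<Sum>j<i. chi (rd j))"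
    by (simp add: interv_sum_list_conv_sum_set_nat atLeast0LessThan)
  finally have *: "2 * (\<Sum>f\<in>C.before i. sgn_face f) = 2 * crossings (st (rd i)) - 2 * (\<Sum>j<i. chi (rd j))" .
  have "x = y - z" if "2 * x = 2 * y - 2 * z" for x y z :: int using that by simp
  from this[OF *] show ?thesis .
qed

text \<open>With a trichromatic face, just one dart of \<open>h\<close> leaves the red cell. This
  bit says whether it enters the green or the blue cell, that is, in which cyclic order the cells
  meet \<open>h\<close>.\<close>

definition forward :: bool where
  "forward \<longleftrightarrow> (\<exists>a\<in>face_darts H h. col (st a) = Red \<and> col (en a) = Green)"

lemma rd_step:
  assumes "i \<le> k" "P (col (st (rd i)))" "\<not> P (col (st (rd k)))"
  obtains j where "i \<le> j" "j < k" "P (col (st (rd j)))" "\<not> P (col (en (rd j)))"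
proof -
  have "\<exists>j. i \<le> j \<and> j < k \<and> P (col (st (rd j))) \<and> \<not> P (col (en (rd j)))"
    using assms(1,3)
  proof (induction k rule: dec_induct)
    case (step n)
    show ?case
    proof (cases "P (col (st (rd n)))")
      case True
      then show ?thesis using step by (intro exI[of _ n]) (simp add: rd_Suc st_fs rd_DD)
    next
      case False
      then show ?thesis using step by (meson less_SucI)
    qed
  qed (use assms in simp)
  then show ?thesis using that by blast
qed

text \<open>The walk along \<open>h\<close> starts at the red site and leaves the red cell exactly
  once before it reaches a vertex of another colour; a second departure would contradict
  \<open>tricol_hole_unique\<close>. So it contributes the same crossing number for every such
  \<open>i\<close>, and only the crossings of the tree path vary.\<close>

lemma before_iff_nonred:
  assumes f: "tricol f" and i: "i < C.root_deg" and nr: "col (st (rd i)) \<noteq> Red"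
  shows "f \<in> C.before i \<longleftrightarrow> crossings (st (rd i)) \<noteq> of_bool forward"
proof -
  have hole: "rd j \<in> face_darts H h" for j using rd_DD face_rd by (simp add: face_darts_def)
  have BB: "rd j \<in> BB" if "col (st (rd j)) \<noteq> col (en (rd j))" for j using that rd_DD by (simp add: BB_def)
  have r0: "col (st (rd 0)) = Red" using tricol_site_col[OF f] by (simp add: rd_0 st_c)
  obtain j0 where j0: "j0 < i" "col (st (rd j0)) = Red" "col (en (rd j0)) \<noteq> Red"
    using rd_step[of 0 i "\<lambda>x. x = Red"] r0 nr by auto
  have uniq: "j = j0" if "j < i" "col (st (rd j)) = Red" "col (en (rd j)) \<noteq> Red" for j
    using tricol_hole_unique(1)[OF f BB[of j] hole BB[of j0] hole] that j0 rd_inj[of j j0] i by simp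
  \<comment> \<open>A return from green to red would have to be followed by a second departure,
    since the \<open>i\<close>-th vertex is not red.\<close>
  have z: "chi (rd j) = 0" if j: "j < i" "j \<noteq> j0" for j
  proof (rule ccontr)
    assume "chi (rd j) \<noteq> 0"
    then have "col (st (rd j)) = Red \<and> col (en (rd j)) = Green \<or> col (st (rd j)) = Green \<and> col (en (rd j)) = Red"
      by (auto simp: chi_def split: if_splits)
    then have g: "col (st (rd j)) = Green" "col (st (rd (Suc j))) = Red"
      using uniq j by (auto simp: rd_Suc st_fs rd_DD)
    obtain j1 where "j1 < j" "col (st (rd j1)) = Red" "col (en (rd j1)) \<noteq> Red"
      using rd_step[of 0 j "\<lambda>x. x = Red"] r0 g by auto
    then have "j0 < j" using uniq[of j1] j by auto
    obtain j2 where "Suc j \<le> j2" "j2 < i" "col (st (rd j2)) = Red" "col (en (rd j2)) \<noteq> Red"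
      using rd_step[of "Suc j" i "\<lambda>x. x = Red"] g nr j by auto
    then show False using uniq[of j2] \<open>j0 < j\<close> by simp
  qed
  have "(\<Sum>j<i. chi (rd j)) = chi (rd j0)"
    using z j0 by (subst sum.remove[of _ j0]) (auto intro!: sum.neutral)
  also have "\<dots> = of_bool forward"
  proof -
    have "forward \<longleftrightarrow> col (en (rd j0)) = Green"
    proof
      assume forward
      then obtain a where a: "a \<in> face_darts H h" "col (st a) = Red" "col (en a) = Green"
        unfolding forward_def by blast
      then have "a \<in> BB" using face_darts_DD by (auto simp: BB_def)
      then have "a = rd j0" using tricol_hole_unique(1)[OF f _ a(1) BB[of j0] hole] a j0 by simp
      then show "col (en (rd j0)) = Green" using a by simp
    next
      assume "col (en (rd j0)) = Green"
      then show forward unfolding forward_def using hole j0 by blast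
    qed
    then show ?thesis using j0 by (simp add: chi_def)
  qed
  finally have "(\<Sum>f\<in>C.before i. sgn_face f) = crossings (st (rd i)) - of_bool forward"
    using before_sgn[OF less_imp_le[OF i]] by argo
  then show ?thesis using tricol_sum[OF f before_faces, of i] eq_iff_diff_eq_0 by metis
qed

text \<open>The path to the \<open>i\<close>-th vertex is red, hence carries no flow at darts with a
  non-red tail. So, up to a correction at the darts of \<open>h\<close>, the side of the cut is
  constant around non-red vertices and along the tree of the site \<open>s\<close> inside its
  cell.\<close>

lemma before_iff_red:
  assumes i: "i < C.root_deg" and red: "col (st (rd i)) = Red" and sc: "col (S Red) = Red"
    and f: "a \<in> DD" "face H a \<noteq> h" and g: "b \<in> DD" "face H b \<noteq> h"
    and s: "col (st a) = s" "col (st b) = s" "s \<noteq> Red"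
  shows "face H a \<in> C.before i \<longleftrightarrow> face H b \<in> C.before i"
proof -
  have i': "i \<le> C.root_deg" using i by simp
  have pV: "st (rd i) \<in> V" using rd_DD st_V by simp
  \<comment> \<open>The second term splits \<open>h\<close> into its first \<open>i\<close> corners
    and the others; it vanishes for darts beside any other face.\<close>
  define J :: "nat \<Rightarrow> int" where "J a = of_bool (face H a \<in> C.before i) + of_bool (\<exists>j<i. a = rd j)" for a
  have path_red: "col (st x) = Red \<and> col (en x) = Red" if "x \<in> set (R.T.rpath v)" "v \<in> V" "col v = Red" for x v
    using that(2,3,1)
  proof (induction rule: R.T.tree_induct)
    case (step v)
    then show ?case using red_parent[of v] R.sp_step(2)[of v] by (auto simp: R.T.rpath_step)
  qed simp
  have Jtw: "J (tw x) = J x" if x: "x \<in> DD" "col (st x) \<noteq> Red" for x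
  proof -
    have "x \<notin> set (R.T.rpath (st (rd i)))" "tw x \<notin> set (R.T.rpath (st (rd i)))"
      using path_red[OF _ pV red] x en_tw by force+
    then have "walk_flow (R.T.rpath (st (rd i))) x = 0" by (simp add: walk_flow_def)
    then show ?thesis using before_flow[OF i' x(1)] count_hole_list[OF i']
      by (simp add: J_def walk_flow_def)
  qed
  have Jrot: "J (rot H x) = J x" if x: "x \<in> DD" "col (st x) \<noteq> Red" for x
  proof -
    have r: "rot H x = fs (tw x)" by (simp add: fs_eq)
    \<comment> \<open>Passing from \<open>tw x\<close> to \<open>rot H x\<close> moves along
      \<open>h\<close> from one index to the next. This changes membership in the first
      \<open>i\<close> darts only at the indices \<open>0\<close> and \<open>i\<close>, both of
      which belong to red vertices.\<close>
    have "(\<exists>j<i. rot H x = rd j) \<longleftrightarrow> (\<exists>j<i. tw x = rd j)"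
    proof
      assume "\<exists>j<i. rot H x = rd j"
      then obtain j where j: "j < i" "rot H x = rd j" by blast
      have "j \<noteq> 0" using x st_rot j sc st_c rd_0 by metis
      then obtain k where "j = Suc k" by (cases j) auto
      then have "fs (tw x) = fs (rd k)" using r j rd_Suc by simp
      then have "tw x = rd k" using fs_inj[of UNIV] by (auto dest: injD)
      then show "\<exists>j<i. tw x = rd j" using \<open>j = Suc k\<close> j by (intro exI[of _ k]) simp
    next
      assume "\<exists>j<i. tw x = rd j"
      then obtain j where j: "j < i" "tw x = rd j" by blast
      then have e: "rot H x = rd (Suc j)" using r rd_Suc by simp
      have "Suc j \<noteq> i" using e red x st_rot by metis
      then show "\<exists>j<i. rot H x = rd j" using e j by (intro exI[of _ "Suc j"]) simp
    qed
    then have "J (rot H x) = J (tw x)" using face_rot[OF x(1)] by (simp add: J_def)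
    then show ?thesis using Jtw x by simp
  qed
  have star: "J y = J x" if xy: "x \<in> DD" "y \<in> DD" "st x = st y" "col (st x) \<noteq> Red" for x y
  proof -
    obtain k where "(rot H ^^ k) x = y" using rot_cyc xy by blast
    moreover have "(rot H ^^ k) x \<in> DD \<and> st ((rot H ^^ k) x) = st x \<and> J ((rot H ^^ k) x) = J x" for k
      using xy by (induction k) (auto simp: rot_DD st_rot Jrot)
    ultimately show ?thesis by metis
  qed
  have const: "\<forall>x\<in>out v. J x = J (c s)" if "v \<in> V" "col v = s" for v
    using that
  proof (induction rule: cell_induct)
    case root
    show ?case
    proof
      fix x assume "x \<in> out (S s)"
      then show "J x = J (c s)" using c_DD[of s] st_c[of s] s root by (intro star) auto
    qed
  next
    case (step v)
    have "J (spd s v) = J (c s)" using step by simp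
    then have t: "J (tw (spd s v)) = J (c s)" using Jtw[of "spd s v"] step s by simp
    show ?case
    proof
      fix x assume "x \<in> out v"
      then have "J x = J (tw (spd s v))" using step s tw_DD st_tw by (intro star) auto
      then show "J x = J (c s)" using t by simp
    qed
  qed
  have "J a = J b" using const st_V f g s by (metis (mono_tags, lifting) mem_Collect_eq)
  moreover have "J a = of_bool (face H a \<in> C.before i)" "J b = of_bool (face H b \<in> C.before i)"
    using f g face_rd by (auto simp: J_def)
  ultimately show ?thesis using of_bool_eq_iff by metis
qed

lemma tricol_dart:
  assumes "tricol f" obtains a where "a \<in> DD" "face H a = f" "col (st a) = s"
proof -
  have f: "f \<in> faces H" "f \<noteq> h" using assms by (auto simp: trichromatic_def)
  then obtain a where a: "a \<in> face_darts H f" by (auto simp: faces_def face_darts_def)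
  then have "s \<in> {col (st a), col (st (fs a)), col (st (fs (fs a)))}"
    using assms tricol_iff[OF f a] by simp
  moreover have "{a, fs a, fs (fs a)} \<subseteq> face_darts H f" using triangle(1)[OF f a] by simp
  ultimately show ?thesis using that by (auto simp: face_darts_def)
qed

end


section \<open>Halving regions of the tree\<close>

text \<open>A region consists of the nodes below \<open>v\<close> without those below \<open>u\<close>; \<open>s\<close> is the number of
  the latter, and \<open>s = 0\<close> means that nothing is removed.\<close>

context plane_tree
begin

definition region :: "nat \<Rightarrow> nat \<Rightarrow> nat \<Rightarrow> nat set" where
  "region v u s = sub v - (if s = 0 then {} else sub u)"

definition valid_region :: "nat \<Rightarrow> nat \<Rightarrow> nat \<Rightarrow> bool" where
  "valid_region v u s \<longleftrightarrow> v \<in> V \<and> u \<in> V \<and> (s = 0 \<or> s = card (sub u) \<and> anc v u \<and> u \<noteq> v)"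

text \<open>For \<open>w\<close> in the region, this is the number of nodes of the region below
  \<open>w\<close>.\<close>

definition weight :: "nat \<Rightarrow> nat \<Rightarrow> nat \<Rightarrow> nat" where
  "weight u s w = card (sub w) - (if anc w u then s else 0)"

text \<open>Halving the size divides the square by four, which pays for a newly removed subtree and
  still halves the potential. The factor 2 makes it progress to get rid of a removed subtree even if
  the size does not halve.\<close>

definition potential :: "nat \<Rightarrow> nat \<Rightarrow> nat \<Rightarrow> nat" where
  "potential v u s = (card (region v u s))\<^sup>2 * (if s = 0 then 1 else 2)"

text \<open>The middle node of the region in preorder; positions from the removed interval on are
  shifted by its length.\<close>

definition median :: "nat \<Rightarrow> nat \<Rightarrow> nat \<Rightarrow> nat" where
  "median v u s = (let p = pos v + (card (sub v) - s) div 2 in pre ! (if p < pos u then p else p + s))"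

lemma finite_region: "finite (region v u s)"
  by (simp add: region_def finite_sub)

lemma weight_eq:
  assumes "valid_region v u s" "w \<in> region v u s"
  shows "weight u s w = card (sub w - (if s = 0 then {} else sub u))"
proof (cases "s = 0")
  case False
  then have s: "s = card (sub u)" using assms by (simp add: valid_region_def)
  show ?thesis
  proof (cases "anc w u")
    case True
    then show ?thesis using s False sub_mono finite_sub by (simp add: weight_def card_Diff_subset)
  next
    case n: False
    have "\<not> anc u w" using assms False by (auto simp: region_def sub_def)
    then have "sub w - sub u = sub w" using sub_disjoint[OF n] by blast
    then show ?thesis using n False by (simp add: weight_def)
  qed
qed (simp add: weight_def)

lemma top_in_region: "valid_region v u s \<Longrightarrow> v \<in> region v u s"
  unfolding valid_region_def region_def using sub_self anc_antisym[of v u] by (auto simp: sub_def)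

lemma card_region: "valid_region v u s \<Longrightarrow> card (region v u s) = weight u s v"
  using weight_eq[OF _ top_in_region] by (simp add: region_def)

lemma card_region_diff:
  assumes "valid_region v u s" shows "card (region v u s) = card (sub v) - s"
  using card_region[OF assms] assms by (auto simp: weight_def valid_region_def)

lemma region_pos: "valid_region v u s \<Longrightarrow> 0 < card (region v u s)"
  using top_in_region finite_region card_gt_0_iff by blast

lemma region_anc:
  assumes "valid_region v u s" "m \<in> region v u s" "anc x m" "anc v x"
  shows "x \<in> region v u s"
proof -
  have m: "m \<in> V" using assms by (auto simp: region_def sub_def)
  then have "x \<in> V" using assms anc_V by blast
  moreover have "\<not> anc u x" if "s \<noteq> 0" using anc_trans[OF _ assms(3) m, of u] assms that m by (auto simp: region_def sub_def)
  ultimately show ?thesis using assms by (auto simp: region_def sub_def)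
qed

lemma weight_mono:
  assumes "valid_region v u s" "x \<in> region v u s" "y \<in> region v u s" "anc x y"
  shows "weight u s y \<le> weight u s x"
  unfolding weight_eq[OF assms(1,2)] weight_eq[OF assms(1,3)]
  using sub_mono[OF assms(4)] finite_sub by (intro card_mono) auto

text \<open>In the preorder with the removed interval skipped, the region occupies consecutive
  positions, and so does the part of it below any of its nodes; a run longer than half covers the
  middle.\<close>

lemma median:
  assumes v: "valid_region v u s"
  shows "median v u s \<in> region v u s"
    and "x \<in> region v u s \<Longrightarrow> card (region v u s) < 2 * weight u s x \<Longrightarrow> anc x (median v u s)"
proof -
  let ?N = "card (sub v) - s"
  let ?p = "pos v + ?N div 2"
  let ?q = "if ?p < pos u then ?p else ?p + s"
  have m: "median v u s = pre ! ?q" by (simp add: median_def Let_def)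
  have V: "v \<in> V" "u \<in> V" using v by (auto simp: valid_region_def)
  have N: "0 < ?N" using region_pos[OF v] card_region_diff[OF v] by simp
  have vb: "pos v + card (sub v) \<le> card V" using sub_pos(1) V by simp
  have hole: "s = 0 \<or> s = card (sub u) \<and> pos v \<le> pos u \<and> pos u + s \<le> pos v + card (sub v)"
  proof (cases "s = 0")
    case False
    then have s: "s = card (sub u)" "anc v u" "u \<noteq> v" using v by (auto simp: valid_region_def)
    then show ?thesis using sub_interval[OF V] by simp
  qed simp
  have q: "?q < card V" "pos v \<le> ?q" "?q < pos v + card (sub v)"
    using N vb hole by (auto split: if_splits)
  have mV: "median v u s \<in> V" "pos (median v u s) = ?q" unfolding m using nth_V pos_nth q by auto
  then have "median v u s \<in> sub v" using sub_pos(2)[OF V(1) mV(1)] q by simp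
  moreover have "median v u s \<notin> sub u" if "s \<noteq> 0"
    using sub_pos(2)[OF V(2) mV(1)] mV(2) hole that by (auto split: if_splits)
  ultimately show "median v u s \<in> region v u s" by (simp add: region_def)
  assume x: "x \<in> region v u s" and heavy: "card (region v u s) < 2 * weight u s x"
  have xV: "x \<in> V" using x by (auto simp: region_def sub_def)
  have heavy': "?N < 2 * weight u s x" using heavy card_region_diff[OF v] by simp
  have xs: "pos v \<le> pos x" "pos x + card (sub x) \<le> pos v + card (sub v)"
    using sub_interval[OF V(1) xV] x by (auto simp: region_def sub_def)
  have "pos x \<le> ?q \<and> ?q < pos x + card (sub x)"
  proof (cases "s = 0")
    case True
    then have w: "weight u s x = card (sub x)" by (simp add: weight_def)
    then show ?thesis using True heavy' xs by auto
  next
    case False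
    then have s: "s = card (sub u)" "pos v \<le> pos u" "pos u + s \<le> pos v + card (sub v)" using hole by auto
    show ?thesis
    proof (cases "anc x u")
      case True
      then have "u \<in> sub x" using V by (simp add: sub_def)
      then have xu: "pos x \<le> pos u" using sub_pos(2)[OF xV V(2)] by simp
      have w: "weight u s x = card (sub x) - s" using True by (simp add: weight_def)
      have "pos u < pos x + card (sub x)" using sub_pos(2)[OF xV V(2)] \<open>u \<in> sub x\<close> by simp
      then show ?thesis using w heavy' xs s xu by (auto split: if_splits)
    next
      case n: False
      then have w: "weight u s x = card (sub x)" by (simp add: weight_def)
      have "\<not> anc u x" using x False by (auto simp: region_def sub_def)
      then have "x \<notin> sub u" "u \<notin> sub x" using n by (auto simp: sub_def)
      then have "pos x < pos u \<or> pos u + s \<le> pos x" "pos u < pos x \<or> pos x + card (sub x) \<le> pos u"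
        using sub_pos(2)[OF V(2) xV] sub_pos(2)[OF xV V(2)] s by auto
      then have "pos x + card (sub x) \<le> pos u \<or> pos u + s \<le> pos x" using False by auto
      then show ?thesis using w heavy' xs s by (auto split: if_splits)
    qed
  qed
  then have "median v u s \<in> sub x" using sub_pos(2)[OF xV mV(1)] mV(2) by simp
  then show "anc x (median v u s)" by (simp add: sub_def)
qed

section \<open>Splitting a region at a centroid\<close>

definition split_node :: "nat \<Rightarrow> nat \<Rightarrow> nat \<Rightarrow> nat" where
  "split_node u s a = (if s \<noteq> 0 \<and> \<not> anc a u then lca a u else a)"

context
  fixes v u s l :: nat
  assumes valid: "valid_region v u s"
    and l: "dp v \<le> l" "l \<le> dp (median v u s)"
    and heavy: "card (region v u s) < 2 * weight u s (br (median v u s) ! l)"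
    and light: "l < dp (median v u s) \<Longrightarrow>
      \<not> card (region v u s) < 2 * weight u s (br (median v u s) ! Suc l)"
begin

abbreviation (input) "mm \<equiv> median v u s"
abbreviation (input) "aa \<equiv> br (median v u s) ! l"
abbreviation (input) "NN \<equiv> card (region v u s)"

lemma split_basic:
  shows "mm \<in> V" "anc v mm" "aa \<in> V" "anc aa mm" "anc v aa" "aa \<in> region v u s" "dp aa = l" "v \<in> V" "u \<in> V"
proof -
  show m: "mm \<in> V" "anc v mm" using median(1)[OF valid] by (auto simp: region_def sub_def)
  show a: "aa \<in> V" "anc aa mm" "dp aa = l" using br_nth[OF m(1) l(2)] anc_br_nth[OF m(1) l(2)] by auto
  show va: "anc v aa" using anc_chain[OF m(2) a(2) m(1)] a(3) l(1) by simp
  show "aa \<in> region v u s" by (rule region_anc[OF valid median(1)[OF valid] a(2) va])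
  show "v \<in> V" "u \<in> V" using valid by (auto simp: valid_region_def)
qed

text \<open>Going up to the lowest common ancestor puts the removed subtree below the split node, so
  that the region outside has a single removed subtree again.\<close>

lemma split_node:
  shows "split_node u s aa \<in> V" "anc v (split_node u s aa)" "anc (split_node u s aa) aa"
    "split_node u s aa \<in> region v u s" "s \<noteq> 0 \<Longrightarrow> anc (split_node u s aa) u"
proof -
  let ?t = "split_node u s aa"
  note b = split_basic
  have L: "anc (lca aa u) aa" "anc (lca aa u) u" "\<And>z. anc z aa \<Longrightarrow> anc z u \<Longrightarrow> anc z (lca aa u)"
    using lca_anc[OF b(3,9)] by auto
  show ta: "anc ?t aa" using L(1) anc_refl b(3) by (simp add: split_node_def)
  show tV: "?t \<in> V" using ta b(3) anc_V by blast
  show tu: "anc ?t u" if "s \<noteq> 0" using that L(2) by (simp add: split_node_def)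
  show vt: "anc v ?t" using L(3) b(5) valid by (auto simp: split_node_def valid_region_def)
  show "?t \<in> region v u s" by (rule region_anc[OF valid b(6) ta vt])
qed

text \<open>A heavy node of the region is an ancestor of the median. Strictly below
  \<open>aa\<close> it would lie at level \<open>Suc l\<close> or deeper on the branch of the
  median, where the weight is at most half by \<open>light\<close> and monotonicity.\<close>

lemma light_below:
  assumes "x \<in> region v u s" "anc aa x" "x \<noteq> aa"
  shows "2 * weight u s x \<le> NN"
proof (rule ccontr)
  assume "\<not> ?thesis"
  then have h: "NN < 2 * weight u s x" by simp
  note b = split_basic
  have xm: "anc x mm" using median(2)[OF valid assms(1) h] .
  have xV: "x \<in> V" using assms by (auto simp: region_def sub_def)
  have "l < dp x" using anc_dp[OF assms(2) xV] anc_eq_dp[OF assms(2) xV] assms(3) b(7) by fastforce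
  moreover have "dp x \<le> dp mm" using anc_dp[OF xm b(1)] .
  ultimately have l': "Suc l \<le> dp mm" "Suc l \<le> dp x" by auto
  let ?c = "br mm ! Suc l"
  have c: "?c \<in> V" "dp ?c = Suc l" "anc ?c mm" using br_nth[OF b(1) l'(1)] anc_br_nth[OF b(1) l'(1)] by auto
  have cx: "anc ?c x" using anc_chain[OF c(3) xm b(1)] c l' by simp
  have "anc v ?c" using anc_chain[OF b(2) c(3) b(1)] c l by simp
  then have "?c \<in> region v u s" by (rule region_anc[OF valid median(1)[OF valid] c(3)])
  then have "weight u s x \<le> weight u s ?c" using weight_mono[OF valid _ assms(1) cx] by simp
  then show False using light l' h by simp
qed

text \<open>The removed subtree covers the heavy part below the centroid, so at most half of the
  region remains; the previously removed subtree disappears inside the new one.\<close>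

lemma split_outside:
  assumes t: "split_node u s aa \<noteq> v"
  defines "u' \<equiv> split_node u s aa"
  shows "valid_region v u' (card (sub u'))"
    "region v u' (card (sub u')) = region v u s - sub u'"
    "2 * potential v u' (card (sub u')) \<le> potential v u s"
proof -
  note b = split_basic and s = split_node[folded u'_def]
  show vr: "valid_region v u' (card (sub u'))"
    using s t b by (simp add: valid_region_def u'_def)
  have c: "card (sub u') \<noteq> 0" using sub_self[OF s(1)] finite_sub by auto
  show r: "region v u' (card (sub u')) = region v u s - sub u'"
    using c s(5) sub_mono[of u' u] by (auto simp: region_def)
  have "sub aa - (if s = 0 then {} else sub u) \<subseteq> region v u s \<inter> sub u'"
    using sub_mono[OF s(3)] sub_mono[OF b(5)] by (auto simp: region_def)
  then have "weight u s aa \<le> card (region v u s \<inter> sub u')"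
    unfolding weight_eq[OF valid b(6)] using finite_region by (intro card_mono) auto
  moreover have "card (region v u s - sub u') = NN - card (region v u s \<inter> sub u')"
    using finite_region finite_sub by (simp add: card_Diff_subset_Int)
  ultimately have "2 * card (region v u' (card (sub u'))) \<le> NN" using heavy r by simp
  then have "(2 * card (region v u' (card (sub u'))))\<^sup>2 \<le> NN\<^sup>2" by (rule power_mono) simp
  then show "2 * potential v u' (card (sub u')) \<le> potential v u s"
    using c by (auto simp: potential_def power_mult_distrib)
qed

text \<open>Three cases. If the split node is the centroid itself, everything strictly below it is
  light. Otherwise a subtree that contains the removed part is disjoint from the heavy one, hence
  small; and a subtree without the removed part drops the factor 2 of the potential.\<close>

lemma split_inside:
  assumes x: "anc (split_node u s aa) x" "x \<noteq> split_node u s aa" "x \<in> region v u s"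
  defines "s' \<equiv> (if anc x u \<and> u \<noteq> x then s else 0)"
  shows "region x u s' = region v u s \<inter> sub x" "2 * potential x u s' \<le> potential v u s"
proof -
  note b = split_basic and t = split_node
  have xV: "x \<in> V" and vx: "anc v x" using x by (auto simp: region_def sub_def)
  have nu: "u \<notin> sub x \<inter> {x}" "\<not> anc u x" if "s \<noteq> 0" using x(3) that b(9) anc_refl by (auto simp: region_def sub_def)
  show r: "region x u s' = region v u s \<inter> sub x"
  proof (cases "s \<noteq> 0 \<and> \<not> (anc x u \<and> u \<noteq> x)")
    case True
    then have "\<not> anc x u" using nu anc_refl xV by auto
    then have "sub x \<inter> sub u = {}" using sub_disjoint nu True by blast
    then show ?thesis using True sub_mono[OF vx] by (auto simp: region_def s'_def)
  next
    case False
    then show ?thesis using sub_mono[OF vx] by (auto simp: region_def s'_def)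
  qed
  have le: "card (region x u s') \<le> NN" unfolding r using finite_region by (intro card_mono) auto
  have half: "2 * potential x u s' \<le> potential v u s" if "2 * card (region x u s') \<le> NN"
  proof -
    have "(2 * card (region x u s'))\<^sup>2 \<le> NN\<^sup>2" using that by (rule power_mono) simp
    then show ?thesis using le by (auto simp: potential_def power_mult_distrib)
  qed
  show "2 * potential x u s' \<le> potential v u s"
  proof (cases "s \<noteq> 0 \<and> \<not> anc aa u")
    case False
    then have "split_node u s aa = aa" by (auto simp: split_node_def)
    then have "2 * weight u s x \<le> NN" using light_below x by simp
    moreover have "region v u s \<inter> sub x = sub x - (if s = 0 then {} else sub u)"
      using sub_mono[OF vx] by (auto simp: region_def)
    ultimately show ?thesis using half r weight_eq[OF valid x(3)] by simp
  next
    case True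
    then have tl: "split_node u s aa = lca aa u" by (simp add: split_node_def)
    show ?thesis
    proof (cases "anc x u")
      case xu: True
      have "\<not> anc x aa"
      proof
        assume "anc x aa"
        then have "anc x (lca aa u)" using lca_anc(3)[OF b(3,9) _ xu] by blast
        then show False using x tl anc_antisym[of x "lca aa u"] t(1) by simp
      qed
      moreover have "\<not> anc aa x" using anc_trans[OF _ xu b(9)] True by blast
      ultimately have "sub x \<inter> sub aa = {}" by (rule sub_disjoint)
      then have "region v u s \<inter> sub x \<subseteq> region v u s - (sub aa - (if s = 0 then {} else sub u))" by auto
      then have "card (region x u s') \<le> card (region v u s - (sub aa - (if s = 0 then {} else sub u)))"
        unfolding r using finite_region by (intro card_mono) auto
      also have "\<dots> = NN - weight u s aa"
        unfolding weight_eq[OF valid b(6)] using finite_region finite_sub sub_mono[OF b(5)]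
        by (intro card_Diff_subset) (auto simp: region_def)
      finally show ?thesis using half heavy by simp
    next
      case False
      then have "potential x u s' = (card (region x u s'))\<^sup>2" by (simp add: potential_def s'_def)
      also have "\<dots> \<le> NN\<^sup>2" using le by (rule power_mono) simp
      finally show ?thesis using True by (simp add: potential_def)
    qed
  qed
qed

end

end

section \<open>The queries\<close>

context voronoi_cotree
begin

lemma the_cotree: "the_tree H Cotree (c Red) = C.dg" and cotree_root: "dart_node H Cotree (c Red) = h"
  by (simp_all add: the_tree_def st_c face_c)

lemma the_primal: "the_tree H Primal (c Red) = R.T.dg" and primal_root: "dart_node H Primal (c Red) = S Red"
  by (simp_all add: the_tree_def st_c)

lemma cotree_path: "y \<in> faces H \<Longrightarrow> root_path H Cotree (c Red) y = C.rpath y"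
  unfolding root_path_def the_cotree cotree_root by (rule C.THE_apath)

lemma primal_path: "v \<in> V \<Longrightarrow> root_path H Primal (c Red) v = R.T.rpath v"
  unfolding root_path_def the_primal primal_root by (rule R.T.THE_apath)

lemma cotree_branch: "y \<in> faces H \<Longrightarrow> branch H Cotree (c Red) y = C.br y"
  unfolding branch_def the_cotree cotree_root using C.apath_rpath by (simp add: cotree_path)

lemma primal_branch: "v \<in> V \<Longrightarrow> branch H Primal (c Red) v = R.T.br v"
  unfolding branch_def the_primal primal_root using R.T.apath_rpath by (simp add: primal_path)

lemma cotree_ancestor: "y \<in> faces H \<Longrightarrow> ancestor H Cotree (c Red) x y \<longleftrightarrow> C.anc x y"
  by (simp add: ancestor_def C.anc_def cotree_branch)

lemma cotree_size: "card {y \<in> verts (the_tree H Cotree (c Red)). ancestor H Cotree (c Red) x y} = card (C.sub x)"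
proof -
  have "{y \<in> verts (the_tree H Cotree (c Red)). ancestor H Cotree (c Red) x y} = C.sub x"
    using cotree_ancestor by (auto simp: the_cotree C.sub_def)
  then show ?thesis by simp
qed

lemma cotree_preorder: "preorder H Cotree (c Red) = C.pre"
proof -
  have nx: "next_dart H Cotree = fs" by (rule ext) simp
  have f: "first_tree_dart H Cotree (c Red) = C.ftd"
    by (rule ext) (simp add: first_tree_dart_def C.ftd_def the_cotree nx)
  have n: "tour_next H Cotree (c Red) = C.nxt"
    by (rule ext) (simp add: tour_next_def C.nxt_def f)
  show ?thesis
    by (simp add: preorder_def C.pre_def first_occs_def tour_def C.tour_list_def f n the_cotree cotree_root face_c del: remdups.simps rev.simps)
qed

text \<open>Each triangle has three darts of its own, and Euler's formula bounds their number in
  turn. This expresses searches over faces in terms of the number of vertices.\<close>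

lemma card_faces: "card (faces H) \<le> 2 * card V"
proof -
  have "(\<Sum>f\<in>faces H - {h}. 3) \<le> (\<Sum>f\<in>faces H - {h}. card (face_darts H f))"
    using triangular by (intro sum_mono) (auto simp: triangular_face_def)
  also have "\<dots> \<le> (\<Sum>f\<in>faces H. card (face_darts H f))"
    using finite_faces by (intro sum_mono2) auto
  also have "\<dots> = card (\<Union>f\<in>faces H. face_darts H f)"
    using finite_faces finite_face_darts by (intro card_UN_disjoint[symmetric]) (auto simp: face_darts_def)
  also have "(\<Union>f\<in>faces H. face_darts H f) = DD" by (auto simp: face_darts_def faces_def)
  finally have "3 * (card (faces H) - 1) \<le> card DD" using h_faces by (simp add: card_Diff_singleton mult.commute)
  then show ?thesis using euler by simp
qed

lemma depth_less: "v \<in> V \<Longrightarrow> R.depth v < card V"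
proof -
  assume v: "v \<in> V"
  show ?thesis using R.sp[OF v] G.length_apath_less unfolding shortest_path_def R.depth_def by blast
qed

lemma dq_less: "y \<in> faces H \<Longrightarrow> dq y < card (faces H)"
proof -
  assume y: "y \<in> faces H"
  have "dp \<le> card (faces H) - 1" if "dp = dq y" for dp
  proof -
    have "inj_on (\<lambda>k. C.br y ! k) {..dq y}" using C.br_nth(2)[OF y] by (intro inj_onI) (metis atMost_iff)
    then have "card {..dq y} \<le> card (faces H)"
      using C.br_nth(1)[OF y] finite_faces by (intro card_inj_on_le) auto
    then show ?thesis using that by simp
  qed
  moreover have "0 < card (faces H)" using y finite_faces card_gt_0_iff by blast
  ultimately show ?thesis by fastforce
qed

end


section \<open>Running programs\<close>

text \<open>The number \<open>k\<close> bounds the rounds of every execution of every loop; adding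
  the two branches of a conditional keeps the expression free of maxima.\<close>

fun time_bound :: "nat \<Rightarrow> nat \<Rightarrow> com \<Rightarrow> nat" where
  "time_bound D k Skip = 1"
| "time_bound D k (NAssign i e) = 1 + ntime D e"
| "time_bound D k (RAssign i e) = 1 + rtime D e"
| "time_bound D k (Seq p q) = time_bound D k p + time_bound D k q"
| "time_bound D k (If b p q) = 1 + btime D b + time_bound D k p + time_bound D k q"
| "time_bound D k (While b p) = (k + 1) * (1 + btime D b) + k * time_bound D k p"

fun nesting :: "com \<Rightarrow> nat" where
  "nesting (Seq p q) = max (nesting p) (nesting q)"
| "nesting (If b p q) = max (nesting p) (nesting q)"
| "nesting (While b p) = Suc (nesting p)"
| "nesting p = 0"

lemma ntime_le: "1 \<le> D \<Longrightarrow> ntime D e \<le> ntime 1 e * D"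
proof (induction e)
  case (NAdd e1 e2) then show ?case by (simp add: algebra_simps)
next
  case (NSub e1 e2) then show ?case by (simp add: algebra_simps)
next
  case (LevelAncestor x1a x2 e1 e2) then show ?case by (simp add: algebra_simps)
next
  case (IsAncestor x1a x2 e1 e2) then show ?case by (simp add: algebra_simps)
next
  case (LCA x1a x2 e1 e2) then show ?case by (simp add: algebra_simps)
qed simp_all

lemma rtime_le: "1 \<le> D \<Longrightarrow> rtime D e \<le> rtime 1 e * D"
proof (induction e)
  case (RAdd e1 e2) then show ?case by (simp add: algebra_simps)
next
  case (RSub e1 e2) then show ?case by (simp add: algebra_simps)
next
  case (Dist s e) then show ?case using ntime_le[of D e] by (simp add: algebra_simps)
qed simp_all

lemma btime_le: "1 \<le> D \<Longrightarrow> btime D b \<le> btime 1 b * D"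
proof (induction b)
  case (NLess e1 e2) then show ?case using ntime_le[of D e1] ntime_le[of D e2] by (simp add: algebra_simps)
next
  case (RLess e1 e2) then show ?case using rtime_le[of D e1] rtime_le[of D e2] by (simp add: algebra_simps)
next
  case (BAnd b1 b2) then show ?case by (simp add: algebra_simps)
qed simp_all

text \<open>The factor \<open>time_bound 1 1 p\<close> depends on the program alone. Charging
  \<open>D\<close> for every step costs a factor \<open>D\<close>, and each level of loop nesting a
  factor \<open>k + 1\<close>.\<close>

lemma time_bound_le:
  assumes D: "1 \<le> D" shows "time_bound D k p \<le> time_bound 1 1 p * D * (k + 1) ^ nesting p"
proof (induction p)
  case Skip
  then show ?case using D by simp
next
  case (NAssign i e)
  then show ?case using ntime_le[OF D, of e] D by simp
next
  case (RAssign i e)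
  then show ?case using rtime_le[OF D, of e] D by simp
next
  case (Seq p q)
  let ?m = "max (nesting p) (nesting q)"
  have "(k + 1) ^ nesting p \<le> (k + 1) ^ ?m" "(k + 1) ^ nesting q \<le> (k + 1) ^ ?m" by (auto intro: power_increasing)
  then have "time_bound D k p \<le> time_bound 1 1 p * D * (k + 1) ^ ?m" "time_bound D k q \<le> time_bound 1 1 q * D * (k + 1) ^ ?m"
    using Seq by (meson le_trans mult_le_mono2)+
  then show ?case by (simp add: distrib_right)
next
  case (If b p q)
  let ?m = "max (nesting p) (nesting q)"
  have "(k + 1) ^ nesting p \<le> (k + 1) ^ ?m" "(k + 1) ^ nesting q \<le> (k + 1) ^ ?m" by (auto intro: power_increasing)
  then have pq: "time_bound D k p \<le> time_bound 1 1 p * D * (k + 1) ^ ?m" "time_bound D k q \<le> time_bound 1 1 q * D * (k + 1) ^ ?m"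
    using If by (meson le_trans mult_le_mono2)+
  have "1 + btime D b \<le> (1 + btime 1 b) * D" using btime_le[OF D, of b] D by simp
  also have "\<dots> * 1 \<le> (1 + btime 1 b) * D * (k + 1) ^ ?m" by (intro mult_le_mono) simp_all
  finally show ?case using pq by (simp add: distrib_right)
next
  case (While b p)
  have "(k + 1) * (1 + btime D b) \<le> (k + 1) * ((1 + btime 1 b) * D)" using btime_le[OF D, of b] D by (intro mult_le_mono) simp_all
  also have "\<dots> * 1 \<le> (k + 1) * ((1 + btime 1 b) * D) * (k + 1) ^ nesting p" by (intro mult_le_mono) simp_all
  also have "\<dots> = (1 + btime 1 b) * D * (k + 1) ^ Suc (nesting p)" by (simp add: algebra_simps)
  finally have 1: "(k + 1) * (1 + btime D b) \<le> (1 + btime 1 b) * D * (k + 1) ^ Suc (nesting p)" by simp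
  have "k * time_bound D k p \<le> (k + 1) * (time_bound 1 1 p * D * (k + 1) ^ nesting p)"
    using While by (intro mult_le_mono) simp_all
  also have "\<dots> = time_bound 1 1 p * D * (k + 1) ^ Suc (nesting p)" by (simp add: algebra_simps)
  finally have 2: "k * time_bound D k p \<le> time_bound 1 1 p * D * (k + 1) ^ Suc (nesting p)" .
  have "time_bound D k (While b p) \<le> (1 + btime 1 b) * D * (k + 1) ^ Suc (nesting p) + time_bound 1 1 p * D * (k + 1) ^ Suc (nesting p)"
    using 1 2 by simp
  also have "\<dots> \<le> time_bound 1 1 (While b p) * D * (k + 1) ^ nesting (While b p)"
    by (simp add: distrib_right)
  finally show ?case .
qed

locale machine =
  fixes H :: plane_digraph and c :: "site \<Rightarrow> nat" and D k :: nat
begin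

abbreviation "nv e \<sigma> \<equiv> nval H c e \<sigma>"
abbreviation "bv b \<sigma> \<equiv> bval H c b \<sigma>"

text \<open>Total correctness; for fixed \<open>D\<close> and \<open>k\<close> the bound on the time
  depends on the program text only, so postconditions never have to mention time.\<close>

definition runs :: "com \<Rightarrow> state \<Rightarrow> (state \<Rightarrow> bool) \<Rightarrow> bool" where
  "runs p \<sigma> Q \<longleftrightarrow> (\<exists>t \<sigma>'. exec H c D p \<sigma> t \<sigma>' \<and> t \<le> time_bound D k p \<and> Q \<sigma>')"

lemma runs_mono: "runs p \<sigma> Q \<Longrightarrow> (\<And>\<sigma>'. Q \<sigma>' \<Longrightarrow> Q' \<sigma>') \<Longrightarrow> runs p \<sigma> Q'"
  unfolding runs_def by blast

lemma runs_skip: "Q \<sigma> \<Longrightarrow> runs Skip \<sigma> Q"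
  unfolding runs_def using exec.Skip by fastforce

lemma runs_assign: "Q ((fst \<sigma>)(i := nv e \<sigma>), snd \<sigma>) \<Longrightarrow> runs (NAssign i e) \<sigma> Q"
  unfolding runs_def using exec.NAssign by fastforce

lemma runs_seq: "runs p \<sigma> (\<lambda>\<sigma>'. runs q \<sigma>' Q) \<Longrightarrow> runs (Seq p q) \<sigma> Q"
proof -
  assume "runs p \<sigma> (\<lambda>\<sigma>'. runs q \<sigma>' Q)"
  then obtain t \<sigma>' t' \<sigma>'' where "exec H c D p \<sigma> t \<sigma>'" "t \<le> time_bound D k p"
    "exec H c D q \<sigma>' t' \<sigma>''" "t' \<le> time_bound D k q" "Q \<sigma>''" unfolding runs_def by blast
  then show ?thesis unfolding runs_def using exec.Seq[of H c D p \<sigma> t \<sigma>' q t' \<sigma>'']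
    by (intro exI[of _ "t + t'"] exI[of _ \<sigma>'']) simp
qed

lemma runs_if: "(bv b \<sigma> \<Longrightarrow> runs p \<sigma> Q) \<Longrightarrow> (\<not> bv b \<sigma> \<Longrightarrow> runs q \<sigma> Q) \<Longrightarrow> runs (If b p q) \<sigma> Q"
proof (cases "bv b \<sigma>")
  case True
  assume "bv b \<sigma> \<Longrightarrow> runs p \<sigma> Q"
  then obtain t \<sigma>' where t: "exec H c D p \<sigma> t \<sigma>'" "t \<le> time_bound D k p" "Q \<sigma>'" using True unfolding runs_def by blast
  then show ?thesis unfolding runs_def using exec.IfTrue[OF True t(1), of q]
    by (intro exI[of _ "1 + btime D b + t"] exI[of _ \<sigma>']) simp
next
  case False
  assume "\<not> bv b \<sigma> \<Longrightarrow> runs q \<sigma> Q"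
  then obtain t \<sigma>' where t: "exec H c D q \<sigma> t \<sigma>'" "t \<le> time_bound D k q" "Q \<sigma>'" using False unfolding runs_def by blast
  then show ?thesis unfolding runs_def using exec.IfFalse[OF False t(1), of p]
    by (intro exI[of _ "1 + btime D b + t"] exI[of _ \<sigma>']) simp
qed

text \<open>A measure below \<open>2 ^ k\<close> that halves in each round is \<open>0\<close> after
  \<open>k\<close> rounds, and then the test is false, since a true test entails a positive
  measure.\<close>

lemma runs_while:
  fixes m :: "state \<Rightarrow> nat"
  assumes "I \<sigma>" "m \<sigma> < 2 ^ k"
    and body: "\<And>\<sigma>. I \<sigma> \<Longrightarrow> bv b \<sigma> \<Longrightarrow> 0 < m \<sigma> \<and> runs p \<sigma> (\<lambda>\<sigma>'. I \<sigma>' \<and> m \<sigma>' \<le> m \<sigma> div 2)"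
  shows "runs (While b p) \<sigma> (\<lambda>\<sigma>'. I \<sigma>' \<and> \<not> bv b \<sigma>')"
proof -
  have "\<exists>t \<sigma>'. exec H c D (While b p) \<sigma> t \<sigma>' \<and> t \<le> (n + 1) * (1 + btime D b) + n * time_bound D k p \<and> I \<sigma>' \<and> \<not> bv b \<sigma>'"
    if "I \<sigma>" "m \<sigma> < 2 ^ n" for n
    using that
  proof (induction n arbitrary: \<sigma>)
    case 0
    then have "\<not> bv b \<sigma>" using body by fastforce
    then show ?case using exec.WhileFalse 0 by fastforce
  next
    case (Suc n)
    show ?case
    proof (cases "bv b \<sigma>")
      case True
      then obtain t \<sigma>' where t: "exec H c D p \<sigma> t \<sigma>'" "t \<le> time_bound D k p" "I \<sigma>'" "m \<sigma>' \<le> m \<sigma> div 2"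
        using body Suc.prems unfolding runs_def by blast
      then have "m \<sigma>' < 2 ^ n" using Suc.prems by simp
      then obtain t' \<sigma>'' where t': "exec H c D (While b p) \<sigma>' t' \<sigma>''"
        "t' \<le> (n + 1) * (1 + btime D b) + n * time_bound D k p" "I \<sigma>''" "\<not> bv b \<sigma>''" using Suc.IH t by blast
      have "1 + btime D b + t + t' \<le> (Suc n + 1) * (1 + btime D b) + Suc n * time_bound D k p"
        using t(2) t'(2) by simp
      then show ?thesis using exec.WhileTrue[OF True t(1) t'(1)] t' by blast
    next
      case False
      have "1 + btime D b \<le> (Suc n + 1) * (1 + btime D b) + Suc n * time_bound D k p" by simp
      then show ?thesis using exec.WhileFalse[of H c b \<sigma> D p] False Suc.prems by blast
    qed
  qed
  then show ?thesis using assms unfolding runs_def by simp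
qed

text \<open>Frame condition: \<open>W\<close> collects the number registers that may change. The
  registers for lengths keep the weights throughout.\<close>

definition eqoff :: "nat set \<Rightarrow> state \<Rightarrow> state \<Rightarrow> bool" where
  "eqoff W \<sigma> \<sigma>' \<longleftrightarrow> snd \<sigma>' = snd \<sigma> \<and> (\<forall>i. i \<notin> W \<longrightarrow> fst \<sigma>' i = fst \<sigma> i)"

end

section \<open>The program\<close>

abbreviation (input) "bor b b' \<equiv> BNot (BAnd (BNot b) (BNot b'))"
abbreviation (input) "beq e e' \<equiv> BAnd (BNot (NLess e e')) (BNot (NLess e' e))"
abbreviation (input) "bpos e \<equiv> NLess (NConst 0) e"
abbreviation (input) "fsx e \<equiv> Rot (Twin e)"
abbreviation (input) "banc e e' \<equiv> bpos (IsAncestor Cotree Red e e')"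
abbreviation (input) "size_of e \<equiv> SubtreeSize Cotree Red e"
abbreviation (input) "rank_of e \<equiv> Rank Cotree Red e"
abbreviation (input) "R i \<equiv> NReg i"

fun site_reg :: "site \<Rightarrow> nat" where
  "site_reg Red = 0" | "site_reg Green = 1" | "site_reg Blue = 2"

definition beats_test :: "site \<Rightarrow> site \<Rightarrow> nexp \<Rightarrow> bexp" where
  "beats_test s t e =
     (let ds = RAdd (RReg (site_reg s)) (Dist s e); dt = RAdd (RReg (site_reg t)) (Dist t e)
      in bor (RLess ds dt)
           (BAnd (BNot (RLess dt ds))
             (bor (RLess (RReg (site_reg t)) (RReg (site_reg s)))
               (BAnd (BNot (RLess (RReg (site_reg s)) (RReg (site_reg t))))
                 (NLess (Tail (R (site_reg t))) (Tail (R (site_reg s))))))))"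

fun cell_test :: "site \<Rightarrow> nexp \<Rightarrow> bexp" where
  "cell_test Red e = BAnd (beats_test Red Green e) (beats_test Red Blue e)"
| "cell_test Green e = BAnd (beats_test Green Red e) (beats_test Green Blue e)"
| "cell_test Blue e = BAnd (beats_test Blue Red e) (beats_test Blue Green e)"

text \<open>
  Registers 0 to 2 keep the reference darts of the sites.  Registers 3, 4 and 5 hold the region
  searched (in the order of \<open>region\<close>), 12 the face to be decided, 13 the dart from it to its
  parent, 16 the decision, 17 the anchor, 18 and 19 an interval of preorder positions, 25 the
  node at which a region is split, 26 the current dart of a face, and 20 and 21 the answer.

  The level search starts from the node in register 8.  Register 6 is a depth at which the
  ancestor passes the test, 7 the number of deeper levels still in question, and 10 the
  candidate.
\<close>

definition level_search :: "side \<Rightarrow> bexp \<Rightarrow> com" where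
  "level_search T b = While (bpos (R 7))
     (Seq (NAssign 9 (NHalf (NAdd (R 7) (NConst 1))))
     (Seq (NAssign 10 (LevelAncestor T Red (R 8) (NAdd (R 6) (R 9))))
     (If b (Seq (NAssign 6 (NAdd (R 6) (R 9))) (NAssign 7 (NSub (R 7) (R 9))))
           (NAssign 7 (NSub (R 9) (NConst 1))))))"

definition frontier :: com where
  "frontier = Seq (NAssign 6 (NConst 0))
     (Seq (NAssign 7 (Depth Primal Red (R 8))) (level_search Primal (cell_test Red (R 10))))"

text \<open>The first node after the red prefix decides: by \<open>crossings_frontier\<close> the
  path has a crossing iff this node is green.\<close>

definition count_crossings :: com where
  "count_crossings = Seq frontier
     (If (BAnd (NLess (R 6) (Depth Primal Red (R 8)))
               (cell_test Green (LevelAncestor Primal Red (R 8) (NAdd (R 6) (NConst 1)))))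
        (NAssign 11 (NConst 1)) (NAssign 11 (NConst 0)))"

text \<open>Registers hold natural numbers, so the signed crossing of the dart itself is split: its
  positive part is added on one side of the comparison, in register 27, and its negative part on the
  other, in register 28.\<close>

definition decide :: com where
  "decide = Seq (NAssign 13 (Parent Cotree Red (R 12)))
     (Seq (NAssign 8 (Tail (R 13))) (Seq count_crossings (Seq (NAssign 14 (R 11))
     (Seq (NAssign 8 (Head (R 13))) (Seq count_crossings (Seq (NAssign 15 (R 11))
     (Seq (NAssign 27 (R 14)) (Seq (NAssign 28 (R 15))
     (Seq (If (BAnd (cell_test Red (Tail (R 13))) (cell_test Green (Head (R 13))))
            (NAssign 27 (NAdd (R 27) (NConst 1))) Skip)
     (Seq (If (BAnd (cell_test Green (Tail (R 13))) (cell_test Red (Head (R 13))))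
            (NAssign 28 (NAdd (R 28) (NConst 1))) Skip)
     (If (beq (R 27) (R 28)) (NAssign 16 (NConst 0)) (NAssign 16 (NConst 1)))))))))))))"

text \<open>The anchor is a face other than \<open>h\<close> that has a corner outside the red cell.  When the
  tree path to a boundary vertex is red, it separates no such corner from the trichromatic face,
  so comparing with the anchor replaces the unknown position of the trichromatic face.\<close>

definition find_anchor :: com where
  "find_anchor = Seq (NAssign 8 (Tail (R 1))) (Seq frontier
     (Seq (NAssign 26 (Parent Primal Red (LevelAncestor Primal Red (R 8) (NAdd (R 6) (NConst 1)))))
     (Seq (NAssign 17 (Face (R 26)))
     (If (beq (R 17) (Face (R 0))) (NAssign 17 (Face (Twin (R 26)))) Skip))))"

text \<open>Each probe jumps from the middle position to the child of \<open>h\<close> above it. A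
  hit empties the interval; otherwise the whole subtree of that child is discarded together with one
  side of it. The parameter \<open>b\<close> is the guess for \<open>forward\<close>.\<close>

definition child_search :: "nat \<Rightarrow> com" where
  "child_search b = Seq (NAssign 18 (NConst 1)) (Seq (NAssign 19 (size_of (Face (R 0))))
     (Seq (NAssign 3 (LevelAncestor Cotree Red (Select Cotree Red (NConst 1)) (NConst 1)))
     (While (NLess (R 18) (R 19))
       (Seq (NAssign 12 (LevelAncestor Cotree Red (Select Cotree Red (NHalf (NAdd (R 18) (R 19)))) (NConst 1)))
       (Seq decide (Seq (NAssign 3 (R 12))
       (If (bpos (R 16)) (NAssign 19 (R 18))
       (If (bor (BAnd (cell_test Red (Head (R 13))) (NLess (rank_of (R 17)) (rank_of (R 12))))
                (BAnd (BNot (cell_test Red (Head (R 13)))) (BNot (beq (R 15) (NConst b)))))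
          (NAssign 19 (rank_of (R 12)))
          (NAssign 18 (NAdd (rank_of (R 12)) (size_of (R 12))))))))))))"

definition some_corner :: "site \<Rightarrow> bexp" where
  "some_corner s = bor (cell_test s (Tail (R 26)))
     (bor (cell_test s (Tail (fsx (R 26)))) (cell_test s (Tail (fsx (fsx (R 26))))))"

definition check_face :: com where
  "check_face = Seq (NAssign 26 (Parent Cotree Red (R 25)))
     (If (BAnd (some_corner Red) (BAnd (some_corner Green) (some_corner Blue)))
        (Seq (NAssign 20 (NConst 1)) (NAssign 21 (R 25))) Skip)"

definition visit_neighbour :: com where
  "visit_neighbour = Seq (NAssign 26 (fsx (R 26))) (Seq (NAssign 12 (Face (Twin (R 26))))
     (If (BAnd (BNot (beq (R 12) (R 25))) (banc (R 25) (R 12)))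
        (Seq decide (If (bpos (R 16)) (NAssign 3 (R 12)) Skip)) Skip))"

definition heavy_test :: bexp where
  "heavy_test =
     bor (BAnd (banc (R 10) (R 4)) (NLess (R 23) (NAdd (NSub (size_of (R 10)) (R 5)) (NSub (size_of (R 10)) (R 5)))))
         (BAnd (BNot (banc (R 10) (R 4))) (NLess (R 23) (NAdd (size_of (R 10)) (size_of (R 10)))))"

definition find_median :: com where
  "find_median = Seq (NAssign 23 (NSub (size_of (R 3)) (R 5)))
     (Seq (NAssign 24 (NAdd (rank_of (R 3)) (NHalf (R 23))))
     (Seq (If (NLess (R 24) (rank_of (R 4))) Skip (NAssign 24 (NAdd (R 24) (R 5))))
     (NAssign 8 (Select Cotree Red (R 24)))))"

definition find_split :: com where
  "find_split = Seq find_median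
     (Seq (NAssign 6 (Depth Cotree Red (R 3)))
     (Seq (NAssign 7 (NSub (Depth Cotree Red (R 8)) (R 6)))
     (Seq (level_search Cotree heavy_test)
     (Seq (NAssign 25 (LevelAncestor Cotree Red (R 8) (R 6)))
     (If (BAnd (bpos (R 5)) (BNot (banc (R 25) (R 4)))) (NAssign 25 (LCA Cotree Red (R 25) (R 4))) Skip)))))"

text \<open>One of the three darts of the split face leads to its parent, so two visits cover all
  children. The last test forgets the removed subtree unless it hangs strictly below the new
  top.\<close>

definition halve :: com where
  "halve = Seq find_split (Seq (NAssign 12 (R 25)) (Seq decide
     (If (BAnd (BNot (beq (R 25) (R 3))) (BNot (bpos (R 16))))
        (Seq (NAssign 4 (R 25)) (NAssign 5 (size_of (R 25))))
        (Seq (NAssign 3 (R 25)) (Seq check_face (Seq visit_neighbour (Seq visit_neighbour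
        (If (BAnd (banc (R 3) (R 4)) (BNot (beq (R 3) (R 4)))) Skip (NAssign 5 (NConst 0))))))))))"

text \<open>Register 22 is a clock: the potential stays below the square of its value plus one. The
  potential is quadratic in the size and is only halved by one step, so two steps go with each
  halving of the clock.\<close>

definition region_search :: com where
  "region_search = Seq (NAssign 4 (R 3)) (Seq (NAssign 5 (NConst 0))
     (Seq (NAssign 22 (size_of (Face (R 0))))
     (While (bpos (R 22)) (Seq (NAssign 22 (NHalf (R 22))) (Seq halve halve)))))"

text \<open>The orientation in which the three cells occur around \<open>h\<close> is unknown, so both are tried.\<close>

definition find_trichromatic :: com where
  "find_trichromatic = Seq
     (If (NLess (NConst 1) (size_of (Face (R 0))))
        (Seq find_anchor (Seq (child_search 0) (Seq region_search (Seq (child_search 1) region_search)))) Skip)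
     (Seq (NAssign 0 (R 20)) (NAssign 1 (R 21)))"

text \<open>The outer loops contain no loops but level searches; this depth becomes the exponent of
  the logarithm.\<close>

lemma nesting_find_trichromatic: "nesting find_trichromatic = 2"
  by (simp add: find_trichromatic_def find_anchor_def child_search_def region_search_def halve_def find_split_def find_median_def
      visit_neighbour_def check_face_def decide_def count_crossings_def frontier_def level_search_def)

context dart_tree
begin

lemma br_parent:
  assumes "v \<in> V" "Suc l \<le> dp v"
  shows "br v ! Suc l \<noteq> rt" "src (pd (br v ! Suc l)) = br v ! l"
proof -
  let ?x = "br v ! Suc l"
  have x: "?x \<in> V" "dp ?x = Suc l" "br ?x = take (Suc (Suc l)) (br v)" using br_nth assms by auto
  show n: "?x \<noteq> rt" using x dp_rt by auto
  have "br ?x = br (src (pd ?x)) @ [?x]" using br_step x n by simp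
  moreover have "length (br (src (pd ?x))) = Suc l" using length_br src_pd dp_pd x n by simp
  ultimately have "br (src (pd ?x)) = take (Suc l) (br v)" using x(3)
    by (metis append_eq_conv_conj min.absorb1 le_Suc_eq take_take order_refl)
  then have "last (br (src (pd ?x))) = last (take (Suc l) (br v))" by simp
  also have "last (take (Suc l) (br v)) = br v ! l"
    using length_br[OF assms(1)] assms(2) by (subst last_conv_nth) auto
  finally show "src (pd ?x) = br v ! l" using last_br src_pd x n by simp
qed

end

text \<open>Depths, positions and sizes are bounded by the number of vertices or of faces, so all
  loop measures start below \<open>2 ^ k\<close>.\<close>

locale voronoi_run = voronoi_cotree +
  fixes D k :: nat
  assumes k: "2 * card (verts (graph H)) < 2 ^ k"
begin

sublocale machine H c D k .

definition good :: "state \<Rightarrow> bool" where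
  "good \<sigma> \<longleftrightarrow> fst \<sigma> 0 = c Red \<and> fst \<sigma> 1 = c Green \<and> fst \<sigma> 2 = c Blue \<and>
     snd \<sigma> 0 = \<omega> Red \<and> snd \<sigma> 1 = \<omega> Green \<and> snd \<sigma> 2 = \<omega> Blue"

lemma good_eqoff: "good \<sigma> \<Longrightarrow> eqoff W \<sigma> \<sigma>' \<Longrightarrow> 0 \<notin> W \<Longrightarrow> 1 \<notin> W \<Longrightarrow> 2 \<notin> W \<Longrightarrow> good \<sigma>'"
  by (simp add: good_def eqoff_def)

lemma good_site: "good \<sigma> \<Longrightarrow> fst \<sigma> (site_reg s) = c s" "good \<sigma> \<Longrightarrow> snd \<sigma> (site_reg s) = \<omega> s"
  by (cases s; simp add: good_def)+

lemma bval_beats: "good \<sigma> \<Longrightarrow> bv (beats_test s t e) \<sigma> \<longleftrightarrow> beats s t (nv e \<sigma>)"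
  by (auto simp: beats_test_def Let_def beats_def good_site st_c shortest_path_tree.dst_def[OF site_tree])

lemma bval_cell:
  assumes "good \<sigma>" "nv e \<sigma> \<in> V" shows "bv (cell_test s e) \<sigma> \<longleftrightarrow> col (nv e \<sigma>) = s"
proof -
  have all: "(\<forall>t. P t) \<longleftrightarrow> P Red \<and> P Green \<and> P Blue" for P
    using site.exhaust by metis
  show ?thesis unfolding Vor_col[OF assms(2), symmetric] Vor_iff all
    using assms by (cases s) (auto simp: bval_beats)
qed

text \<open>Bisection keeps \<open>P\<close> at the lower end, if it held there initially, and its
  failure just above the upper end. So it finds some level after which \<open>P\<close> stops, or
  the last level.\<close>

lemma level_search:
  assumes n: "fst \<sigma> 7 < 2 ^ k"
    and b: "\<And>\<sigma>' j. eqoff {6, 7, 9, 10} \<sigma> \<sigma>' \<Longrightarrow> fst \<sigma> 6 \<le> j \<Longrightarrow> j \<le> fst \<sigma> 6 + fst \<sigma> 7 \<Longrightarrow>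
      fst \<sigma>' 10 = branch H T (c Red) (fst \<sigma> 8) ! j \<Longrightarrow> bv b \<sigma>' \<longleftrightarrow> P j"
  shows "runs (level_search T b) \<sigma> (\<lambda>\<sigma>'. eqoff {6, 7, 9, 10} \<sigma> \<sigma>' \<and>
     fst \<sigma> 6 \<le> fst \<sigma>' 6 \<and> fst \<sigma>' 6 \<le> fst \<sigma> 6 + fst \<sigma> 7 \<and> (P (fst \<sigma> 6) \<longrightarrow> P (fst \<sigma>' 6)) \<and>
     (fst \<sigma>' 6 < fst \<sigma> 6 + fst \<sigma> 7 \<longrightarrow> \<not> P (Suc (fst \<sigma>' 6))))"
proof -
  let ?l = "fst \<sigma> 6" and ?n = "fst \<sigma> 7"
  let ?I = "\<lambda>\<sigma>'. eqoff {6, 7, 9, 10} \<sigma> \<sigma>' \<and> ?l \<le> fst \<sigma>' 6 \<and> fst \<sigma>' 6 + fst \<sigma>' 7 \<le> ?l + ?n \<and>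
    (P ?l \<longrightarrow> P (fst \<sigma>' 6)) \<and> (fst \<sigma>' 6 + fst \<sigma>' 7 < ?l + ?n \<longrightarrow> \<not> P (Suc (fst \<sigma>' 6 + fst \<sigma>' 7)))"
  have "runs (level_search T b) \<sigma> (\<lambda>\<sigma>'. ?I \<sigma>' \<and> \<not> bv (bpos (R 7)) \<sigma>')"
    unfolding level_search_def
  proof (rule runs_while[where m = "\<lambda>\<sigma>'. fst \<sigma>' 7"])
    show "?I \<sigma>" by (simp add: eqoff_def)
    show "fst \<sigma> 7 < 2 ^ k" by (rule n)
    fix \<tau> assume I: "?I \<tau>" and pos: "bv (bpos (R 7)) \<tau>"
    \<comment> \<open>Rounding up makes the probed level a new one, and both remaining lengths,
      \<open>?N - d\<close> and \<open>d - 1\<close>, are at most half of \<open>?N\<close>.\<close>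
    define d where "d = Suc (fst \<tau> 7) div 2"
    let ?L = "fst \<tau> 6" and ?N = "fst \<tau> 7" and ?x = "branch H T (c Red) (fst \<sigma> 8) ! (fst \<tau> 6 + d)"
    have d: "0 < d" "d \<le> ?N" "?N - d \<le> ?N div 2" "d - 1 \<le> ?N div 2" "?L + d + (?N - d) = ?L + ?N" "Suc (?L + (d - 1)) = ?L + d"
      using pos by (auto simp: d_def)
    have 8: "fst \<tau> 8 = fst \<sigma> 8" using I by (simp add: eqoff_def)
    have eo: "eqoff {6, 7, 9, 10} \<sigma> \<tau>" using I by blast
    let ?\<tau> = "((fst \<tau>)(9 := d, 10 := ?x), snd \<tau>)"
    have e: "eqoff {6, 7, 9, 10} \<sigma> ?\<tau>" using eo by (auto simp: eqoff_def)
    have j: "fst \<sigma> 6 \<le> ?L + d" "?L + d \<le> fst \<sigma> 6 + fst \<sigma> 7" using I d by linarith+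
    have j': "?L + d - Suc 0 \<le> fst \<sigma> 6 + fst \<sigma> 7" using j by linarith
    have bP: "bv b ?\<tau> \<longleftrightarrow> P (?L + d)" by (rule b[OF e j]) simp
    have t1: "?I ((fst ?\<tau>)(6 := ?L + d, 7 := ?N - d), snd \<tau>)" if "P (?L + d)"
    proof (intro conjI impI)
      show "eqoff {6, 7, 9, 10} \<sigma> ((fst ?\<tau>)(6 := ?L + d, 7 := ?N - d), snd \<tau>)" using eo by (auto simp: eqoff_def)
    qed (use I j that d in simp_all)
    have t2: "?I ((fst ?\<tau>)(7 := d - 1), snd \<tau>)" if "\<not> P (?L + d)"
    proof (intro conjI impI)
      show "eqoff {6, 7, 9, 10} \<sigma> ((fst ?\<tau>)(7 := d - 1), snd \<tau>)" using eo by (auto simp: eqoff_def)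
    qed (use I j j' that d in simp_all)
    have "runs (Seq (NAssign 9 (NHalf (NAdd (R 7) (NConst 1))))
     (Seq (NAssign 10 (LevelAncestor T Red (R 8) (NAdd (R 6) (R 9))))
     (If b (Seq (NAssign 6 (NAdd (R 6) (R 9))) (NAssign 7 (NSub (R 7) (R 9))))
           (NAssign 7 (NSub (R 9) (NConst 1)))))) \<tau> (\<lambda>\<sigma>'. ?I \<sigma>' \<and> fst \<sigma>' 7 \<le> ?N div 2)"
    proof (intro runs_seq runs_assign runs_if, goal_cases)
      case 1
      then show ?case using t1 bP d(3) by (simp add: 8 flip: d_def)
    next
      case 2
      then show ?case using t2 bP d(4) by (simp add: 8 flip: d_def)
    qed
    then show "0 < ?N \<and> runs (Seq (NAssign 9 (NHalf (NAdd (R 7) (NConst 1))))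
     (Seq (NAssign 10 (LevelAncestor T Red (R 8) (NAdd (R 6) (R 9))))
     (If b (Seq (NAssign 6 (NAdd (R 6) (R 9))) (NAssign 7 (NSub (R 7) (R 9))))
           (NAssign 7 (NSub (R 9) (NConst 1)))))) \<tau> (\<lambda>\<sigma>'. ?I \<sigma>' \<and> fst \<sigma>' 7 \<le> ?N div 2)"
      using d by simp
  qed
  then show ?thesis by (rule runs_mono) auto
qed

end


section \<open>Runs of the test for one subtree, and the anchor\<close>

declare cell_test.simps [simp del]

context voronoi_run
begin

lemma eqoff_reg: "eqoff W \<sigma> \<tau> \<Longrightarrow> i \<notin> W \<Longrightarrow> fst \<tau> i = fst \<sigma> i"
  by (simp add: eqoff_def)

lemmas queries = cotree_branch primal_branch cotree_ancestor C.last_rpath R.T.last_rpath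
  cotree_size cotree_preorder rank_def[symmetric] C.lca_def[symmetric] cotree_path primal_path
  C.length_rpath R.T.length_rpath fs_eq[symmetric]

text \<open>Without a trichromatic face the red cell may be empty, and then not even the root passes
  the test; hence redness is promised only under \<open>col (S Red) = Red\<close>.\<close>

lemma run_frontier:
  assumes "good \<sigma>" "fst \<sigma> 8 = v" "v \<in> V"
  shows "runs frontier \<sigma> (\<lambda>\<sigma>'. eqoff {6, 7, 9, 10} \<sigma> \<sigma>' \<and> fst \<sigma>' 6 \<le> R.depth v \<and>
    (col (S Red) = Red \<longrightarrow> col (R.T.br v ! fst \<sigma>' 6) = Red) \<and>
    (fst \<sigma>' 6 < R.depth v \<longrightarrow> col (R.T.br v ! Suc (fst \<sigma>' 6)) \<noteq> Red))"
proof -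
  let ?\<sigma> = "((fst \<sigma>)(6 := 0, 7 := R.depth v), snd \<sigma>)"
  have g: "good ?\<sigma>" using assms by (simp add: good_def)
  have "runs (level_search Primal (cell_test Red (R 10))) ?\<sigma> (\<lambda>\<sigma>'. eqoff {6, 7, 9, 10} ?\<sigma> \<sigma>' \<and>
     fst ?\<sigma> 6 \<le> fst \<sigma>' 6 \<and> fst \<sigma>' 6 \<le> fst ?\<sigma> 6 + fst ?\<sigma> 7 \<and> (col (R.T.br v ! (fst ?\<sigma> 6)) = Red \<longrightarrow> col (R.T.br v ! (fst \<sigma>' 6)) = Red) \<and>
     (fst \<sigma>' 6 < fst ?\<sigma> 6 + fst ?\<sigma> 7 \<longrightarrow> \<not> col (R.T.br v ! (Suc (fst \<sigma>' 6))) = Red))"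
  proof (rule level_search)
    show "fst ?\<sigma> 7 < 2 ^ k" using depth_less[OF assms(3)] k by simp
    fix \<sigma>' j assume e: "eqoff {6, 7, 9, 10} ?\<sigma> \<sigma>'" and j: "j \<le> fst ?\<sigma> 6 + fst ?\<sigma> 7"
      and x: "fst \<sigma>' 10 = branch H Primal (c Red) (fst ?\<sigma> 8) ! j"
    have x': "fst \<sigma>' 10 = R.T.br v ! j" using x assms by (simp add: queries)
    then have "fst \<sigma>' 10 \<in> V" using R.T.br_nth(1)[OF assms(3)] j by simp
    then show "bv (cell_test Red (R 10)) \<sigma>' \<longleftrightarrow> col (R.T.br v ! j) = Red"
      using bval_cell[of \<sigma>' "R 10" Red] good_eqoff[OF g e] x' by simp
  qed
  then show ?thesis unfolding frontier_def
    apply (intro runs_seq runs_assign)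
    apply (simp add: assms queries)
    apply (erule runs_mono)
    by (auto simp: eqoff_def R.T.br_def)
qed

lemma run_count_crossings:
  assumes "good \<sigma>" "fst \<sigma> 8 = v" "v \<in> V"
  shows "runs count_crossings \<sigma> (\<lambda>\<sigma>'. eqoff {6, 7, 9, 10, 11} \<sigma> \<sigma>' \<and>
    (col (S Red) = Red \<longrightarrow> int (fst \<sigma>' 11) = crossings v))"
    (is "runs _ _ ?Q")
proof -
  have "runs (If (BAnd (NLess (R 6) (Depth Primal Red (R 8)))
               (cell_test Green (LevelAncestor Primal Red (R 8) (NAdd (R 6) (NConst 1)))))
        (NAssign 11 (NConst 1)) (NAssign 11 (NConst 0))) \<tau> ?Q"
    if \<tau>: "eqoff {6, 7, 9, 10} \<sigma> \<tau>" "fst \<tau> 6 \<le> R.depth v"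
      "col (S Red) = Red \<longrightarrow> col (R.T.br v ! fst \<tau> 6) = Red"
      "fst \<tau> 6 < R.depth v \<longrightarrow> col (R.T.br v ! Suc (fst \<tau> 6)) \<noteq> Red" for \<tau>
  proof -
    have g: "good \<tau>" using good_eqoff[OF assms(1) \<tau>(1)] by simp
    have 8: "fst \<tau> 8 = v" using eqoff_reg[OF \<tau>(1)] assms by simp
    have e: "eqoff {6, 7, 9, 10, 11} \<sigma> ((fst \<tau>)(11 := x), snd \<tau>)" for x
      using \<tau>(1) by (auto simp: eqoff_def)
    let ?l = "fst \<tau> 6" and ?e = "LevelAncestor Primal Red (R 8) (NAdd (R 6) (NConst 1))"
    show ?thesis
    proof (cases "?l < R.depth v")
      case True
      let ?x = "R.T.br v ! Suc ?l"
      have x: "?x \<in> V" "?x \<noteq> S Red" "st (R.spd ?x) = R.T.br v ! ?l" "R.T.anc ?x v"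
        using R.T.br_nth(1)[OF assms(3)] R.T.br_parent[OF assms(3)] R.T.anc_br_nth[OF assms(3)] True by auto
      have nx: "nv ?e \<tau> = ?x" using 8 assms by (simp add: queries)
      have b: "bv (cell_test Green ?e) \<tau> \<longleftrightarrow> col ?x = Green"
        using bval_cell[OF g, of ?e Green] nx x by simp
      have cr: "crossings v = of_bool (col ?x = Green)" if "col (S Red) = Red"
        using crossings_frontier[of ?x v] x \<tau> True that assms by simp
      show ?thesis
        apply (intro runs_if runs_assign)
        using b 8 True cr e assms by (auto simp: queries)
    next
      case False
      then have l: "?l = R.depth v" using \<tau> by simp
      have cr: "crossings v = 0" if "col (S Red) = Red"
        using crossings_red[OF assms(3)] \<tau>(3) that R.T.br_nth_dp[OF assms(3)] l by simp
      show ?thesis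
        apply (intro runs_if runs_assign)
        using 8 False cr e assms by (auto simp: queries)
    qed
  qed
  then show ?thesis unfolding count_crossings_def
    by (intro runs_seq runs_mono[OF run_frontier[OF assms]]) auto
qed

abbreviation "Wdec \<equiv> {6, 7, 8, 9, 10, 11, 13, 14, 15, 16, 27, 28}"

text \<open>Besides the decision, register 15 keeps the crossings at the end of the dart. For a
  child of \<open>h\<close> this end is the boundary vertex to which
  \<open>before_iff_nonred\<close> applies.\<close>

lemma run_decide:
  assumes "good \<sigma>" "fst \<sigma> 12 = y" "y \<in> faces H" "y \<noteq> h"
  shows "runs decide \<sigma> (\<lambda>\<sigma>'. eqoff Wdec \<sigma> \<sigma>' \<and> fst \<sigma>' 13 = tw (qd y) \<and>
    (\<forall>f. tricol f \<longrightarrow> (0 < fst \<sigma>' 16 \<longleftrightarrow> f \<in> C.sub y) \<and> int (fst \<sigma>' 15) = crossings (en (tw (qd y)))))"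
proof -
  let ?z = "tw (qd y)"
  have z: "?z \<in> DD" using qd assms tw_DD by simp
  have zV: "st ?z \<in> V" "en ?z \<in> V" using z st_V en_V by auto
  let ?A = "col (st ?z) = Red \<and> col (en ?z) = Green" and ?B = "col (st ?z) = Green \<and> col (en ?z) = Red"
  have key: "f \<in> C.sub y \<longleftrightarrow> a + of_bool ?A \<noteq> b + of_bool ?B"
    if "tricol f" "int a = crossings (st ?z)" "int b = crossings (en ?z)" for f a b
  proof -
    have "f \<in> C.sub y \<longleftrightarrow> int a + chi ?z \<noteq> int b" using in_sub_iff[OF that(1) assms(3,4)] that by simp
    also have "\<dots> \<longleftrightarrow> int (a + of_bool ?A) \<noteq> int (b + of_bool ?B)" by (auto simp: chi_def)
    finally show ?thesis by (simp only: of_nat_eq_iff)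
  qed
  have root: "col (S Red) = Red" if "tricol f" for f using tricol_site_col that by blast
  show ?thesis unfolding decide_def
    apply (intro runs_seq runs_assign)
    apply (rule runs_mono[OF run_count_crossings[where v = "st ?z"]])
    subgoal using assms by (simp add: good_def)
    subgoal using assms by (simp add: queries)
    subgoal by (rule zV)
    subgoal premises p for \<sigma>2
      apply (intro runs_seq runs_assign)
      apply (rule runs_mono[OF run_count_crossings[where v = "en ?z"]])
      subgoal using assms p by (simp add: good_def eqoff_def)
      subgoal using assms p by (simp add: queries eqoff_def)
      subgoal by (rule zV)
      subgoal premises q for \<sigma>3
      proof -
        have g: "good \<sigma>3" using assms p q by (simp add: good_def eqoff_def)
        have 13: "fst \<sigma>3 13 = ?z" using assms p q by (simp add: queries eqoff_def)
        have 14: "col (S Red) = Red \<Longrightarrow> int (fst \<sigma>3 14) = crossings (st ?z)" using p q by (simp add: eqoff_def)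
        have 11: "col (S Red) = Red \<Longrightarrow> int (fst \<sigma>3 11) = crossings (en ?z)" using q by simp
        have e: "eqoff Wdec \<sigma> \<sigma>3" using p q by (auto simp: eqoff_def)
        let ?\<tau> = "((fst \<sigma>3)(15 := fst \<sigma>3 11, 27 := fst \<sigma>3 14, 28 := fst \<sigma>3 11), snd \<sigma>3)"
        have b: "bv (cell_test s (Tail (R 13))) \<tau> \<longleftrightarrow> col (st ?z) = s" "bv (cell_test s (Head (R 13))) \<tau> \<longleftrightarrow> col (en ?z) = s"
          if "good \<tau>" "fst \<tau> 13 = ?z" for s \<tau>
          using bval_cell[OF that(1), of "Tail (R 13)"] bval_cell[OF that(1), of "Head (R 13)"] that zV by auto
        have r1: "runs (If (BAnd (cell_test Red (Tail (R 13))) (cell_test Green (Head (R 13))))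
            (NAssign 27 (NAdd (R 27) (NConst 1))) Skip) \<tau>
          (\<lambda>\<tau>. \<tau> = ((fst \<sigma>3)(15 := fst \<sigma>3 11, 27 := fst \<sigma>3 14 + of_bool ?A, 28 := fst \<sigma>3 11), snd \<sigma>3))"
          if "\<tau> = ?\<tau>" for \<tau>
          unfolding that apply (intro runs_if runs_assign runs_skip)
          using b[of ?\<tau>] g 13 by (auto simp: good_def fun_eq_iff)
        let ?\<tau>' = "((fst \<sigma>3)(15 := fst \<sigma>3 11, 27 := fst \<sigma>3 14 + of_bool ?A, 28 := fst \<sigma>3 11), snd \<sigma>3)"
        have r2: "runs (If (BAnd (cell_test Green (Tail (R 13))) (cell_test Red (Head (R 13))))
            (NAssign 28 (NAdd (R 28) (NConst 1))) Skip) \<tau>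
          (\<lambda>\<tau>. \<tau> = ((fst \<sigma>3)(15 := fst \<sigma>3 11, 27 := fst \<sigma>3 14 + of_bool ?A, 28 := fst \<sigma>3 11 + of_bool ?B), snd \<sigma>3))"
          if "\<tau> = ?\<tau>'" for \<tau>
          unfolding that apply (intro runs_if runs_assign runs_skip)
          using b[of ?\<tau>'] g 13 by (auto simp: good_def fun_eq_iff)
        let ?\<rho> = "((fst \<sigma>3)(15 := fst \<sigma>3 11, 27 := fst \<sigma>3 14 + of_bool ?A, 28 := fst \<sigma>3 11 + of_bool ?B), snd \<sigma>3)"
        have fin: "runs (If (beq (R 27) (R 28)) (NAssign 16 (NConst 0)) (NAssign 16 (NConst 1))) ?\<rho>
          (\<lambda>\<sigma>'. eqoff Wdec \<sigma> \<sigma>' \<and> fst \<sigma>' 13 = ?z \<and>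
            (\<forall>f. tricol f \<longrightarrow> (0 < fst \<sigma>' 16 \<longleftrightarrow> f \<in> C.sub y) \<and> int (fst \<sigma>' 15) = crossings (en ?z)))"
        proof -
          have "eqoff Wdec \<sigma> ((fst ?\<rho>)(16 := x), snd ?\<rho>)" for x using e by (auto simp: eqoff_def)
          moreover have "f \<in> C.sub y \<longleftrightarrow> fst ?\<rho> 27 \<noteq> fst ?\<rho> 28" if "tricol f" for f
            using key[OF that 14[OF root[OF that]] 11[OF root[OF that]]] by simp
          ultimately show ?thesis using 13 11 root
            by (intro runs_if runs_assign) (auto simp del: of_bool_eq_iff)
        qed
        show ?thesis
          apply (intro runs_seq runs_assign)
          apply (rule runs_mono[OF r1], simp)
          apply (intro runs_seq)
          apply (rule runs_mono[OF r2], assumption)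
          apply (erule ssubst, rule fin)
          done
      qed
      done
    done
qed

text \<open>The dart by which the tree path to the green site leaves the red cell is bichromatic, so
  by \<open>bichromatic_not_bridge\<close> one of its two sides is not \<open>h\<close>; its non-red
  end is a corner of either side.\<close>

lemma run_find_anchor:
  assumes "good \<sigma>"
  shows "runs find_anchor \<sigma> (\<lambda>\<sigma>'. eqoff {6, 7, 8, 9, 10, 17, 26} \<sigma> \<sigma>' \<and>
    (\<forall>f. tricol f \<longrightarrow> fst \<sigma>' 17 \<noteq> h \<and> (\<exists>a\<in>DD. face H a = fst \<sigma>' 17 \<and> col (st a) \<noteq> Red)))"
    (is "runs _ _ ?Q")
proof -
  have "runs (Seq (NAssign 26 (Parent Primal Red (LevelAncestor Primal Red (R 8) (NAdd (R 6) (NConst 1)))))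
     (Seq (NAssign 17 (Face (R 26)))
     (If (beq (R 17) (Face (R 0))) (NAssign 17 (Face (Twin (R 26)))) Skip))) \<tau> ?Q"
    if \<tau>: "eqoff {6, 7, 8, 9, 10} \<sigma> \<tau>" "fst \<tau> 8 = S Green" "fst \<tau> 6 \<le> R.depth (S Green)"
      "col (S Red) = Red \<longrightarrow> col (R.T.br (S Green) ! fst \<tau> 6) = Red"
      "fst \<tau> 6 < R.depth (S Green) \<longrightarrow> col (R.T.br (S Green) ! Suc (fst \<tau> 6)) \<noteq> Red" for \<tau>
  proof -
    let ?v = "S Green" and ?l = "fst \<tau> 6"
    let ?w = "nv (Parent Primal Red (LevelAncestor Primal Red (R 8) (NAdd (R 6) (NConst 1)))) \<tau>"
    have 0: "face H (fst \<tau> 0) = h" using \<tau>(1) assms face_c by (simp add: eqoff_def good_def)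
    have e: "eqoff {6, 7, 8, 9, 10, 17, 26} \<sigma> ((fst \<tau>)(26 := x, 17 := x'), snd \<tau>)" for x x'
      using \<tau>(1) by (auto simp: eqoff_def)
    have w: "?w \<in> DD \<and> col (st ?w) \<noteq> Red \<and> ?w \<in> BB" if f: "tricol f" for f
    proof -
      have sc: "col (S s) = s" for s using tricol_site_col[OF f] .
      have "?l \<noteq> R.depth ?v"
        using \<tau>(4) sc R.T.br_nth_dp[OF S_V, of Green] by (metis site.distinct(1))
      then have l: "Suc ?l \<le> R.depth ?v" using \<tau>(3) by simp
      let ?x = "R.T.br ?v ! Suc ?l"
      have x: "?x \<in> V" "?x \<noteq> S Red" "st (R.spd ?x) = R.T.br ?v ! ?l"
        using R.T.br_nth(1)[OF S_V l] R.T.br_parent[OF S_V l] by auto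
      have "?w = tw (R.spd ?x)" using \<tau>(2) x S_V by (simp add: queries)
      moreover have "R.spd ?x \<in> DD" "en (R.spd ?x) = ?x" using R.spd_DD R.sp_step x by auto
      moreover have "col ?x \<noteq> Red" "col (R.T.br ?v ! ?l) = Red" using \<tau>(4,5) l sc by auto
      ultimately show ?thesis using x by (auto simp: BB_def tw_DD st_tw en_tw)
    qed
    show ?thesis
    proof (intro runs_seq runs_assign runs_if runs_skip, goal_cases)
      case 1
      then have fh: "face H ?w = h" using 0 by auto
      have "face H (tw ?w) \<noteq> h \<and> (\<exists>a\<in>DD. face H a = face H (tw ?w) \<and> col (st a) \<noteq> Red)" if f: "tricol f" for f
      proof -
        have n: "face H (tw ?w) \<noteq> h" using bichromatic_not_bridge[OF f, of ?w] w[OF f] fh by simp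
        \<comment> \<open>The next dart around the non-red end lies beside the face across the
          edge.\<close>
        have "rot H ?w \<in> DD" "face H (rot H ?w) = face H (tw ?w)" "st (rot H ?w) = st ?w"
          using w[OF f] rot_DD face_rot st_rot by auto
        then show ?thesis using n w[OF f] by metis
      qed
      then show ?case using e by simp
    next
      case 2
      then have fh: "face H ?w \<noteq> h" using 0 by auto
      then show ?case using e w by auto
    qed
  qed
  note rest = this
  let ?\<sigma> = "((fst \<sigma>)(8 := S Green), snd \<sigma>)"
  have g: "good ?\<sigma>" using assms by (simp add: good_def)
  have 1: "nv (Tail (R 1)) \<sigma> = S Green" using assms st_c by (simp add: good_def)
  show ?thesis unfolding find_anchor_def
    apply (intro runs_seq runs_assign)
    apply (subst 1)
    apply (rule runs_mono[OF run_frontier[OF g, where v = "S Green"]])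
    subgoal by simp
    subgoal by (rule S_V)
    subgoal for \<sigma>2
      apply (rule rest)
      by (auto simp: eqoff_def)
    done
qed


section \<open>The search among the children of the hole\<close>

lemma faces_bound: "card (faces H) < 2 ^ k"
  using card_faces k by simp

lemma pos_root: "C.pos y = 0 \<longleftrightarrow> y = h" if "y \<in> faces H"
  using C.nth_pos[OF that] C.nth_pos[OF C.rt_V] C.pos_rt by metis

lemma child_of_position:
  assumes m: "1 \<le> m" "m < card (faces H)"
  defines "y \<equiv> C.br (C.pre ! m) ! Suc 0"
  obtains i where "C.pre ! m \<in> faces H" "y \<in> faces H" "y \<noteq> h" "i < C.root_deg" "qd y = rd i" "rd i \<in> DD - TD"
    "C.pos y \<le> m" "m < C.pos y + card (C.sub y)" "C.pos y + card (C.sub y) \<le> card (faces H)"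
proof -
  let ?x = "C.pre ! m"
  have x: "?x \<in> faces H" "C.pos ?x = m" using C.nth_V C.pos_nth m by auto
  then have "?x \<noteq> h" using C.pos_rt m by auto
  then have d: "Suc 0 \<le> dq ?x" using C.dp_0[OF x(1)] by simp
  have y: "y \<in> faces H" "dq y = Suc 0" "C.anc y ?x"
    unfolding y_def using C.br_nth[OF x(1) d] C.anc_br_nth[OF x(1) d] by auto
  have yh: "y \<noteq> h" using y C.dp_rt by auto
  have par: "face H (qd y) = h" using C.br_parent(2)[OF x(1) d] by (simp add: y_def C.br_def)
  have "qd y \<in> {a \<in> DD. face H a = h}" using qd[OF y(1) yh] par by simp
  then obtain i where i: "i < C.root_deg" "qd y = rd i"
    using C.root_dart_enum(2) by (metis (no_types, lifting) imageE lessThan_iff)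
  have "?x \<in> C.sub y" using x y by (simp add: C.sub_def)
  then have "C.pos y \<le> m" "m < C.pos y + card (C.sub y)" using C.sub_pos(2)[OF y(1) x(1)] x by auto
  then show ?thesis using that[OF x(1) y(1) yh i] C.sub_pos(1)[OF y(1)] qd[OF y(1) yh] i by simp
qed

abbreviation "Wchild \<equiv> {3, 6, 7, 8, 9, 10, 11, 12, 13, 14, 15, 16, 18, 19, 27, 28}"

lemma run_child_search:
  assumes g: "good \<sigma>" and F: "1 < card (faces H)"
    and anchor: "\<And>f. tricol f \<Longrightarrow> fst \<sigma> 17 \<noteq> h \<and> (\<exists>a\<in>DD. face H a = fst \<sigma> 17 \<and> col (st a) \<noteq> Red)"
  shows "runs (child_search b) \<sigma> (\<lambda>\<sigma>'. eqoff Wchild \<sigma> \<sigma>' \<and> fst \<sigma>' 3 \<in> faces H \<and> fst \<sigma>' 3 \<noteq> h \<and>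
    (\<forall>f. tricol f \<and> b = of_bool forward \<longrightarrow> f \<in> C.sub (fst \<sigma>' 3)))"
proof -
  let ?T = "\<lambda>f. tricol f \<and> b = of_bool forward"
  \<comment> \<open>A nonempty interval contains the position of the face, and an empty one
    certifies that the face lies below register 3. Nothing is claimed about the face if the guess
    \<open>b\<close> is wrong.\<close>
  let ?I = "\<lambda>\<tau>. eqoff Wchild \<sigma> \<tau> \<and> 1 \<le> fst \<tau> 18 \<and> fst \<tau> 19 \<le> card (faces H) \<and> fst \<tau> 3 \<in> faces H \<and> fst \<tau> 3 \<noteq> h \<and>
    (\<forall>f. ?T f \<longrightarrow> fst \<tau> 18 \<le> C.pos f \<and> C.pos f < fst \<tau> 19 \<or> fst \<tau> 19 \<le> fst \<tau> 18 \<and> f \<in> C.sub (fst \<tau> 3))"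
  let ?test = "bor (BAnd (cell_test Red (Head (R 13))) (NLess (rank_of (R 17)) (rank_of (R 12))))
                (BAnd (BNot (cell_test Red (Head (R 13)))) (BNot (beq (R 15) (NConst b))))"
  let ?tail = "If (bpos (R 16)) (NAssign 19 (R 18)) (If ?test (NAssign 19 (rank_of (R 12)))
     (NAssign 18 (NAdd (rank_of (R 12)) (size_of (R 12)))))"
  let ?body = "Seq (NAssign 12 (LevelAncestor Cotree Red (Select Cotree Red (NHalf (NAdd (R 18) (R 19)))) (NConst 1)))
       (Seq decide (Seq (NAssign 3 (R 12)) ?tail))"
  have tail: "runs ?tail \<rho> (\<lambda>\<sigma>'. ?I \<sigma>' \<and> fst \<sigma>' 19 - fst \<sigma>' 18 \<le> (fst \<tau> 19 - fst \<tau> 18) div 2)"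
    if I: "?I \<tau>" and lt: "fst \<tau> 18 < fst \<tau> 19" and m: "m = (fst \<tau> 18 + fst \<tau> 19) div 2"
      and y: "y = C.br (C.pre ! m) ! Suc 0" and e: "eqoff Wchild \<sigma> \<rho>"
      and r: "fst \<rho> 18 = fst \<tau> 18" "fst \<rho> 19 = fst \<tau> 19" "fst \<rho> 12 = y" "fst \<rho> 3 = y" "fst \<rho> 13 = tw (qd y)"
      and dec: "\<And>f. tricol f \<Longrightarrow> (0 < fst \<rho> 16 \<longleftrightarrow> f \<in> C.sub y) \<and> int (fst \<rho> 15) = crossings (en (tw (qd y)))"
    for \<tau> \<rho> m y
  proof -
    have m': "1 \<le> m" "m < card (faces H)" "fst \<tau> 18 \<le> m" "m < fst \<tau> 19" using I lt m by auto
    obtain i where i: "y \<in> faces H" "y \<noteq> h" "i < C.root_deg" "qd y = rd i" "rd i \<in> DD - TD"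
      "C.pos y \<le> m" "m < C.pos y + card (C.sub y)" "C.pos y + card (C.sub y) \<le> card (faces H)"
      using child_of_position[OF m'(1,2)] y by metis
    have gr: "good \<rho>" using good_eqoff[OF g e] by simp
    have z: "en (tw (qd y)) = st (rd i)" "st (rd i) \<in> V" "face H (tw (rd i)) = y"
      using i en_tw st_V C.dst_pd[OF i(1,2)] by auto
    have cell: "bv (cell_test Red (Head (R 13))) \<rho> \<longleftrightarrow> col (st (rd i)) = Red"
      using bval_cell[OF gr, of "Head (R 13)" Red] r z by simp
    have bp: "f \<in> C.before i \<longleftrightarrow> C.pos f < C.pos y" if "f \<in> faces H" "f \<noteq> h" for f
      using C.before_pos[OF i(3,5) that] z by simp
    have 17: "fst \<rho> 17 = fst \<sigma> 17" using eqoff_reg[OF e] by simp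
    \<comment> \<open>At a red boundary vertex the anchor stands in for \<open>f\<close>, because
      \<open>f\<close> has corners of all colours and hence one of the colour of the anchor's
      non-red corner. Elsewhere the crossings are compared with the guess.\<close>
    have test: "bv ?test \<rho> \<longleftrightarrow> C.pos f < C.pos y" if f: "?T f" for f
    proof -
      have fF: "f \<in> faces H" "f \<noteq> h" using f by (auto simp: trichromatic_def)
      show ?thesis
      proof (cases "col (st (rd i)) = Red")
        case True
        obtain a where a: "a \<in> DD" "face H a = fst \<sigma> 17" "col (st a) \<noteq> Red" "fst \<sigma> 17 \<noteq> h" using anchor f by blast
        obtain a' where a': "a' \<in> DD" "face H a' = f" "col (st a') = col (st a)" using tricol_dart f by metis
        have "fst \<sigma> 17 \<in> faces H" using a face_faces by metis
        then have "bv ?test \<rho> \<longleftrightarrow> fst \<sigma> 17 \<in> C.before i" using True cell bp a r 17 by (simp add: queries)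
        moreover have "col (S Red) = Red" using tricol_site_col f by blast
        ultimately have "bv ?test \<rho> \<longleftrightarrow> f \<in> C.before i"
          using before_iff_red[OF i(3) True _ a(1) _ a'(1), of "col (st a)"] a a' fF by simp
        then show ?thesis using bp[OF fF] by simp
      next
        case False
        have "bv ?test \<rho> \<longleftrightarrow> fst \<rho> 15 \<noteq> b" using False cell by auto
        also have "\<dots> \<longleftrightarrow> crossings (st (rd i)) \<noteq> of_bool forward" using dec[of f] z(1) f by auto
        also have "\<dots> \<longleftrightarrow> f \<in> C.before i" using before_iff_nonred[OF _ i(3) False] f by blast
        finally show ?thesis using bp[OF fF] by simp
      qed
    qed
    have T: "C.pos f < C.pos y \<or> f \<in> C.sub y \<or> C.pos y + card (C.sub y) \<le> C.pos f"
      "f \<in> C.sub y \<Longrightarrow> \<not> C.pos f < C.pos y" "fst \<tau> 18 \<le> C.pos f" "C.pos f < fst \<tau> 19" if "?T f" for f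
    proof -
      have fF: "f \<in> faces H" using that by (auto simp: trichromatic_def)
      show "C.pos f < C.pos y \<or> f \<in> C.sub y \<or> C.pos y + card (C.sub y) \<le> C.pos f"
        "f \<in> C.sub y \<Longrightarrow> \<not> C.pos f < C.pos y" using C.sub_pos(2)[OF i(1) fF] by auto
      show "fst \<tau> 18 \<le> C.pos f" "C.pos f < fst \<tau> 19" using I lt that by auto
    qed
    have e': "eqoff Wchild \<sigma> ((fst \<rho>)(18 := x), snd \<rho>)" "eqoff Wchild \<sigma> ((fst \<rho>)(19 := x), snd \<rho>)" for x
      using e by (auto simp: eqoff_def)
    show ?thesis
    proof (intro runs_if runs_assign, goal_cases)
      case 1
      then show ?case using e'(2) dec i I r m' by (auto simp: fun_upd_def)
    next
      case 2
      have "C.pos y \<le> card (faces H)" using i by simp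
      moreover have "C.pos f < C.pos y" if "?T f" for f using test[OF that] 2(2) by blast
      ultimately show ?case using e'(2) i I r m' m T by (auto simp: queries)
    next
      case 3
      have "C.pos y + card (C.sub y) \<le> C.pos f" if f: "?T f" for f
        using test[OF f] 3(2) T(1)[OF f] dec[of f] f 3(1) by auto
      moreover have "1 \<le> C.pos y + card (C.sub y)" using i(7) by simp
      \<comment> \<open>The probed position \<open>m\<close> lies in the discarded subtree, so what
        remains is strictly above \<open>m\<close>.\<close>
      moreover have "fst \<tau> 19 - (C.pos y + card (C.sub y)) \<le> (fst \<tau> 19 - fst \<tau> 18) div 2"
        using i(7) m lt by linarith
      ultimately show ?case using e'(1) i I r T by (auto simp: queries)
    qed
  qed
  have loop: "runs (While (NLess (R 18) (R 19)) ?body) \<tau> (\<lambda>\<sigma>'. ?I \<sigma>' \<and> \<not> bv (NLess (R 18) (R 19)) \<sigma>')" if "?I \<tau>" for \<tau>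
  proof (rule runs_while[where m = "\<lambda>\<tau>. fst \<tau> 19 - fst \<tau> 18"])
    show "?I \<tau>" by (rule that)
    show "fst \<tau> 19 - fst \<tau> 18 < 2 ^ k" using that faces_bound by linarith
    fix \<tau> assume I: "?I \<tau>" and "bv (NLess (R 18) (R 19)) \<tau>"
    then have lt: "fst \<tau> 18 < fst \<tau> 19" by simp
    define m where "m = (fst \<tau> 18 + fst \<tau> 19) div 2"
    define y where "y = C.br (C.pre ! m) ! Suc 0"
    have m': "1 \<le> m" "m < card (faces H)" using I lt m_def by auto
    have y: "C.pre ! m \<in> faces H" "y \<in> faces H" "y \<noteq> h" using child_of_position[OF m'] unfolding y_def by metis+
    have v: "nv (LevelAncestor Cotree Red (Select Cotree Red (NHalf (NAdd (R 18) (R 19)))) (NConst 1)) \<tau> = y"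
      using y(1) by (simp add: queries y_def flip: m_def)
    have gt: "good ((fst \<tau>)(12 := y), snd \<tau>)" using good_eqoff[OF g, of Wchild \<tau>] I by (simp add: good_def)
    have "runs ?body \<tau> (\<lambda>\<sigma>'. ?I \<sigma>' \<and> fst \<sigma>' 19 - fst \<sigma>' 18 \<le> (fst \<tau> 19 - fst \<tau> 18) div 2)"
      apply (intro runs_seq runs_assign)
      apply (subst v)
      apply (rule runs_mono[OF run_decide[OF gt _ y(2,3)]])
      subgoal by simp
      subgoal premises p for \<rho>
        apply (intro runs_seq runs_assign)
        apply (rule tail[OF I lt m_def y_def])
        subgoal using I p by (auto simp: eqoff_def)
        using p by (simp_all add: eqoff_def)
      done
    then show "0 < fst \<tau> 19 - fst \<tau> 18 \<and> runs ?body \<tau> (\<lambda>\<sigma>'. ?I \<sigma>' \<and> fst \<sigma>' 19 - fst \<sigma>' 18 \<le> (fst \<tau> 19 - fst \<tau> 18) div 2)"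
      using lt by simp
  qed
  obtain "C.pre ! 1 \<in> faces H" "C.br (C.pre ! 1) ! Suc 0 \<in> faces H" "C.br (C.pre ! 1) ! Suc 0 \<noteq> h"
    using child_of_position[of 1] F by auto
  note y1 = this
  have 0: "face H (fst \<sigma> 0) = h" using g face_c by (simp add: good_def)
  \<comment> \<open>Position \<open>0\<close> is that of \<open>h\<close>, which is why the interval
    starts at \<open>1\<close>.\<close>
  have "1 \<le> C.pos f \<and> C.pos f < card (faces H)" if "tricol f" for f
    using that pos_root[of f] C.pos_less[of f] by (auto simp: trichromatic_def Suc_le_eq)
  then have init: "?I ((fst \<sigma>)(18 := 1, 19 := card (faces H), 3 := C.br (C.pre ! 1) ! Suc 0), snd \<sigma>)"
    using y1 by (auto simp: eqoff_def)
  show ?thesis unfolding child_search_def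
    apply (intro runs_seq runs_assign)
    apply (rule runs_mono[OF loop])
    subgoal using init y1 0 by (simp add: queries C.sub_rt)
    subgoal by auto
    done
qed

section \<open>The search in shrinking regions\<close>

lemma run_check_face:
  assumes g: "good \<sigma>" and t: "fst \<sigma> 25 = t" "t \<in> faces H" "t \<noteq> h"
  shows "runs check_face \<sigma> (\<lambda>\<sigma>'. eqoff {20, 21, 26} \<sigma> \<sigma>' \<and> fst \<sigma>' 26 = tw (qd t) \<and>
    (if tricol t then fst \<sigma>' 20 = 1 \<and> fst \<sigma>' 21 = t else fst \<sigma>' 20 = fst \<sigma> 20 \<and> fst \<sigma>' 21 = fst \<sigma> 21))"
    (is "runs _ _ ?Q")
proof -
  define z0 where "z0 = tw (qd t)"
  have z: "z0 \<in> DD" "face H z0 = t" using qd t tw_DD C.dst_pd[OF t(2,3)] by (auto simp: z0_def)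
  then have "z0 \<in> face_darts H t" by (simp add: face_darts_def)
  note tri = tricol_iff[OF t(2,3) this]
  have zs: "st z0 \<in> V" "st (fs z0) \<in> V" "st (fs (fs z0)) \<in> V" using z fs_DD st_V by auto
  let ?\<tau> = "((fst \<sigma>)(26 := z0), snd \<sigma>)"
  have g': "good ?\<tau>" using g by (simp add: good_def)
  have corner: "bv (some_corner s) ?\<tau> \<longleftrightarrow> s \<in> {col (st z0), col (st (fs z0)), col (st (fs (fs z0)))}" for s
    using bval_cell[OF g', of "Tail (R 26)" s] bval_cell[OF g', of "Tail (fsx (R 26))" s]
      bval_cell[OF g', of "Tail (fsx (fsx (R 26)))" s] zs
    by (auto simp: some_corner_def queries)
  have v: "nv (Parent Cotree Red (R 25)) \<sigma> = z0" using t by (simp add: queries z0_def)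
  have B: "bv (BAnd (some_corner Red) (BAnd (some_corner Green) (some_corner Blue))) ?\<tau> \<longleftrightarrow> tricol t"
    unfolding tri UNIV_site by (auto simp: corner)
  have "runs (If (BAnd (some_corner Red) (BAnd (some_corner Green) (some_corner Blue)))
        (Seq (NAssign 20 (NConst 1)) (NAssign 21 (R 25))) Skip) ?\<tau> ?Q"
    apply (rule runs_if; unfold B)
    subgoal using t by (intro runs_seq runs_assign) (auto simp: eqoff_def z0_def)
    subgoal using t by (intro runs_skip) (auto simp: eqoff_def z0_def)
    done
  then show ?thesis unfolding check_face_def z0_def[symmetric]
    by (intro runs_seq runs_assign) (subst v)
qed

abbreviation "Wvisit \<equiv> {3, 6, 7, 8, 9, 10, 11, 12, 13, 14, 15, 16, 26, 27, 28}"

lemma run_visit_neighbour: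
  assumes g: "good \<sigma>" and t: "fst \<sigma> 25 = t" "t \<in> faces H" "t \<noteq> h" and e: "fst \<sigma> 26 = e" "e \<in> DD"
    and x: "x = face H (tw (fs e))"
  shows "runs visit_neighbour \<sigma> (\<lambda>\<sigma>'. eqoff Wvisit \<sigma> \<sigma>' \<and> fst \<sigma>' 26 = fs e \<and>
    (fst \<sigma>' 3 = fst \<sigma> 3 \<and> (\<forall>f. tricol f \<longrightarrow> \<not> (x \<noteq> t \<and> C.anc t x \<and> f \<in> C.sub x)) \<or>
     fst \<sigma>' 3 = x \<and> x \<in> faces H \<and> x \<noteq> t \<and> C.anc t x \<and> (\<forall>f. tricol f \<longrightarrow> f \<in> C.sub x)))"
    (is "runs _ _ ?P")
proof -
  let ?\<tau> = "((fst \<sigma>)(26 := fs e, 12 := x), snd \<sigma>)"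
  have xF: "x \<in> faces H" using x e fs_DD tw_DD face_faces by simp
  have xh: "x \<noteq> h" if "x \<noteq> t" "C.anc t x" using that by (auto simp: C.anc_def)
  have g': "good ?\<tau>" using g by (simp add: good_def)
  have B: "bv (BAnd (BNot (beq (R 12) (R 25))) (banc (R 25) (R 12))) ?\<tau> \<longleftrightarrow> x \<noteq> t \<and> C.anc t x"
    using t xF by (auto simp: queries)
  have "runs (If (BAnd (BNot (beq (R 12) (R 25))) (banc (R 25) (R 12)))
        (Seq decide (If (bpos (R 16)) (NAssign 3 (R 12)) Skip)) Skip) ?\<tau> ?P"
    apply (rule runs_if; unfold B)
    subgoal premises p
      apply (rule runs_seq)
      apply (rule runs_mono[OF run_decide[OF g' _ xF xh]])
      subgoal by simp
      subgoal using p by blast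
      subgoal using p by blast
      subgoal premises q for \<rho>
      proof -
        have e1: "eqoff Wvisit \<sigma> \<rho>" "fst \<rho> 26 = fs e" "fst \<rho> 12 = x" "fst \<rho> 3 = fst \<sigma> 3"
          using q by (auto simp: eqoff_def)
        have e2: "eqoff Wvisit \<sigma> ((fst \<rho>)(3 := x), snd \<rho>)" using e1(1) by (auto simp: eqoff_def)
        show ?thesis
          apply (intro runs_if runs_assign runs_skip)
          using e1 e2 q p xF by auto
      qed
      done
    subgoal by (intro runs_skip) (auto simp: eqoff_def)
    done
  moreover have "nv (fsx (R 26)) \<sigma> = fs e" using e by (simp add: queries)
  moreover have "nv (Face (Twin (R 26))) ((fst \<sigma>)(26 := fs e), snd \<sigma>) = x" using x by simp
  ultimately show ?thesis unfolding visit_neighbour_def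
    by (intro runs_seq runs_assign) (simp only: fst_conv snd_conv)
qed

definition search_state :: "state \<Rightarrow> bool" where
  "search_state \<sigma> \<longleftrightarrow> good \<sigma> \<and> fst \<sigma> 3 \<in> faces H \<and> fst \<sigma> 3 \<noteq> h \<and>
     C.valid_region (fst \<sigma> 3) (fst \<sigma> 4) (fst \<sigma> 5) \<and> (fst \<sigma> 20 \<noteq> 0 \<longrightarrow> tricol (fst \<sigma> 21))"

abbreviation "Wsplit \<equiv> {6, 7, 8, 9, 10, 23, 24, 25}"

lemma run_find_split:
  assumes "search_state \<sigma>" and vus: "v = fst \<sigma> 3" "u = fst \<sigma> 4" "s = fst \<sigma> 5"
  defines "m \<equiv> C.median v u s" and "N \<equiv> card (C.region v u s)"
  shows "runs find_split \<sigma> (\<lambda>\<sigma>'. eqoff Wsplit \<sigma> \<sigma>' \<and> (\<exists>l. dq v \<le> l \<and> l \<le> dq m \<and>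
    N < 2 * C.weight u s (C.br m ! l) \<and> (l < dq m \<longrightarrow> \<not> N < 2 * C.weight u s (C.br m ! Suc l)) \<and>
    fst \<sigma>' 25 = C.split_node u s (C.br m ! l)))"
proof -
  have g: "good \<sigma>" and val: "C.valid_region v u s" using assms by (auto simp: search_state_def)
  then have V: "v \<in> faces H" "u \<in> faces H" by (auto simp: C.valid_region_def)
  have m: "m \<in> faces H" "C.anc v m" using C.median(1)[OF val] by (auto simp: m_def C.region_def C.sub_def)
  have N: "N = card (C.sub v) - s" "0 < N" using C.card_region_diff[OF val] C.region_pos[OF val] by (auto simp: N_def)
  have dvm: "dq v \<le> dq m" using C.anc_dp m by blast
  let ?p = "C.pos v + N div 2"
  let ?q = "if ?p < C.pos u then ?p else ?p + s"
  have mq: "m = C.pre ! ?q" by (simp add: m_def C.median_def Let_def N)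
  let ?\<sigma>1 = "((fst \<sigma>)(23 := N, 24 := ?q, 8 := m), snd \<sigma>)"
  have fm: "runs find_median \<sigma> (\<lambda>\<tau>. \<tau> = ?\<sigma>1)"
    unfolding find_median_def
    apply (intro runs_seq runs_assign)
    apply (rule runs_if)
    subgoal apply (intro runs_skip runs_assign) using vus mq by (auto simp: queries N fun_eq_iff)
    subgoal apply (intro runs_assign) using vus mq by (auto simp: queries N fun_eq_iff)
    done
  let ?\<sigma>2 = "((fst ?\<sigma>1)(6 := dq v, 7 := dq m - dq v), snd \<sigma>)"
  let ?P = "\<lambda>j. N < 2 * C.weight u s (C.br m ! j)"
  have ls: "runs (level_search Cotree heavy_test) ?\<sigma>2 (\<lambda>\<sigma>'. eqoff {6, 7, 9, 10} ?\<sigma>2 \<sigma>' \<and>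
     fst ?\<sigma>2 6 \<le> fst \<sigma>' 6 \<and> fst \<sigma>' 6 \<le> fst ?\<sigma>2 6 + fst ?\<sigma>2 7 \<and> (?P (fst ?\<sigma>2 6) \<longrightarrow> ?P (fst \<sigma>' 6)) \<and>
     (fst \<sigma>' 6 < fst ?\<sigma>2 6 + fst ?\<sigma>2 7 \<longrightarrow> \<not> ?P (Suc (fst \<sigma>' 6))))"
  proof (rule level_search)
    show "fst ?\<sigma>2 7 < 2 ^ k" using dq_less[OF m(1)] faces_bound by simp
    fix \<sigma>' j assume e: "eqoff {6, 7, 9, 10} ?\<sigma>2 \<sigma>'" and j: "j \<le> fst ?\<sigma>2 6 + fst ?\<sigma>2 7"
      and x: "fst \<sigma>' 10 = branch H Cotree (c Red) (fst ?\<sigma>2 8) ! j"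
    have x': "fst \<sigma>' 10 = C.br m ! j" using x m by (simp add: queries)
    have "C.br m ! j \<in> faces H" using C.br_nth(1)[OF m(1)] j dvm by simp
    moreover have "fst \<sigma>' 4 = u" "fst \<sigma>' 5 = s" "fst \<sigma>' 23 = N" using e vus by (auto simp: eqoff_def)
    ultimately show "bv heavy_test \<sigma>' \<longleftrightarrow> ?P j"
      using x' V by (auto simp: heavy_test_def queries C.weight_def)
  qed
  have vm: "C.br m ! dq v = v" using C.anc_iff m by blast
  \<comment> \<open>The search starts at the level of the top, whose weight is that of the whole
    region.\<close>
  have P0: "?P (dq v)" using N C.card_region[OF val] by (simp add: vm N_def)
  show ?thesis unfolding find_split_def
    apply (rule runs_seq)
    apply (rule runs_mono[OF fm])
    apply (erule ssubst)
    apply (intro runs_seq runs_assign)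
    apply (rule runs_mono[of _ _ "\<lambda>\<sigma>'. eqoff {6, 7, 9, 10} ?\<sigma>2 \<sigma>' \<and>
     fst ?\<sigma>2 6 \<le> fst \<sigma>' 6 \<and> fst \<sigma>' 6 \<le> fst ?\<sigma>2 6 + fst ?\<sigma>2 7 \<and> (?P (fst ?\<sigma>2 6) \<longrightarrow> ?P (fst \<sigma>' 6)) \<and>
     (fst \<sigma>' 6 < fst ?\<sigma>2 6 + fst ?\<sigma>2 7 \<longrightarrow> \<not> ?P (Suc (fst \<sigma>' 6)))"])
    subgoal using ls vus V m by (simp add: queries)
    subgoal premises p for _ \<rho>
    proof -
      have l: "dq v \<le> fst \<rho> 6" "fst \<rho> 6 \<le> dq m" "?P (fst \<rho> 6)" "fst \<rho> 6 < dq m \<longrightarrow> \<not> ?P (Suc (fst \<rho> 6))"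
        using p P0 dvm by auto
      have r: "fst \<rho> 8 = m" "fst \<rho> 4 = u" "fst \<rho> 5 = s" using p vus by (auto simp: eqoff_def)
      have a: "C.br m ! fst \<rho> 6 \<in> faces H" using C.br_nth(1)[OF m(1) l(2)] .
      let ?a = "C.br m ! fst \<rho> 6"
      have e: "eqoff Wsplit \<sigma> ((fst \<rho>)(25 := x), snd \<rho>)" "eqoff Wsplit \<sigma> ((fst \<rho>)(25 := x, 25 := y), snd \<rho>)" for x y
        using p by (auto simp: eqoff_def)
      have fin: "eqoff Wsplit \<sigma> \<tau> \<and> (\<exists>l. dq v \<le> l \<and> l \<le> dq m \<and>
        N < 2 * C.weight u s (C.br m ! l) \<and> (l < dq m \<longrightarrow> \<not> N < 2 * C.weight u s (C.br m ! Suc l)) \<and>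
        fst \<tau> 25 = C.split_node u s (C.br m ! l))"
        if "eqoff Wsplit \<sigma> \<tau>" "fst \<tau> 25 = C.split_node u s ?a" for \<tau>
        using that l by blast
      let ?\<tau> = "((fst \<rho>)(25 := ?a), snd \<rho>)"
      have v: "nv (LevelAncestor Cotree Red (R 8) (R 6)) \<rho> = ?a" using r m by (simp add: queries)
      have B: "bv (BAnd (bpos (R 5)) (BNot (banc (R 25) (R 4)))) ?\<tau> \<longleftrightarrow> s \<noteq> 0 \<and> \<not> C.anc ?a u"
        using r V by (simp add: queries)
      have L: "nv (LCA Cotree Red (R 25) (R 4)) ?\<tau> = C.lca ?a u" using r V a by (simp add: queries)
      show ?thesis
        apply (intro runs_seq runs_assign)
        apply (subst v)
        apply (rule runs_if; unfold B)
        subgoal premises b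
        proof -
          have "C.split_node u s ?a = C.lca ?a u" using b by (simp add: C.split_node_def)
          then show ?thesis by (intro runs_assign fin) (simp only: L fst_conv snd_conv, use e in simp, simp only: L fst_conv snd_conv fun_upd_same)
        qed
        subgoal premises b
        proof -
          have "C.split_node u s ?a = ?a" using b by (simp only: C.split_node_def if_False)
          then show ?thesis using e by (intro runs_skip fin) simp_all
        qed
        done
    qed
    done
qed


abbreviation "Whalve \<equiv> {3, 4, 5, 6, 7, 8, 9, 10, 11, 12, 13, 14, 15, 16, 20, 21, 23, 24, 25, 26, 27, 28}"

abbreviation "reg \<sigma> \<equiv> C.region (fst \<sigma> 3) (fst \<sigma> 4) (fst \<sigma> 5)"
abbreviation "pot \<sigma> \<equiv> C.potential (fst \<sigma> 3) (fst \<sigma> 4) (fst \<sigma> 5)"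

text \<open>The split node belongs to none of the smaller regions and is therefore tested itself.
  Progress is claimed only as long as nothing has been found.\<close>

lemma run_halve:
  assumes ss: "search_state \<sigma>"
  shows "runs halve \<sigma> (\<lambda>\<sigma>'. eqoff Whalve \<sigma> \<sigma>' \<and> search_state \<sigma>' \<and>
    (fst \<sigma> 20 \<noteq> 0 \<longrightarrow> fst \<sigma>' 20 \<noteq> 0) \<and>
    (\<forall>f. tricol f \<and> f \<in> reg \<sigma> \<longrightarrow>
      fst \<sigma>' 20 \<noteq> 0 \<or> f \<in> reg \<sigma>' \<and> 2 * pot \<sigma>' \<le> pot \<sigma>))"
    (is "runs halve \<sigma> ?Q")
proof -
  define v u s where vus: "v = fst \<sigma> 3" "u = fst \<sigma> 4" "s = fst \<sigma> 5"
  define m where "m = C.median v u s"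
  have g: "good \<sigma>" and val: "C.valid_region v u s" and vF: "v \<in> faces H" "v \<noteq> h"
    and sound: "fst \<sigma> 20 \<noteq> 0 \<Longrightarrow> tricol (fst \<sigma> 21)"
    using ss by (auto simp: search_state_def vus)
  have uF: "u \<in> faces H" using val by (simp add: C.valid_region_def)
  let ?outside = "Seq (NAssign 4 (R 25)) (NAssign 5 (size_of (R 25)))"
  let ?last = "If (BAnd (banc (R 3) (R 4)) (BNot (beq (R 3) (R 4)))) Skip (NAssign 5 (NConst 0))"
  let ?inside = "Seq (NAssign 3 (R 25)) (Seq check_face (Seq visit_neighbour (Seq visit_neighbour ?last)))"
  have rest: "runs (Seq (NAssign 12 (R 25)) (Seq decide
     (If (BAnd (BNot (beq (R 25) (R 3))) (BNot (bpos (R 16)))) ?outside ?inside))) \<rho> ?Q"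
    if e0: "eqoff Wsplit \<sigma> \<rho>" and l: "dq v \<le> l" "l \<le> dq m"
      and heavy: "card (C.region v u s) < 2 * C.weight u s (C.br m ! l)"
      and light: "l < dq m \<longrightarrow> \<not> card (C.region v u s) < 2 * C.weight u s (C.br m ! Suc l)"
      and t25: "fst \<rho> 25 = C.split_node u s (C.br m ! l)" for \<rho> l
  proof -
    define t where "t = C.split_node u s (C.br m ! l)"
    note prems = val l[unfolded m_def] heavy[unfolded m_def] light[unfolded m_def, rule_format]
    have t: "t \<in> faces H" "C.anc v t" "t \<in> C.region v u s"
      using C.split_node(1,2,4)[OF prems] by (simp_all add: t_def m_def)
    have outside: "C.valid_region v t (card (C.sub t))"
        "C.region v t (card (C.sub t)) = C.region v u s - C.sub t"
        "2 * C.potential v t (card (C.sub t)) \<le> C.potential v u s" if "t \<noteq> v"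
      using C.split_outside[OF prems] that by (simp_all add: t_def m_def)
    have inside: "C.region x u (if C.anc x u \<and> u \<noteq> x then s else 0) = C.region v u s \<inter> C.sub x"
      "2 * C.potential x u (if C.anc x u \<and> u \<noteq> x then s else 0) \<le> C.potential v u s"
      if "C.anc t x" "x \<noteq> t" "x \<in> C.region v u s" for x
      using C.split_inside[OF prems, of x] that by (simp_all only: t_def m_def simp_thms True_implies_equals implies_True_equals)
    have below: "x \<noteq> h" if "C.anc v x" for x using that vF by (auto simp: C.anc_def)
    have th: "t \<noteq> h" using below t by blast
    have t25': "fst \<rho> 25 = t" using t25 t_def by simp
    have g1: "good ((fst \<rho>)(12 := t), snd \<rho>)" using good_eqoff[OF g e0] by (simp add: good_def)
    have in_case: "runs ?inside \<rho>1 ?Q"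
      if e1: "eqoff Whalve \<sigma> \<rho>1"
        and r1: "fst \<rho>1 25 = t" "fst \<rho>1 4 = u" "fst \<rho>1 5 = s" "fst \<rho>1 20 = fst \<sigma> 20" "fst \<rho>1 21 = fst \<sigma> 21"
        and ft: "\<And>f. tricol f \<Longrightarrow> f \<in> C.region v u s \<Longrightarrow> f \<in> C.sub t" for \<rho>1
    proof -
      define z where "z = tw (qd t)"
      have z: "z \<in> DD" "face H z = t" using qd t th tw_DD C.dst_pd[OF t(1) th] by (auto simp: z_def)
      then have zt: "z \<in> face_darts H t" by (simp add: face_darts_def)
      note tri = triangle[OF t(1) th zt]
      define x1 x2 where x12: "x1 = face H (tw (fs z))" "x2 = face H (tw (fs (fs z)))"
      \<comment> \<open>\<open>z\<close> leads to the parent of \<open>t\<close>, so the children of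
        \<open>t\<close> lie across the two other darts of the triangle.\<close>
      have child: "\<exists>x\<in>{x1, x2}. x \<noteq> t \<and> C.anc t x \<and> f \<in> C.sub x" if ft: "f \<in> C.sub t" "f \<noteq> t" for f
      proof -
        have f: "C.anc t f" "f \<in> faces H" using ft by (auto simp: C.sub_def)
        obtain c' where c': "c' \<in> faces H" "c' \<noteq> h" "face H (qd c') = t" "C.anc c' f"
          using C.child_towards[OF f ft(2)] by blast
        have "qd c' \<in> face_darts H t" using qd c' by (simp add: face_darts_def)
        moreover have "qd c' \<noteq> z" using C.pd_ne_tw_pd[OF c'(1,2) t(1) th] by (simp add: z_def)
        ultimately have "qd c' = fs z \<or> qd c' = fs (fs z)" unfolding tri(1) by auto
        moreover have "face H (tw (qd c')) = c'" using C.dst_pd c' by simp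
        ultimately have "c' \<in> {x1, x2}" unfolding x12 by auto
        moreover have "C.anc t c'" using C.anc_par[OF c'(1,2)] c'(3) C.anc_refl t by simp
        moreover have "c' \<noteq> t" using C.not_anc_par[OF c'(1,2)] c'(3) C.anc_refl t by metis
        ultimately show ?thesis using c' f by (auto simp: C.sub_def)
      qed
      let ?\<rho>1 = "((fst \<rho>1)(3 := t), snd \<rho>1)"
      have g1: "good ?\<rho>1" using good_eqoff[OF g e1] by (simp add: good_def)
      have last: "runs ?last \<rho>4 ?Q"
        if e4: "eqoff Whalve \<sigma> \<rho>4" and r4: "fst \<rho>4 4 = u" "fst \<rho>4 5 = s"
          and flag: "if tricol t then fst \<rho>4 20 = 1 \<and> fst \<rho>4 21 = t else fst \<rho>4 20 = fst \<sigma> 20 \<and> fst \<rho>4 21 = fst \<sigma> 21"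
          and w: "fst \<rho>4 3 \<in> faces H" "C.anc t (fst \<rho>4 3)"
          and sub: "\<And>f. tricol f \<Longrightarrow> f \<in> C.sub t \<Longrightarrow> f \<noteq> t \<Longrightarrow> fst \<rho>4 3 \<noteq> t \<and> f \<in> C.sub (fst \<rho>4 3)" for \<rho>4
      proof -
        define w where "w = fst \<rho>4 3"
        define s' where "s' = (if C.anc w u \<and> u \<noteq> w then s else 0)"
        have wF: "w \<in> faces H" "C.anc t w" "C.anc v w" using w t C.anc_trans unfolding w_def by blast+
        have val': "C.valid_region w u s'" using val wF by (auto simp: C.valid_region_def s'_def)
        have fin: "?Q \<tau>" if \<tau>: "\<tau> = ((fst \<rho>4)(5 := s'), snd \<rho>4)" for \<tau>
        proof (intro conjI allI impI)
          show "eqoff Whalve \<sigma> \<tau>" using e4 \<tau> by (auto simp: eqoff_def)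
          then have "good \<tau>" using good_eqoff[OF g] by simp
          then show "search_state \<tau>" using wF below val' flag sound r4 \<tau> w_def
            by (auto simp: search_state_def split: if_splits)
          show "fst \<tau> 20 \<noteq> 0" if "fst \<sigma> 20 \<noteq> 0" using that flag \<tau> by (auto split: if_splits)
          fix f assume f: "tricol f \<and> f \<in> reg \<sigma>"
          show "fst \<tau> 20 \<noteq> 0 \<or> f \<in> reg \<tau> \<and> 2 * pot \<tau> \<le> pot \<sigma>"
          proof (cases "fst \<tau> 20 \<noteq> 0")
            case False
            then have "\<not> tricol t" "fst \<sigma> 20 = 0" using flag \<tau> by (auto split: if_splits)
            then have fr: "f \<in> C.region v u s" "f \<noteq> t" using f vus by auto
            have "w \<noteq> t" "f \<in> C.sub w" using sub[of f] ft[OF _ fr(1)] fr f unfolding w_def by auto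
            then have "w \<in> C.region v u s"
              using C.region_anc[OF val fr(1) _ wF(3)] by (simp add: C.sub_def)
            note ins = inside[OF wF(2) \<open>w \<noteq> t\<close> this, folded s'_def]
            have "reg \<tau> = C.region w u s'" "pot \<tau> = C.potential w u s'" using \<tau> r4 w_def by simp_all
            then show ?thesis using ins fr \<open>f \<in> C.sub w\<close> vus by simp
          qed simp
        qed
        have B: "bv (BAnd (banc (R 3) (R 4)) (BNot (beq (R 3) (R 4)))) \<rho>4 \<longleftrightarrow> C.anc w u \<and> u \<noteq> w"
          using r4 uF w_def by (auto simp: queries)
        show ?thesis
          apply (rule runs_if; unfold B)
          subgoal by (intro runs_skip fin) (auto simp: s'_def prod_eq_iff fun_eq_iff r4)
          subgoal premises b
          proof -
            have "s' = 0" using b unfolding s'_def by (rule if_not_P)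
            then show ?thesis by (intro runs_assign fin) simp
          qed
          done
      qed
      show ?thesis
        apply (intro runs_seq runs_assign)
        apply (subst nval.simps, subst r1(1))
        apply (rule runs_mono[OF run_check_face[OF g1 _ t(1) th]])
        subgoal using r1 by simp
        subgoal premises p for \<rho>2
        proof -
          have e2: "eqoff Whalve \<sigma> \<rho>2" using p e1 by (auto simp: eqoff_def)
          have r2: "fst \<rho>2 25 = t" "fst \<rho>2 26 = z" "fst \<rho>2 3 = t" "fst \<rho>2 4 = u" "fst \<rho>2 5 = s"
            using p r1 by (auto simp: eqoff_def z_def)
          have flag: "if tricol t then fst \<rho>2 20 = 1 \<and> fst \<rho>2 21 = t else fst \<rho>2 20 = fst \<sigma> 20 \<and> fst \<rho>2 21 = fst \<sigma> 21"
            using p r1 by simp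
          show ?thesis
            apply (intro runs_seq)
            apply (rule runs_mono[OF run_visit_neighbour[OF good_eqoff[OF g e2] r2(1) t(1) th r2(2) z(1) x12(1)]])
            subgoal by simp
            subgoal by simp
            subgoal by simp
            subgoal premises q for \<rho>3
            proof -
              have e3: "eqoff Whalve \<sigma> \<rho>3" using q e2 by (auto simp: eqoff_def)
              have r3: "fst \<rho>3 25 = t" "fst \<rho>3 26 = fs z" "fst \<rho>3 4 = u" "fst \<rho>3 5 = s" "fst \<rho>3 20 = fst \<rho>2 20" "fst \<rho>3 21 = fst \<rho>2 21"
                using q r2 by (auto simp: eqoff_def)
              have s3: "fst \<rho>3 3 = t \<and> (\<forall>f. tricol f \<longrightarrow> \<not> (x1 \<noteq> t \<and> C.anc t x1 \<and> f \<in> C.sub x1)) \<or>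
                fst \<rho>3 3 = x1 \<and> x1 \<in> faces H \<and> x1 \<noteq> t \<and> C.anc t x1 \<and> (\<forall>f. tricol f \<longrightarrow> f \<in> C.sub x1)"
                using q r2(3) by simp
              show ?thesis
                apply (intro runs_seq)
                apply (rule runs_mono[OF run_visit_neighbour[OF good_eqoff[OF g e3] r3(1) t(1) th r3(2) fs_DD[OF z(1)] x12(2)]])
                subgoal by simp
                subgoal by simp
                subgoal by simp
                subgoal premises q' for \<rho>4
                proof (rule last)
                  show "eqoff Whalve \<sigma> \<rho>4" using q' e3 by (auto simp: eqoff_def)
                  have r4: "fst \<rho>4 4 = u" "fst \<rho>4 5 = s" "fst \<rho>4 20 = fst \<rho>3 20" "fst \<rho>4 21 = fst \<rho>3 21"
                    using q' r3 by (auto simp: eqoff_def)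
                  then show "fst \<rho>4 4 = u" "fst \<rho>4 5 = s" by auto
                  show "if tricol t then fst \<rho>4 20 = 1 \<and> fst \<rho>4 21 = t else fst \<rho>4 20 = fst \<sigma> 20 \<and> fst \<rho>4 21 = fst \<sigma> 21"
                    using flag r4 r3 by simp
                  have s4: "fst \<rho>4 3 = fst \<rho>3 3 \<and> (\<forall>f. tricol f \<longrightarrow> \<not> (x2 \<noteq> t \<and> C.anc t x2 \<and> f \<in> C.sub x2)) \<or>
                    fst \<rho>4 3 = x2 \<and> x2 \<in> faces H \<and> x2 \<noteq> t \<and> C.anc t x2 \<and> (\<forall>f. tricol f \<longrightarrow> f \<in> C.sub x2)"
                    using q' by simp
                  show "fst \<rho>4 3 \<in> faces H" "C.anc t (fst \<rho>4 3)" using s3 s4 t C.anc_refl by metis+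
                  show "fst \<rho>4 3 \<noteq> t \<and> f \<in> C.sub (fst \<rho>4 3)" if "tricol f" "f \<in> C.sub t" "f \<noteq> t" for f
                    using child[OF that(2,3)] s3 s4 that(1) by (metis insertE singletonD)
                qed
                done
            qed
            done
        qed
        done
    qed
    show ?thesis
      apply (intro runs_seq runs_assign)
      apply (subst nval.simps, subst t25')
      apply (rule runs_mono[OF run_decide[OF g1 _ t(1) th]])
      subgoal by simp
      subgoal premises p for \<rho>1
      proof -
        have e1: "eqoff Whalve \<sigma> \<rho>1" using p e0 by (auto simp: eqoff_def)
        have r1: "fst \<rho>1 25 = t" "fst \<rho>1 4 = u" "fst \<rho>1 5 = s" "fst \<rho>1 20 = fst \<sigma> 20" "fst \<rho>1 21 = fst \<sigma> 21" "fst \<rho>1 3 = v"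
          using p e0 t25' vus by (auto simp: eqoff_def)
        have dec: "0 < fst \<rho>1 16 \<longleftrightarrow> f \<in> C.sub t" if "tricol f" for f using p that by blast
        have B: "bv (BAnd (BNot (beq (R 25) (R 3))) (BNot (bpos (R 16)))) \<rho>1 \<longleftrightarrow> t \<noteq> v \<and> fst \<rho>1 16 = 0"
          using r1 by auto
        show ?thesis
          apply (rule runs_if; unfold B)
          subgoal premises b
          proof -
            note out = outside[OF conjunct1[OF b]]
            let ?\<tau> = "((fst \<rho>1)(4 := t, 5 := card (C.sub t)), snd \<rho>1)"
            have "?Q ?\<tau>"
            proof (intro conjI allI impI)
              show e: "eqoff Whalve \<sigma> ?\<tau>" using e1 by (auto simp: eqoff_def)
              show "search_state ?\<tau>" using good_eqoff[OF g e] vF out(1) sound r1 by (simp add: search_state_def)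
              show "fst ?\<tau> 20 \<noteq> 0" if "fst \<sigma> 20 \<noteq> 0" using that r1 by simp
              fix f assume f: "tricol f \<and> f \<in> reg \<sigma>"
              show "fst ?\<tau> 20 \<noteq> 0 \<or> f \<in> reg ?\<tau> \<and> 2 * pot ?\<tau> \<le> pot \<sigma>"
              proof (cases "fst \<sigma> 20 \<noteq> 0")
                case False
                then have "f \<in> C.region v u s" using f vus by simp
                moreover have "f \<notin> C.sub t" using dec f b by simp
                moreover have "reg ?\<tau> = C.region v t (card (C.sub t))" "pot ?\<tau> = C.potential v t (card (C.sub t))"
                  using r1 by simp_all
                ultimately show ?thesis using out vus by simp
              qed (use r1 in simp)
            qed
            then show ?thesis using r1 by (intro runs_seq runs_assign) (simp add: queries)
          qed
          subgoal premises b
          proof (rule in_case[OF e1 r1(1-5)])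
            \<comment> \<open>Either the decision was positive, or \<open>t\<close> is the top
              \<open>v\<close> and the whole region lies below it.\<close>
            fix f assume "tricol f" "f \<in> C.region v u s"
            then show "f \<in> C.sub t" using b dec[of f] by (cases "t = v") (auto simp: C.region_def)
          qed
          done
      qed
      done
  qed
  show ?thesis unfolding halve_def
    apply (rule runs_seq)
    apply (rule runs_mono[OF run_find_split[OF ss vus]])
    using rest unfolding m_def by blast
qed

lemma potential_0: "C.potential v u s < 1 \<Longrightarrow> C.region v u s = {}"
  using C.finite_region[of v u s] by (auto simp: C.potential_def split: if_splits)

lemma run_region_search:
  assumes g: "good \<sigma>" and v: "fst \<sigma> 3 \<in> faces H" "fst \<sigma> 3 \<noteq> h"
    and sound: "fst \<sigma> 20 \<noteq> 0 \<longrightarrow> tricol (fst \<sigma> 21)"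
  shows "runs region_search \<sigma> (\<lambda>\<sigma>'. eqoff (insert 22 Whalve) \<sigma> \<sigma>' \<and>
    (fst \<sigma>' 20 \<noteq> 0 \<longrightarrow> tricol (fst \<sigma>' 21)) \<and>
    (\<forall>f. tricol f \<and> (fst \<sigma> 20 \<noteq> 0 \<or> f \<in> C.sub (fst \<sigma> 3)) \<longrightarrow> fst \<sigma>' 20 \<noteq> 0))"
proof -
  let ?T = "\<lambda>f. tricol f \<and> (fst \<sigma> 20 \<noteq> 0 \<or> f \<in> C.sub (fst \<sigma> 3))"
  let ?I = "\<lambda>\<tau>. search_state \<tau> \<and> eqoff (insert 22 Whalve) \<sigma> \<tau> \<and> fst \<tau> 22 < 2 ^ k \<and>
    (\<forall>f. ?T f \<longrightarrow> fst \<tau> 20 \<noteq> 0 \<or> f \<in> reg \<tau> \<and> pot \<tau> < (fst \<tau> 22 + 1)\<^sup>2)"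
  let ?body = "Seq (NAssign 22 (NHalf (R 22))) (Seq halve halve)"
  have loop: "runs (While (bpos (R 22)) ?body) \<tau> (\<lambda>\<sigma>'. ?I \<sigma>' \<and> \<not> bv (bpos (R 22)) \<sigma>')" if I0: "?I \<tau>" for \<tau>
  proof (rule runs_while[where m = "\<lambda>\<tau>. fst \<tau> 22"])
    show "?I \<tau>" by (rule I0)
    show "fst \<tau> 22 < 2 ^ k" using I0 by blast
    fix \<tau> assume I: "?I \<tau>" and b: "bv (bpos (R 22)) \<tau>"
    let ?\<tau> = "((fst \<tau>)(22 := fst \<tau> 22 div 2), snd \<tau>)"
    have s: "search_state ?\<tau>" using I by (simp add: search_state_def good_def)
    have v: "nv (NHalf (R 22)) \<tau> = fst \<tau> 22 div 2" by simp
    have "runs ?body \<tau> (\<lambda>\<sigma>'. ?I \<sigma>' \<and> fst \<sigma>' 22 \<le> fst \<tau> 22 div 2)"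
      apply (intro runs_seq runs_assign)
      apply (subst v)
      apply (rule runs_mono[OF run_halve[OF s]])
      subgoal premises p for \<rho>
        apply (rule runs_mono[OF run_halve])
        subgoal using p by blast
        subgoal premises q for \<rho>'
        proof -
          have 22: "fst \<rho>' 22 = fst \<tau> 22 div 2" using p q by (simp add: eqoff_def)
          have e: "eqoff (insert 22 Whalve) \<sigma> \<rho>'" using p q I by (auto simp: eqoff_def)
          have "fst \<rho>' 20 \<noteq> 0 \<or> f \<in> reg \<rho>' \<and> pot \<rho>' < (fst \<rho>' 22 + 1)\<^sup>2" if f: "?T f" for f
          proof (cases "fst \<rho>' 20 \<noteq> 0")
            case False
            let ?n = "fst \<tau> 22"
            have "fst \<rho> 20 = 0" using q False by blast
            moreover from this have \<tau>0: "fst \<tau> 20 = 0" using p by auto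
            moreover have fI: "f \<in> reg \<tau> \<and> pot \<tau> < (?n + 1)\<^sup>2" using I f \<tau>0 by blast
            moreover have "tricol f" using f by blast
            moreover from this have "fst \<rho> 20 \<noteq> 0 \<or> f \<in> reg \<rho> \<and> 2 * pot \<rho> \<le> pot \<tau>" using p fI by auto
            ultimately have q1: "f \<in> reg \<rho>' \<and> 2 * pot \<rho>' \<le> pot \<rho> \<and> 2 * pot \<rho> \<le> pot \<tau> \<and> pot \<tau> < (?n + 1)\<^sup>2"
              using q False by blast
            then have "4 * pot \<rho>' < (?n + 1)\<^sup>2" by linarith
            \<comment> \<open>From \<open>?n + 1 \<le> 2 * (?n div 2 + 1)\<close>: two halvings of
              the potential keep pace with one halving of the clock.\<close>
            also have "(?n + 1)\<^sup>2 \<le> (2 * (?n div 2 + 1))\<^sup>2" by (rule power_mono) auto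
            also have "\<dots> = 4 * (?n div 2 + 1)\<^sup>2" by (simp only: power_mult_distrib) simp
            finally show ?thesis using q1 22 by simp
          qed simp
          then show ?thesis using q 22 e I by auto
        qed
        done
      done
    then show "0 < fst \<tau> 22 \<and> runs ?body \<tau> (\<lambda>\<sigma>'. ?I \<sigma>' \<and> fst \<sigma>' 22 \<le> fst \<tau> 22 div 2)" using b by simp
  qed
  let ?\<tau> = "((fst \<sigma>)(4 := fst \<sigma> 3, 5 := 0, 22 := card (faces H)), snd \<sigma>)"
  have 0: "face H (fst \<sigma> 0) = h" using g face_c by (simp add: good_def)
  have init: "?I ?\<tau>"
  proof (intro conjI allI impI)
    show "search_state ?\<tau>" using g v sound by (simp add: search_state_def good_def C.valid_region_def)
    show "eqoff (insert 22 Whalve) \<sigma> ?\<tau>" by (auto simp: eqoff_def)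
    show "fst ?\<tau> 22 < 2 ^ k" using faces_bound by simp
    fix f assume f: "?T f"
    have "card (C.sub (fst \<sigma> 3)) \<le> card (faces H)" using C.sub_V finite_faces by (intro card_mono) auto
    then have "(card (C.sub (fst \<sigma> 3)))\<^sup>2 < (card (faces H) + 1)\<^sup>2" by (intro power_strict_mono) auto
    then show "fst ?\<tau> 20 \<noteq> 0 \<or> f \<in> reg ?\<tau> \<and> pot ?\<tau> < (fst ?\<tau> 22 + 1)\<^sup>2"
      using f by (auto simp: C.region_def C.potential_def)
  qed
  show ?thesis unfolding region_search_def
    apply (intro runs_seq runs_assign)
    apply (rule runs_mono[OF loop])
    subgoal using init 0 by (simp add: queries C.sub_rt)
    \<comment> \<open>When the clock is \<open>0\<close>, the potential is below \<open>1\<close>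
      and the region is empty, so the face must have been found.\<close>
    subgoal using potential_0 by (fastforce simp: search_state_def)
    done
qed

text \<open>One of the guesses \<open>0\<close> and \<open>1\<close> equals
  \<open>of_bool forward\<close>. The other search cannot spoil the result, because register 20 is
  set only after a successful check and never cleared.\<close>

lemma run_find_trichromatic:
  assumes g: "good \<sigma>" and "fst \<sigma> 20 = 0"
  shows "runs find_trichromatic \<sigma> (\<lambda>\<sigma>'. \<forall>f. answer \<sigma>' = Some f \<longleftrightarrow> tricol f)"
proof -
  let ?P = "\<lambda>\<tau>. (fst \<tau> 20 \<noteq> 0 \<longrightarrow> tricol (fst \<tau> 21)) \<and> (\<forall>f. tricol f \<longrightarrow> fst \<tau> 20 \<noteq> 0)"
  have fin: "runs (Seq (NAssign 0 (R 20)) (NAssign 1 (R 21))) \<tau> (\<lambda>\<sigma>'. \<forall>f. answer \<sigma>' = Some f \<longleftrightarrow> tricol f)" if "?P \<tau>" for \<tau>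
    using that tricol_unique by (intro runs_seq runs_assign) (auto simp: answer_def)
  let ?anchor = "\<lambda>\<tau>. \<forall>f. tricol f \<longrightarrow> fst \<tau> 17 \<noteq> h \<and> (\<exists>a\<in>DD. face H a = fst \<tau> 17 \<and> col (st a) \<noteq> Red)"
  let ?J = "\<lambda>\<tau>. good \<tau> \<and> ?anchor \<tau> \<and> (fst \<tau> 20 \<noteq> 0 \<longrightarrow> tricol (fst \<tau> 21))"
  have stage: "runs (Seq (child_search b) region_search) \<tau>
     (\<lambda>\<sigma>'. ?J \<sigma>' \<and> (fst \<tau> 20 \<noteq> 0 \<longrightarrow> fst \<sigma>' 20 \<noteq> 0) \<and> (\<forall>f. tricol f \<and> b = of_bool forward \<longrightarrow> fst \<sigma>' 20 \<noteq> 0))"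
    if J: "?J \<tau>" and F: "1 < card (faces H)" for \<tau> b
    apply (rule runs_seq)
    apply (rule runs_mono[OF run_child_search[OF _ F]])
    subgoal using J by blast
    subgoal using J by blast
    subgoal premises p for \<rho>
    proof -
      have gr: "good \<rho>" using good_eqoff[of \<tau> Wchild \<rho>] J p by simp
      have r: "fst \<rho> 20 = fst \<tau> 20" "fst \<rho> 21 = fst \<tau> 21" "fst \<rho> 17 = fst \<tau> 17" using p by (auto simp: eqoff_def)
      have snd: "fst \<rho> 20 \<noteq> 0 \<longrightarrow> tricol (fst \<rho> 21)" using J r by simp
      show ?thesis
        apply (rule runs_mono[OF run_region_search[OF gr _ _ snd]])
        subgoal using p by blast
        subgoal using p by blast
        subgoal premises q for \<rho>'
        proof -
          have "good \<rho>'" using good_eqoff[of \<rho> "insert 22 Whalve" \<rho>'] gr q by simp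
          moreover have "fst \<rho>' 17 = fst \<tau> 17" using q r by (simp add: eqoff_def)
          moreover have "fst \<tau> 20 \<noteq> 0 \<longrightarrow> fst \<rho>' 20 \<noteq> 0" using q r snd by auto
          ultimately show ?thesis using q p J by auto
        qed
        done
    qed
    done
  \<comment> \<open>The program nests its four searches to the right; regrouping them in pairs
    changes neither the run nor the bound.\<close>
  have assoc: "runs (Seq p (Seq q r)) \<tau> Q" if "runs (Seq p q) \<tau> (\<lambda>\<tau>'. runs r \<tau>' Q)" for p q r \<tau> Q
  proof -
    from that obtain t \<tau>' where t: "exec H c D (Seq p q) \<tau> t \<tau>'" "t \<le> time_bound D k (Seq p q)" "runs r \<tau>' Q"
      unfolding runs_def by blast
    obtain t1 t2 \<tau>1 where x: "t = t1 + t2" "exec H c D p \<tau> t1 \<tau>1" "exec H c D q \<tau>1 t2 \<tau>'"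
      using t(1) by (cases rule: exec.cases) auto
    obtain t3 \<tau>2 where y: "exec H c D r \<tau>' t3 \<tau>2" "t3 \<le> time_bound D k r" "Q \<tau>2" using t(3) unfolding runs_def by blast
    have "exec H c D (Seq p (Seq q r)) \<tau> (t1 + (t2 + t3)) \<tau>2"
      using x y by (intro exec.Seq) auto
    moreover have "t1 + (t2 + t3) \<le> time_bound D k (Seq p (Seq q r))" using x t y by simp
    ultimately show ?thesis unfolding runs_def using y by blast
  qed
  have 0: "face H (fst \<sigma> 0) = h" using g face_c by (simp add: good_def)
  have B: "bv (NLess (NConst 1) (size_of (Face (R 0)))) \<sigma> \<longleftrightarrow> 1 < card (faces H)"
    using 0 by (simp add: queries C.sub_rt)
  show ?thesis unfolding find_trichromatic_def
    apply (rule runs_seq)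
    apply (rule runs_mono[where Q = ?P])
     prefer 2
    subgoal by (rule fin)
    apply (rule runs_if; unfold B)
    subgoal premises F
      apply (rule runs_seq)
      apply (rule runs_mono[OF run_find_anchor[OF g]])
      subgoal premises p for \<rho>
      proof -
        have "good \<rho>" using good_eqoff[OF g, of "{6, 7, 8, 9, 10, 17, 26}" \<rho>] p by simp
        moreover have "fst \<rho> 20 = 0" using p assms(2) by (simp add: eqoff_def)
        ultimately have J: "?J \<rho>" using p by simp
        show ?thesis
          apply (rule assoc)
          apply (rule runs_mono[OF stage[OF J F]])
          subgoal premises q for \<rho>1
            apply (rule runs_mono[OF stage[OF _ F]])
            subgoal using q by blast
            subgoal premises r for \<rho>2
              using q r by (cases forward) (auto simp: of_bool_def)
            done
          done
      qed
      done
    \<comment> \<open>With \<open>h\<close> as the only face the preorder has no position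
      \<open>1\<close> to probe, so the search is skipped.\<close>
    subgoal premises F
    proof (rule runs_skip)
      have "\<not> tricol f" for f
      proof
        assume "tricol f"
        then have "{f, h} \<subseteq> faces H" "f \<noteq> h" using h_faces by (auto simp: trichromatic_def)
        then have "card {f, h} \<le> card (faces H)" using finite_faces by (intro card_mono)
        then show False using F \<open>f \<noteq> h\<close> by simp
      qed
      then show "?P \<sigma>" using assms by simp
    qed
    done
qed

end

section \<open>The running time in terms of the number of vertices\<close>

theorem theorem3p1:
  shows "\<exists>(p :: com) (C :: real).
    \<forall>(H :: plane_digraph) (h :: nat) (S :: site \<Rightarrow> nat) (c :: site \<Rightarrow> nat)
      (\<omega> :: site \<Rightarrow> real) (D :: nat).
      embedded_in_plane H \<and> no_negative_cycle H \<and> unique_shortest_paths H \<and>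
      inj S \<and> h \<in> faces H \<and>
      (\<forall>s. c s \<in> face_darts H h \<and> tail (graph H) (c s) = S s) \<and>
      (\<forall>s. \<forall>v\<in>verts (graph H). S s \<rightarrow>\<^sup>*\<^bsub>graph H\<^esub> v) \<and>
      (\<forall>f\<in>faces H - {h}. triangular_face H f) \<and>
      (\<forall>s. 0 \<le> \<omega> s) \<and> 1 \<le> D \<longrightarrow>
      (\<exists>t \<sigma>. exec H c D p (initial_state c \<omega>) t \<sigma> \<and>
         real t \<le> C * (log 2 (real (card (verts (graph H)))))\<^sup>2 * real D \<and>
         (\<forall>f. answer \<sigma> = Some f \<longleftrightarrow> trichromatic H h S \<omega> f))"
proof (intro exI[of _ find_trichromatic] exI[of _ "16 * real (time_bound 1 1 find_trichromatic)"] allI impI)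
  fix H :: plane_digraph and h :: nat and S c :: "site \<Rightarrow> nat" and \<omega> :: "site \<Rightarrow> real" and D :: nat
  assume A: "embedded_in_plane H \<and> no_negative_cycle H \<and> unique_shortest_paths H \<and>
      inj S \<and> h \<in> faces H \<and>
      (\<forall>s. c s \<in> face_darts H h \<and> tail (graph H) (c s) = S s) \<and>
      (\<forall>s. \<forall>v\<in>verts (graph H). S s \<rightarrow>\<^sup>*\<^bsub>graph H\<^esub> v) \<and>
      (\<forall>f\<in>faces H - {h}. triangular_face H f) \<and>
      (\<forall>s. 0 \<le> \<omega> s) \<and> 1 \<le> D"
  interpret voronoi H h S c \<omega> by unfold_locales (use A in auto)
  obtain qd dq where C: "dart_tree (faces H) (darts H - tree_darts H (S Red)) (face H) (face H \<circ> twin H) (twin H) h qd dq"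
    using R.cotree[OF h_faces] by blast
  let ?n = "card (verts (graph H))"
  have "card (range S) \<le> ?n" using S_V finite_V by (intro card_mono) auto
  moreover have "card (range S) = 3" using card_image[OF inj_S] unfolding UNIV_site by simp
  ultimately have n: "3 \<le> ?n" by simp
  \<comment> \<open>The logarithm rounded down. Twice the number of vertices is below
    \<open>2 ^ (m + 2)\<close>, so \<open>m + 2\<close> rounds suffice for every loop, and
    \<open>time_bound_le\<close> turns this into a factor \<open>m + 3\<close> per nesting
    level.\<close>
  obtain m where m: "2 ^ m \<le> ?n" "?n < 2 ^ (m + 1)" using ex_power_ivl1[of 2 ?n] n by auto
  have "voronoi_run H h S c qd dq (m + 2)"
    unfolding voronoi_run_def voronoi_run_axioms_def voronoi_cotree_def
    using m C voronoi_axioms by simp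
  then interpret X: voronoi_run H h S c \<omega> qd dq D "m + 2" .
  have good: "X.good (initial_state c \<omega>)" "fst (initial_state c \<omega>) 20 = 0"
    by (simp_all add: X.good_def initial_state_def)
  obtain t \<sigma> where t: "exec H c D find_trichromatic (initial_state c \<omega>) t \<sigma>"
    "t \<le> time_bound D (m + 2) find_trichromatic" "\<forall>f. answer \<sigma> = Some f \<longleftrightarrow> trichromatic H h S \<omega> f"
    using X.run_find_trichromatic[OF good] unfolding X.runs_def by blast
  let ?B = "time_bound 1 1 find_trichromatic" and ?L = "log 2 (real ?n)"
  have "t \<le> ?B * D * (m + 3)\<^sup>2"
    using t(2) time_bound_le[of D "m + 2" find_trichromatic] A by (simp add: nesting_find_trichromatic numeral_3_eq_3)
  then have "real t \<le> real (?B * D * (m + 3)\<^sup>2)" by (simp only: of_nat_le_iff)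
  also have "\<dots> = real ?B * real D * (real m + 3)\<^sup>2" by simp
  \<comment> \<open>Three distinct sites make the logarithm at least \<open>1\<close>, so
    \<open>m + 3\<close> is at most four logarithms; squared, this is the factor 16.\<close>
  also have "\<dots> \<le> real ?B * real D * (4 * ?L)\<^sup>2"
  proof -
    have "(2::real) ^ m \<le> real ?n" using m(1) by (metis of_nat_le_iff of_nat_numeral of_nat_power)
    then have "real m \<le> ?L" by (rule le_log_of_power) simp
    moreover have "1 \<le> ?L" using n by (simp add: le_log_iff)
    ultimately have "real m + 3 \<le> 4 * ?L" by simp
    then show ?thesis by (intro mult_left_mono power_mono) auto
  qed
  also have "\<dots> = 16 * real ?B * ?L\<^sup>2 * real D" by (simp add: power_mult_distrib)
  finally show "\<exists>t \<sigma>. exec H c D find_trichromatic (initial_state c \<omega>) t \<sigma> \<and>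
     real t \<le> 16 * real ?B * (log 2 (real ?n))\<^sup>2 * real D \<and>
     (\<forall>f. answer \<sigma> = Some f \<longleftrightarrow> trichromatic H h S \<omega> f)"
    using t by blast
qed

end
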